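(* Let $M$ be an $n|m$-dimensional supermanifold with a projective class $\Pi^k_{ij}$ and an odd Poisson bracket of functions $[f,g]=(-1)^{\tilde f}((S,f),g)$ defined by a master Hamiltonian $S=S^{ij}p_jp_i$. Then the projective Laplacian is a Batalin–Vilkovisky operator if and only if $$S^{jk}\partial_k\partial_jT^i+T^j\partial_jT^i=0,$$ $$S^{kl}\partial_l\partial_kS^{ij}+T^k\partial_kS^{ij}+S^{ik}\partial_kT^j(-1)^{\tilde\jmath}+S^{jk}\partial_kT^i(-1)^{\tilde\imath(\tilde\jmath+1)}=0,$$ where $$T^i=\frac{2}{n-m+3}\,\partial_jS^{ji}-\frac{n-m+1}{n-m+3}\,S^{jk}\Pi^i_{kj}.$$
   Context: Local coordinates on $M$ are $x^i$, $\tilde\imath$ is the parity of $x^i$, $\tilde f$ the parity of $f$, $\partial_i=\partial/\partial x^i$, repeated indices are summed, and $p_i$ are the momenta on $T^*M$ conjugate to $x^i$. Projective class: for a symmetric linear connection with coefficients $\Gamma^k_{ij}$ on an $n|m$-dimensional supermanifold put $$\Pi^k_{ji}=\Gamma^k_{ji}-\frac{1}{n-m+1}\left(\Gamma^s_{js}\delta^k_i(-1)^{\tilde s}+\Gamma^s_{is}\delta^k_j(-1)^{\tilde\imath\tilde\jmath+\tilde s}\right).$$ Two symmetric connections define the same projective class if their $\Pi^k_{ji}$ coincide; the projective class is identified with the $\Pi^k_{ji}$. (Values of $n-m$ for which a denominator vanishes are implicitly excluded.) The odd master Hamiltonian $S=S^{ij}p_jp_i\in C^\infty(T^*M)$ specifies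 the odd symmetric bracket $$\{f,g\}=((S,f),g)=S^{ij}\partial_jf\,\partial_ig\,(-1)^{\tilde\imath(\tilde f+1)},$$ where $(\cdot,\cdot)$ is the canonical even Poisson bracket on $T^*M$, and $[f,g]=(-1)^{\tilde f}\{f,g\}$. An odd Poisson bracket is an odd bilinear map satisfying $[a,b]=-(-1)^{(\tilde a+1)(\tilde b+1)}[b,a]$, $[a,[b,c]]=[[a,b],c]+(-1)^{(\tilde a+1)(\tilde b+1)}[b,[a,c]]$ and $[a,bc]=[a,b]c+(-1)^{(\tilde a+1)\tilde b}b[a,c]$. The projective Laplacian associated with the odd tensor $S^{ij}$ and the projective class is the operator $\Delta=S^{ij}\partial_j\partial_i+T^i\partial_i$ on $C^\infty(M)$. It is a Batalin–Vilkovisky operator if it generates the bracket, $[a,b]=(-1)^{\tilde a}\left(\Delta(ab)-\Delta(a)b-(-1)^{\tilde a}a\Delta(b)\right)$, and $\Delta^2=0$.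
   Formalization: In the second condition the signs (-1)^j and (-1)^{i(j+1)} are corrected to (-1)^i and (-1)^{j(i+1)}; as printed it fails for mixed parity, e.g. for Δ=∂_x∂_ξ+∂_y∂_η on R^{2|2} in the coordinate x'=x+x²ξη, where the (x',ξ) component equals 2η. *)

theory Defs
  imports "HOL-Analysis.Analysis" "HOL-Library.Function_Algebras"
begin

section \<open>Superdomains\<close>

text \<open>
  Points of \<open>R^n\<close> are functions \<open>nat \<Rightarrow> real\<close> vanishing at all indices \<open>\<ge> n\<close>, as in
  \<^const>\<open>Euclidean_space\<close>; this admits all \<open>n\<close> and \<open>m\<close>, including \<open>0\<close>.
  A function \<open>f\<close> on a superdomain over an open \<open>V\<close> in \<open>R^n\<close> with odd coordinates
  \<open>\<xi>_0, \<dots>, \<xi>_(m-1)\<close> is given by its coefficients: \<open>f = \<Sum>I. f I(x) \<xi>_I\<close>, where \<open>I\<close> ranges over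
  the subsets of \<open>{..<m}\<close> and \<open>\<xi>_I\<close> is the product of the \<open>\<xi>_i\<close>, \<open>i \<in> I\<close>, in increasing order.
  Values outside \<open>V\<close> or at other \<open>I\<close> are irrelevant, so such functions are compared with
  \<open>sf_eq m V\<close> only. Addition and zero are pointwise (\<^theory>\<open>HOL-Library.Function_Algebras\<close>); the
  product of superfunctions is \<open>\<star>\<close>, not the pointwise one.
\<close>

type_synonym sfun = "nat set \<Rightarrow> (nat \<Rightarrow> real) \<Rightarrow> real"

text \<open>\<open>Inl i\<close> labels the even coordinate \<open>x_i\<close>, \<open>Inr j\<close> the odd coordinate \<open>\<xi>_j\<close>.\<close>

type_synonym idx = "nat + nat"

definition coords :: "nat \<Rightarrow> nat \<Rightarrow> idx set" where
  "coords n m = {..<n} <+> {..<m}"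

fun par :: "idx \<Rightarrow> nat" where
  "par (Inl i) = 0"
| "par (Inr j) = 1"

abbreviation sg :: "nat \<Rightarrow> real" where
  "sg k \<equiv> (-1) ^ k"

definition sf_eq :: "nat \<Rightarrow> (nat \<Rightarrow> real) set \<Rightarrow> sfun \<Rightarrow> sfun \<Rightarrow> bool" where
  "sf_eq m V f g \<longleftrightarrow> (\<forall>I\<subseteq>{..<m}. \<forall>x\<in>V. f I x = g I x)"

definition scl :: "real \<Rightarrow> sfun \<Rightarrow> sfun" where
  "scl c f = (\<lambda>I x. c * f I x)"

definition sf_const :: "real \<Rightarrow> sfun" where
  "sf_const c = (\<lambda>I x. if I = {} then c else 0)"

definition sf_mult :: "sfun \<Rightarrow> sfun \<Rightarrow> sfun" (infixl "\<star>" 70) where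
  "f \<star> g = (\<lambda>K x. \<Sum>I\<in>Pow K. sg (card {(i, j). i \<in> I \<and> j \<in> K - I \<and> j < i}) * f I x * g (K - I) x)"

fun coord_fun :: "idx \<Rightarrow> sfun" where
  "coord_fun (Inl i) = (\<lambda>I x. if I = {} then x i else 0)"
| "coord_fun (Inr j) = (\<lambda>I x. if I = {j} then 1 else 0)"

definition pderiv1 :: "nat \<Rightarrow> ((nat \<Rightarrow> real) \<Rightarrow> real) \<Rightarrow> (nat \<Rightarrow> real) \<Rightarrow> real" where
  "pderiv1 i h x = deriv (\<lambda>t. h (x(i := t))) (x i)"

text \<open>Odd derivatives are left derivatives.\<close>

fun pd :: "idx \<Rightarrow> sfun \<Rightarrow> sfun" where
  "pd (Inl i) f = (\<lambda>I. pderiv1 i (f I))"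
| "pd (Inr j) f = (\<lambda>I x. if j \<in> I then 0 else sg (card {k \<in> I. k < j}) * f (insert j I) x)"

definition C_infinity :: "nat \<Rightarrow> (nat \<Rightarrow> real) set \<Rightarrow> ((nat \<Rightarrow> real) \<Rightarrow> real) \<Rightarrow> bool" where
  "C_infinity n V h \<longleftrightarrow> (\<forall>is. set is \<subseteq> {..<n} \<longrightarrow>
     continuous_on V (foldr pderiv1 is h) \<and>
     (\<forall>i<n. \<forall>x\<in>V. (\<lambda>t. foldr pderiv1 is h (x(i := t))) field_differentiable at (x i)))"

definition sf_smooth :: "nat \<Rightarrow> nat \<Rightarrow> (nat \<Rightarrow> real) set \<Rightarrow> sfun \<Rightarrow> bool" where
  "sf_smooth n m V f \<longleftrightarrow> (\<forall>I\<subseteq>{..<m}. C_infinity n V (f I))"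

text \<open>Parities are natural numbers modulo 2.\<close>

definition sf_parity :: "nat \<Rightarrow> (nat \<Rightarrow> real) set \<Rightarrow> nat \<Rightarrow> sfun \<Rightarrow> bool" where
  "sf_parity m V p f \<longleftrightarrow> (\<forall>I\<subseteq>{..<m}. \<forall>x\<in>V. card I mod 2 \<noteq> p mod 2 \<longrightarrow> f I x = 0)"

definition part :: "nat \<Rightarrow> sfun \<Rightarrow> sfun" where
  "part p f = (\<lambda>I x. if card I mod 2 = p mod 2 then f I x else 0)"

definition superalgebra_hom ::
  "nat \<Rightarrow> nat \<Rightarrow> (nat \<Rightarrow> real) set \<Rightarrow> (nat \<Rightarrow> real) set \<Rightarrow> (sfun \<Rightarrow> sfun) \<Rightarrow> bool" where
  "superalgebra_hom n m V V' \<psi> \<longleftrightarrow>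
     (\<forall>f. sf_smooth n m V f \<longrightarrow> sf_smooth n m V' (\<psi> f)) \<and>
     (\<forall>f g. sf_smooth n m V f \<and> sf_smooth n m V g \<and> sf_eq m V f g \<longrightarrow> sf_eq m V' (\<psi> f) (\<psi> g)) \<and>
     (\<forall>f g. sf_smooth n m V f \<and> sf_smooth n m V g \<longrightarrow> sf_eq m V' (\<psi> (f + g)) (\<psi> f + \<psi> g)) \<and>
     (\<forall>c f. sf_smooth n m V f \<longrightarrow> sf_eq m V' (\<psi> (scl c f)) (scl c (\<psi> f))) \<and>
     (\<forall>f g. sf_smooth n m V f \<and> sf_smooth n m V g \<longrightarrow> sf_eq m V' (\<psi> (f \<star> g)) (\<psi> f \<star> \<psi> g)) \<and>
     sf_eq m V' (\<psi> (sf_const 1)) (sf_const 1) \<and>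
     (\<forall>p f. sf_smooth n m V f \<and> sf_parity m V p f \<longrightarrow> sf_parity m V' p (\<psi> f))"

section \<open>Supermanifolds\<close>

text \<open>
  A supermanifold is given by an atlas: charts \<open>chart M \<alpha>\<close> from open sets \<open>cdom M \<alpha>\<close> of the
  underlying manifold to open subsets of \<open>R^n\<close>, glued over overlaps by isomorphisms of the sheaves
  of superfunctions. \<open>trans M \<alpha> \<beta>\<close> rewrites a function of the coordinates of \<open>\<beta>\<close> as a function of
  the coordinates of \<open>\<alpha>\<close>. One map serves all open subsets \<open>W\<close> of an overlap simultaneously,
  which encodes compatibility with restriction.
\<close>

record ('a, 'c) atlas =
  body :: "'a topology"
  charts :: "'c set"
  cdom :: "'c \<Rightarrow> 'a set"
  chart :: "'c \<Rightarrow> 'a \<Rightarrow> nat \<Rightarrow> real"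
  trans :: "'c \<Rightarrow> 'c \<Rightarrow> sfun \<Rightarrow> sfun"

definition cran :: "('a, 'c) atlas \<Rightarrow> 'c \<Rightarrow> (nat \<Rightarrow> real) set" where
  "cran M \<alpha> = chart M \<alpha> ` cdom M \<alpha>"

definition supermanifold :: "nat \<Rightarrow> nat \<Rightarrow> ('a, 'c) atlas \<Rightarrow> bool" where
  "supermanifold n m M \<longleftrightarrow>
     Hausdorff_space (body M) \<and> second_countable (body M) \<and>
     (\<Union>\<alpha>\<in>charts M. cdom M \<alpha>) = topspace (body M) \<and>
     (\<forall>\<alpha>\<in>charts M.
        openin (body M) (cdom M \<alpha>) \<and>
        openin (Euclidean_space n) (cran M \<alpha>) \<and>
        homeomorphic_map (subtopology (body M) (cdom M \<alpha>))
          (subtopology (Euclidean_space n) (cran M \<alpha>)) (chart M \<alpha>)) \<and>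
     (\<forall>\<alpha>\<in>charts M. \<forall>\<beta>\<in>charts M. \<forall>W. openin (body M) W \<and> W \<subseteq> cdom M \<alpha> \<inter> cdom M \<beta> \<longrightarrow>
        superalgebra_hom n m (chart M \<beta> ` W) (chart M \<alpha> ` W) (trans M \<alpha> \<beta>) \<and>
        (\<forall>f. sf_smooth n m (chart M \<beta> ` W) f \<longrightarrow>
           (\<forall>w\<in>W. trans M \<alpha> \<beta> f {} (chart M \<alpha> w) = f {} (chart M \<beta> w)))) \<and>
     (\<forall>\<alpha>\<in>charts M. \<forall>W f. openin (body M) W \<and> W \<subseteq> cdom M \<alpha> \<and> sf_smooth n m (chart M \<alpha> ` W) f \<longrightarrow>
        sf_eq m (chart M \<alpha> ` W) (trans M \<alpha> \<alpha> f) f) \<and>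
     (\<forall>\<alpha>\<in>charts M. \<forall>\<beta>\<in>charts M. \<forall>\<gamma>\<in>charts M. \<forall>W f.
        openin (body M) W \<and> W \<subseteq> cdom M \<alpha> \<inter> cdom M \<beta> \<inter> cdom M \<gamma> \<and> sf_smooth n m (chart M \<gamma> ` W) f \<longrightarrow>
        sf_eq m (chart M \<alpha> ` W) (trans M \<alpha> \<beta> (trans M \<beta> \<gamma> f)) (trans M \<alpha> \<gamma> f))"

text \<open>Elements of \<open>C\<^sup>\<infinity>(M)\<close>: families of local expressions that agree on overlaps.\<close>

type_synonym 'c gfun = "'c \<Rightarrow> sfun"

definition smooth_functions :: "nat \<Rightarrow> nat \<Rightarrow> ('a, 'c) atlas \<Rightarrow> 'c gfun set" where
  "smooth_functions n m M = {f.
     (\<forall>\<alpha>\<in>charts M. sf_smooth n m (cran M \<alpha>) (f \<alpha>)) \<and>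
     (\<forall>\<alpha>\<in>charts M. \<forall>\<beta>\<in>charts M.
        sf_eq m (chart M \<alpha> ` (cdom M \<alpha> \<inter> cdom M \<beta>)) (trans M \<alpha> \<beta> (f \<beta>)) (f \<alpha>))}"

definition gf_eq :: "nat \<Rightarrow> ('a, 'c) atlas \<Rightarrow> 'c gfun \<Rightarrow> 'c gfun \<Rightarrow> bool" where
  "gf_eq m M f g \<longleftrightarrow> (\<forall>\<alpha>\<in>charts M. sf_eq m (cran M \<alpha>) (f \<alpha>) (g \<alpha>))"

definition gf_parity :: "nat \<Rightarrow> ('a, 'c) atlas \<Rightarrow> nat \<Rightarrow> 'c gfun \<Rightarrow> bool" where
  "gf_parity m M p f \<longleftrightarrow> (\<forall>\<alpha>\<in>charts M. sf_parity m (cran M \<alpha>) p (f \<alpha>))"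

definition gscl :: "real \<Rightarrow> 'c gfun \<Rightarrow> 'c gfun" where
  "gscl c f = (\<lambda>\<alpha>. scl c (f \<alpha>))"

definition gmult :: "'c gfun \<Rightarrow> 'c gfun \<Rightarrow> 'c gfun" (infixl "\<bullet>\<^sub>s" 70) where
  "f \<bullet>\<^sub>s g = (\<lambda>\<alpha>. f \<alpha> \<star> g \<alpha>)"

section \<open>Symmetric connections and projective classes\<close>

text \<open>\<open>\<Gamma> \<alpha> k i j\<close> is \<open>\<Gamma>\<^sup>k\<^sub>i\<^sub>j\<close> in the chart \<open>\<alpha>\<close>, where \<open>\<nabla>\<^sub>i \<partial>\<^sub>j = \<Gamma>\<^sup>k\<^sub>i\<^sub>j \<partial>\<^sub>k\<close>.\<close>

type_synonym 'c connection = "'c \<Rightarrow> idx \<Rightarrow> idx \<Rightarrow> idx \<Rightarrow> sfun"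

text \<open>
  With \<open>y\<^sup>a\<close> the coordinates of \<open>\<beta>\<close> expressed through those of \<open>\<alpha>\<close>, the transformation law is
  \<open>\<Gamma>\<^sup>k\<^sub>i\<^sub>j \<partial>\<^sub>k y\<^sup>c = \<partial>\<^sub>i \<partial>\<^sub>j y\<^sup>c + (-1)\<^bsup>i(j+b)\<^esup> \<partial>\<^sub>j y\<^sup>b \<partial>\<^sub>i y\<^sup>a \<Gamma>'\<^sup>c\<^sub>a\<^sub>b\<close>; it is obtained by expanding
  \<open>\<nabla>\<^sub>i \<partial>\<^sub>j\<close> with \<open>\<partial>\<^sub>i = (\<partial>\<^sub>i y\<^sup>a) \<partial>'\<^sub>a\<close>.
\<close>

definition symmetric_connection :: "nat \<Rightarrow> nat \<Rightarrow> ('a, 'c) atlas \<Rightarrow> 'c connection \<Rightarrow> bool" where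
  "symmetric_connection n m M \<Gamma> \<longleftrightarrow>
     (\<forall>\<alpha>\<in>charts M. \<forall>i\<in>coords n m. \<forall>j\<in>coords n m. \<forall>k\<in>coords n m.
        sf_smooth n m (cran M \<alpha>) (\<Gamma> \<alpha> k i j) \<and>
        sf_parity m (cran M \<alpha>) (par i + par j + par k) (\<Gamma> \<alpha> k i j) \<and>
        sf_eq m (cran M \<alpha>) (\<Gamma> \<alpha> k i j) (scl (sg (par i * par j)) (\<Gamma> \<alpha> k j i))) \<and>
     (\<forall>\<alpha>\<in>charts M. \<forall>\<beta>\<in>charts M. \<forall>i\<in>coords n m. \<forall>j\<in>coords n m. \<forall>c\<in>coords n m.
        let y = (\<lambda>a. trans M \<alpha> \<beta> (coord_fun a)) in
        sf_eq m (chart M \<alpha> ` (cdom M \<alpha> \<inter> cdom M \<beta>))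
          (\<Sum>k\<in>coords n m. \<Gamma> \<alpha> k i j \<star> pd k (y c))
          (pd i (pd j (y c)) +
           (\<Sum>a\<in>coords n m. \<Sum>b\<in>coords n m. scl (sg (par i * (par j + par b)))
              (pd j (y b) \<star> pd i (y a) \<star> trans M \<alpha> \<beta> (\<Gamma> \<beta> c a b)))))"

text \<open>
  \<open>proj_coeff n m G k j i\<close> is \<open>\<Pi>\<^sup>k\<^sub>j\<^sub>i\<close> for the connection with coefficients \<open>G k i j\<close> in a fixed chart.
\<close>

definition proj_coeff :: "nat \<Rightarrow> nat \<Rightarrow> (idx \<Rightarrow> idx \<Rightarrow> idx \<Rightarrow> sfun) \<Rightarrow> idx \<Rightarrow> idx \<Rightarrow> idx \<Rightarrow> sfun" where
  "proj_coeff n m G k j i = G k j i - scl (1 / (real n - real m + 1))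
     ((\<Sum>s\<in>coords n m. scl (of_bool (k = i) * sg (par s)) (G s j s)) +
      (\<Sum>s\<in>coords n m. scl (of_bool (k = j) * sg (par i * par j + par s)) (G s i s)))"

definition projective_class :: "nat \<Rightarrow> nat \<Rightarrow> ('a, 'c) atlas \<Rightarrow> 'c connection \<Rightarrow> bool" where
  "projective_class n m M P \<longleftrightarrow> (\<exists>\<Gamma>. symmetric_connection n m M \<Gamma> \<and>
     (\<forall>\<alpha>\<in>charts M. \<forall>k\<in>coords n m. \<forall>j\<in>coords n m. \<forall>i\<in>coords n m.
        sf_eq m (cran M \<alpha>) (P \<alpha> k j i) (proj_coeff n m (\<Gamma> \<alpha>) k j i)))"

section \<open>Master Hamiltonian and bracket\<close>

text \<open>
  \<open>S \<alpha> i j\<close> is \<open>S\<^sup>i\<^sup>j\<close> in the chart \<open>\<alpha>\<close>. The symmetry is that of \<open>p\<^sub>j p\<^sub>i\<close>, and the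
  transformation law expresses that \<open>S\<^sup>i\<^sup>j p\<^sub>j p\<^sub>i\<close> is a well-defined function on \<open>T\<^sup>*M\<close>: substitute
  \<open>p\<^sub>i = (\<partial>\<^sub>i y\<^sup>a) p'\<^sub>a\<close>, where \<open>y\<^sup>a\<close> are the coordinates of \<open>\<beta>\<close> expressed through those of \<open>\<alpha>\<close>.
\<close>

definition master_hamiltonian ::
  "nat \<Rightarrow> nat \<Rightarrow> ('a, 'c) atlas \<Rightarrow> ('c \<Rightarrow> idx \<Rightarrow> idx \<Rightarrow> sfun) \<Rightarrow> bool" where
  "master_hamiltonian n m M S \<longleftrightarrow>
     (\<forall>\<alpha>\<in>charts M. \<forall>i\<in>coords n m. \<forall>j\<in>coords n m.
        sf_smooth n m (cran M \<alpha>) (S \<alpha> i j) \<and>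
        sf_parity m (cran M \<alpha>) (par i + par j + 1) (S \<alpha> i j) \<and>
        sf_eq m (cran M \<alpha>) (S \<alpha> i j) (scl (sg (par i * par j)) (S \<alpha> j i))) \<and>
     (\<forall>\<alpha>\<in>charts M. \<forall>\<beta>\<in>charts M. \<forall>k\<in>coords n m. \<forall>l\<in>coords n m.
        let y = (\<lambda>a. trans M \<alpha> \<beta> (coord_fun a)) in
        sf_eq m (chart M \<alpha> ` (cdom M \<alpha> \<inter> cdom M \<beta>))
          (trans M \<alpha> \<beta> (S \<beta> k l))
          (\<Sum>i\<in>coords n m. \<Sum>j\<in>coords n m. scl (sg (par l * (par i + par k)))
             (S \<alpha> i j \<star> pd j (y l) \<star> pd i (y k))))"

text \<open>
  The cotangent bundle of an \<open>n|m\<close>-dimensional superdomain is the \<open>2n|2m\<close>-dimensional superdomain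
  whose first \<open>n|m\<close> coordinates are the \<open>x\<^sup>i\<close> and whose remaining ones are the momenta;
  \<open>mom n m i\<close> labels the momentum conjugate to \<open>x\<^sup>i\<close>.
\<close>

fun mom :: "nat \<Rightarrow> nat \<Rightarrow> idx \<Rightarrow> idx" where
  "mom n m (Inl i) = Inl (n + i)"
| "mom n m (Inr j) = Inr (m + j)"

text \<open>
  \<open>horiz\<close> drops the momenta. On functions of the \<open>x\<^sup>i\<close> it is pullback along the projection of the
  cotangent bundle; on functions on the cotangent bundle it is restriction to the zero section.
\<close>

definition horiz :: "nat \<Rightarrow> nat \<Rightarrow> sfun \<Rightarrow> sfun" where
  "horiz n m f = (\<lambda>I x. if I \<subseteq> {..<m} then f I (\<lambda>i. if i < n then x i else 0) else 0)"

text \<open>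
  The canonical even Poisson bracket, normalised by \<open>(p\<^sub>i, x\<^sup>j) = \<delta>\<^sub>i\<^sup>j\<close>: for \<open>F\<close> of parity \<open>q\<close>,
  \<open>(F, G) = (-1)\<^bsup>i(q+1)\<^esup> \<partial>F/\<partial>p\<^sub>i \<partial>G/\<partial>x\<^sup>i - (-1)\<^bsup>iq\<^esup> \<partial>F/\<partial>x\<^sup>i \<partial>G/\<partial>p\<^sub>i\<close>.
\<close>

definition canonical_bracket :: "nat \<Rightarrow> nat \<Rightarrow> sfun \<Rightarrow> sfun \<Rightarrow> sfun" where
  "canonical_bracket n m F G = (\<Sum>q<2. \<Sum>i\<in>coords n m.
     scl (sg (par i * (q + 1))) (pd (mom n m i) (part q F) \<star> pd i G) -
     scl (sg (par i * q)) (pd i (part q F) \<star> pd (mom n m i) G))"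

definition hamiltonian :: "nat \<Rightarrow> nat \<Rightarrow> (idx \<Rightarrow> idx \<Rightarrow> sfun) \<Rightarrow> sfun" where
  "hamiltonian n m S = (\<Sum>i\<in>coords n m. \<Sum>j\<in>coords n m.
     horiz n m (S i j) \<star> coord_fun (mom n m j) \<star> coord_fun (mom n m i))"

text \<open>
  \<open>[f, g] = (-1)\<^bsup>q\<^esup> ((S, f), g)\<close> for \<open>f\<close> of parity \<open>q\<close>, extended additively in \<open>f\<close>. As
  \<open>((S, f), g)\<close> does not depend on the momenta, nothing is lost by putting them to zero. Note that
  \<open>((S, f), g) = 2 S\<^sup>i\<^sup>j \<partial>\<^sub>j f \<partial>\<^sub>i g (-1)\<^bsup>iq\<^esup>\<close>, since \<open>S = S\<^sup>i\<^sup>j p\<^sub>j p\<^sub>i\<close> carries no factor \<open>1/2\<close>.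
\<close>

definition odd_bracket ::
  "nat \<Rightarrow> nat \<Rightarrow> ('c \<Rightarrow> idx \<Rightarrow> idx \<Rightarrow> sfun) \<Rightarrow> 'c gfun \<Rightarrow> 'c gfun \<Rightarrow> 'c gfun" where
  "odd_bracket n m S f g = (\<lambda>\<alpha>. \<Sum>q<2. scl (sg q)
     (horiz n m (canonical_bracket n m
        (canonical_bracket n m (hamiltonian n m (S \<alpha>)) (horiz n m (part q (f \<alpha>))))
        (horiz n m (g \<alpha>)))))"

definition odd_poisson_bracket ::
  "nat \<Rightarrow> nat \<Rightarrow> ('a, 'c) atlas \<Rightarrow> ('c gfun \<Rightarrow> 'c gfun \<Rightarrow> 'c gfun) \<Rightarrow> bool" where
  "odd_poisson_bracket n m M B \<longleftrightarrow>
     (\<forall>a\<in>smooth_functions n m M. \<forall>b\<in>smooth_functions n m M. B a b \<in> smooth_functions n m M) \<and>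
     (\<forall>a\<in>smooth_functions n m M. \<forall>b\<in>smooth_functions n m M. \<forall>c\<in>smooth_functions n m M. \<forall>r.
        gf_eq m M (B (a + b) c) (B a c + B b c) \<and>
        gf_eq m M (B a (b + c)) (B a b + B a c) \<and>
        gf_eq m M (B (gscl r a) b) (gscl r (B a b)) \<and>
        gf_eq m M (B a (gscl r b)) (gscl r (B a b))) \<and>
     (\<forall>a\<in>smooth_functions n m M. \<forall>b\<in>smooth_functions n m M. \<forall>p q. gf_parity m M p a \<and> gf_parity m M q b \<longrightarrow>
        gf_parity m M (p + q + 1) (B a b) \<and>
        gf_eq m M (B a b) (gscl (- sg ((p + 1) * (q + 1))) (B b a)) \<and>
        (\<forall>c\<in>smooth_functions n m M.
           gf_eq m M (B a (B b c)) (B (B a b) c + gscl (sg ((p + 1) * (q + 1))) (B b (B a c))) \<and>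
           gf_eq m M (B a (b \<bullet>\<^sub>s c)) (B a b \<bullet>\<^sub>s c + gscl (sg ((p + 1) * q)) (b \<bullet>\<^sub>s B a c))))"

section \<open>The projective Laplacian\<close>

text \<open>\<open>T\<^sup>i\<close> in a fixed chart, where \<open>P i k j\<close> is \<open>\<Pi>\<^sup>i\<^sub>k\<^sub>j\<close>.\<close>

definition proj_T ::
  "nat \<Rightarrow> nat \<Rightarrow> (idx \<Rightarrow> idx \<Rightarrow> sfun) \<Rightarrow> (idx \<Rightarrow> idx \<Rightarrow> idx \<Rightarrow> sfun) \<Rightarrow> idx \<Rightarrow> sfun" where
  "proj_T n m S P i =
     scl (2 / (real n - real m + 3)) (\<Sum>j\<in>coords n m. pd j (S j i)) -
     scl ((real n - real m + 1) / (real n - real m + 3))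
       (\<Sum>j\<in>coords n m. \<Sum>k\<in>coords n m. S j k \<star> P i k j)"

definition projective_laplacian ::
  "nat \<Rightarrow> nat \<Rightarrow> ('c \<Rightarrow> idx \<Rightarrow> idx \<Rightarrow> sfun) \<Rightarrow> 'c connection \<Rightarrow> 'c gfun \<Rightarrow> 'c gfun" where
  "projective_laplacian n m S P f = (\<lambda>\<alpha>.
     (\<Sum>i\<in>coords n m. \<Sum>j\<in>coords n m. S \<alpha> i j \<star> pd j (pd i (f \<alpha>))) +
     (\<Sum>i\<in>coords n m. proj_T n m (S \<alpha>) (P \<alpha>) i \<star> pd i (f \<alpha>)))"

definition BV_operator ::
  "nat \<Rightarrow> nat \<Rightarrow> ('a, 'c) atlas \<Rightarrow> ('c gfun \<Rightarrow> 'c gfun \<Rightarrow> 'c gfun) \<Rightarrow> ('c gfun \<Rightarrow> 'c gfun) \<Rightarrow> bool" where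
  "BV_operator n m M B D \<longleftrightarrow>
     (\<forall>a\<in>smooth_functions n m M. \<forall>b\<in>smooth_functions n m M. \<forall>p. gf_parity m M p a \<longrightarrow>
        gf_eq m M (B a b) (gscl (sg p) (D (a \<bullet>\<^sub>s b) - D a \<bullet>\<^sub>s b - gscl (sg p) (a \<bullet>\<^sub>s D b)))) \<and>
     (\<forall>a\<in>smooth_functions n m M. gf_eq m M (D (D a)) 0)"

end

theory Submission
  imports Defs
begin

text \<open>
  In a chart, write \<open>\<Delta>\<close> for the projective Laplacian. Leibniz' rule shows that \<open>\<Delta>\<close> always generates
  the bracket, so only \<open>\<Delta>\<^sup>2 = 0\<close> is at stake. In \<open>\<Delta>\<^sup>2\<close> the terms of order four, and those of order
  three and two that contain no derivative of \<open>S\<close> or \<open>T\<close>, cancel because \<open>S\<close> and \<open>T\<close> are odd; the remaining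
  third-order term is the Jacobi identity for the coordinate functions, contracted with the third
  derivatives. What is left is the second-order operator whose coefficients are the left-hand sides
  of the two equations, and it is tested on the functions \<open>x\<^sup>i\<close> and \<open>x\<^sup>i x\<^sup>j\<close>.
  Both the Jacobi identity and \<open>\<Delta>\<^sup>2 = 0\<close> concern global functions; near a given point the functions
  \<open>x\<^sup>i\<close> and \<open>x\<^sup>i x\<^sup>j\<close> agree with global ones by means of bump functions.
\<close>

section \<open>Superfunctions as a real algebra\<close>

text \<open>\<open>\<Delta>\<close> is odd, so its square is half a graded commutator and has order
  at most three rather than four; the cancellations are the index form of this fact. All signs
  depend on parities, so the calculation is done with homogeneous elements of an abstract
  differential superalgebra. That algebra is instantiated over chart domains, where the Laplacian is
  squared, and over their cotangent superdomains, where \<open>((S, f), g)\<close> is evaluated. The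
  obstacle is that superfunctions agree only on an open set and only at the relevant coefficients;
  truncating the coefficients turns this into honest equality. The bracket is generated with the
  correct constant because both sides carry a factor 2: in the Leibniz defect of
  \<open>\<Delta>\<close> it comes from the symmetry of \<open>S\<close>, in
  \<open>((S, f), g)\<close> from \<open>S\<close> being quadratic in the momenta. The hypotheses
  are global and the equations local. Hence the equivalence is proved on neighbourhoods where the
  test functions extend globally, and only then glued.\<close>

definition inversions :: "nat set \<Rightarrow> nat set \<Rightarrow> nat" where
  "inversions I J = card {(i, j). i \<in> I \<and> j \<in> J \<and> j < i}"

lemma finite_inversions:
  "finite I \<Longrightarrow> finite J \<Longrightarrow> finite {(i, j). i \<in> I \<and> j \<in> J \<and> j < (i::nat)}"
  by (rule finite_subset[of _ "I \<times> J"]) auto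

lemma inversions_empty [simp]: "inversions {} J = 0" "inversions I {} = 0"
  by (simp_all add: inversions_def)

lemma inversions_Un_left:
  assumes "finite I" "finite J" "finite L" "I \<inter> J = {}"
  shows "inversions (I \<union> J) L = inversions I L + inversions J L"
proof -
  have "{(i, j). i \<in> I \<union> J \<and> j \<in> L \<and> j < i} =
      {(i, j). i \<in> I \<and> j \<in> L \<and> j < i} \<union> {(i, j). i \<in> J \<and> j \<in> L \<and> j < i}" (is "_ = ?A \<union> ?B")
    by auto
  moreover have "card (?A \<union> ?B) = card ?A + card ?B"
    using assms by (intro card_Un_disjoint finite_inversions) auto
  ultimately show ?thesis
    by (simp only: inversions_def)
qed

lemma inversions_Un_right:
  assumes "finite I" "finite J" "finite L" "I \<inter> J = {}"
  shows "inversions L (I \<union> J) = inversions L I + inversions L J"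
proof -
  have "{(i, j). i \<in> L \<and> j \<in> I \<union> J \<and> j < i} =
      {(i, j). i \<in> L \<and> j \<in> I \<and> j < i} \<union> {(i, j). i \<in> L \<and> j \<in> J \<and> j < i}" (is "_ = ?A \<union> ?B")
    by auto
  moreover have "card (?A \<union> ?B) = card ?A + card ?B"
    using assms by (intro card_Un_disjoint finite_inversions) auto
  ultimately show ?thesis
    by (simp only: inversions_def)
qed

text \<open>Every pair in \<open>I \<times> J\<close> is inverted in exactly one of the two orders.
  In signs, \<open>\<xi>_I \<xi>_J = (-1)^(|I| |J|) \<xi>_J \<xi>_I\<close>, the source of graded
  commutativity.\<close>

lemma inversions_swap:
  assumes "finite I" "finite J" "I \<inter> J = {}"
  shows "inversions I J + inversions J I = card I * card J"
proof -
  have "inversions J I = card {(i, j). i \<in> I \<and> j \<in> J \<and> i < j}"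
    unfolding inversions_def
    by (rule bij_betw_same_card[of prod.swap]) (auto simp: bij_betw_def inj_on_def image_def)
  moreover have "I \<times> J =
      {(i, j). i \<in> I \<and> j \<in> J \<and> j < i} \<union> {(i, j). i \<in> I \<and> j \<in> J \<and> i < j}"
    using assms by (auto simp: not_less_iff_gr_or_eq)
  moreover have "card ({(i, j). i \<in> I \<and> j \<in> J \<and> j < i} \<union> {(i, j). i \<in> I \<and> j \<in> J \<and> i < j}) =
      card {(i, j). i \<in> I \<and> j \<in> J \<and> j < i} + card {(i, j). i \<in> I \<and> j \<in> J \<and> i < j}"
    using assms(1,2)
    by (intro card_Un_disjoint finite_inversions) (auto intro: finite_subset[of _ "I \<times> J"])
  ultimately show ?thesis
    by (metis inversions_def card_cartesian_product)
qed

text \<open>The number of factors that \<open>\<xi>_j\<close> passes on its way to the front of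
  \<open>\<xi>_I\<close>; it is the exponent in the left derivative
  \<open>pd (Inr j)\<close>.\<close>

definition count_below :: "nat \<Rightarrow> nat set \<Rightarrow> nat" where
  "count_below j I = card {k \<in> I. k < j}"

lemma inversions_singleton_left: "inversions {j} I = count_below j I"
  unfolding inversions_def count_below_def
  by (rule bij_betw_same_card[of snd]) (force simp: bij_betw_def inj_on_def)

text \<open>The sum form avoids subtraction of natural numbers.\<close>

lemma inversions_singleton_right:
  assumes "finite I" "j \<notin> I"
  shows "inversions I {j} + count_below j I = card I"
  using inversions_swap[of I "{j}"] assms by (simp add: inversions_singleton_left)

lemma count_below_insert:
  assumes "finite I" "i \<notin> I"
  shows "count_below j (insert i I) = count_below j I + of_bool (i < j)"
proof -
  have "{k \<in> insert i I. k < j} =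
      (if i < j then insert i {k \<in> I. k < j} else {k \<in> I. k < j})"
    by auto
  then show ?thesis
    using assms by (simp add: count_below_def)
qed

section \<open>The graded product of superfunctions\<close>

lemma sf_mult_eq:
  "(f \<star> g) K x = (\<Sum>I\<in>Pow K. sg (inversions I (K - I)) * f I x * g (K - I) x)"
  by (simp add: sf_mult_def inversions_def)

text \<open>\<open>Pow K\<close> is infinite too, so the sum defining the product takes its default
  value 0.\<close>

lemma sf_mult_infinite: "infinite K \<Longrightarrow> (f \<star> g) K = (\<lambda>x. 0)"
  by (simp add: sf_mult_def fun_eq_iff finite_Pow_iff)

text \<open>Both sides sum over the ordered partitions of \<open>K\<close> into three blocks.
  Additivity of \<open>inversions\<close> in each argument reduces either sign to the inversions
  between the three pairs of blocks.\<close>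

lemma sf_mult_assoc: "(f \<star> g) \<star> h = f \<star> (g \<star> h)"
proof (intro ext)
  fix K x
  show "((f \<star> g) \<star> h) K x = (f \<star> (g \<star> h)) K x"
  proof (cases "finite K")
    case True
    have "((f \<star> g) \<star> h) K x = (\<Sum>I\<in>Pow K. \<Sum>J\<in>Pow I. sg (inversions I (K - I)) *
        (sg (inversions J (I - J)) * f J x * g (I - J) x) * h (K - I) x)"
      by (simp add: sf_mult_eq sum_distrib_left sum_distrib_right)
    also have "\<dots> = (\<Sum>(I, J)\<in>Sigma (Pow K) Pow. sg (inversions I (K - I)) *
        (sg (inversions J (I - J)) * f J x * g (I - J) x) * h (K - I) x)"
      using True by (subst sum.Sigma) (auto intro: finite_subset)
    also have "\<dots> = (\<Sum>(J, L)\<in>Sigma (Pow K) (\<lambda>J. Pow (K - J)). sg (inversions J (K - J)) * f J x *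
        (sg (inversions L (K - J - L)) * g L x * h (K - J - L) x))"
    \<comment> \<open>The pair \<open>(I, J)\<close> with \<open>J \<subseteq> I\<close> encodes the
      partition into \<open>J\<close>, \<open>I - J\<close> and \<open>K - I\<close>; the pair
      \<open>(J, L)\<close> lists the first two blocks.\<close>
    proof (rule sum.reindex_bij_witness[where i = "\<lambda>(J, L). (J \<union> L, J)" and j = "\<lambda>(I, J). (J, I - J)"],
        goal_cases)
      case (5 a)
      then obtain I J where a: "a = (I, J)" and IJ: "J \<subseteq> I" "I \<subseteq> K"
        by auto
      note fin = finite_subset[OF IJ(2) True] finite_subset[OF IJ(1) finite_subset[OF IJ(2) True]]
      have K: "K - J - (I - J) = K - I" "J \<union> (I - J) = I" "K - J = (I - J) \<union> (K - I)"
        using IJ by auto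
      have "inversions I (K - I) = inversions J (K - I) + inversions (I - J) (K - I)"
        using inversions_Un_left[of J "I - J" "K - I"] fin True K by auto
      moreover have "inversions J (K - J) = inversions J (I - J) + inversions J (K - I)"
        using inversions_Un_right[of "I - J" "K - I" J] fin True K by auto
      ultimately show ?case
        using IJ K(1) by (simp add: a power_add)
    qed auto
    also have "\<dots> = (\<Sum>J\<in>Pow K. \<Sum>L\<in>Pow (K - J). sg (inversions J (K - J)) * f J x *
        (sg (inversions L (K - J - L)) * g L x * h (K - J - L) x))"
      using True by (subst sum.Sigma) (auto intro: finite_subset)
    finally show ?thesis
      by (simp add: sf_mult_eq sum_distrib_left)
  qed (simp add: sf_mult_infinite)
qed

lemma sf_mult_add_left: "(f + g) \<star> h = f \<star> h + g \<star> h"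
  and sf_mult_add_right: "f \<star> (g + h) = f \<star> g + f \<star> h"
  by (simp_all add: fun_eq_iff sf_mult_eq algebra_simps sum.distrib)

lemma sf_mult_scl_left: "scl c f \<star> g = scl c (f \<star> g)"
  and sf_mult_scl_right: "f \<star> scl c g = scl c (f \<star> g)"
  by (simp_all add: fun_eq_iff sf_mult_eq scl_def sum_distrib_left algebra_simps)

lemma sf_mult_one_right:
  assumes "finite K"
  shows "(f \<star> sf_const 1) K = f K"
proof
  fix x
  have "(f \<star> sf_const 1) K x = (\<Sum>I\<in>Pow K. if I = K then f K x else 0)"
    unfolding sf_mult_eq
    by (rule sum.cong) (auto simp: sf_const_def)
  then show "(f \<star> sf_const 1) K x = f K x"
    using assms by simp
qed

lemma sf_mult_one_left:
  assumes "finite K"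
  shows "(sf_const 1 \<star> f) K = f K"
proof
  fix x
  have "(sf_const 1 \<star> f) K x = (\<Sum>I\<in>Pow K. if I = {} then f K x else 0)"
    unfolding sf_mult_eq
    by (rule sum.cong) (auto simp: sf_const_def)
  then show "(sf_const 1 \<star> f) K x = f K x"
    using assms by simp
qed

text \<open>
  Only finite sets of odd coordinates occur in a monomial; dropping the junk coefficients at
  infinite sets makes the product unital, independently of the number of odd coordinates.
\<close>

typedef superfun = "{f :: sfun. \<forall>I. infinite I \<longrightarrow> f I = (\<lambda>x. 0)}"
  by (rule exI[of _ "\<lambda>I x. 0"]) simp

setup_lifting type_definition_superfun

instantiation superfun :: real_algebra_1
begin

lift_definition zero_superfun :: superfun is "\<lambda>I x. 0" by simp
lift_definition one_superfun :: superfun is "sf_const 1" by (auto simp: sf_const_def)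
lift_definition plus_superfun :: "superfun \<Rightarrow> superfun \<Rightarrow> superfun" is "\<lambda>f g I x. f I x + g I x"
  by (auto simp: fun_eq_iff)
lift_definition uminus_superfun :: "superfun \<Rightarrow> superfun" is "\<lambda>f I x. - f I x"
  by (auto simp: fun_eq_iff)
lift_definition minus_superfun :: "superfun \<Rightarrow> superfun \<Rightarrow> superfun" is "\<lambda>f g I x. f I x - g I x"
  by (auto simp: fun_eq_iff)
lift_definition times_superfun :: "superfun \<Rightarrow> superfun \<Rightarrow> superfun" is sf_mult
  by (simp add: sf_mult_infinite)
lift_definition scaleR_superfun :: "real \<Rightarrow> superfun \<Rightarrow> superfun" is scl
  by (auto simp: scl_def)

instance
proof
  fix a b c :: superfun and r s :: real
  show "a * b * c = a * (b * c)" by transfer (rule sf_mult_assoc)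
  show "1 * a = a"
    by transfer (metis (no_types, lifting) ext sf_mult_one_left sf_mult_infinite)
  show "a * 1 = a"
    by transfer (metis (no_types, lifting) ext sf_mult_one_right sf_mult_infinite)
  show "(a + b) * c = a * c + b * c"
    by transfer (use sf_mult_add_left in \<open>simp add: plus_fun_def\<close>)
  show "a * (b + c) = a * b + a * c"
    by transfer (use sf_mult_add_right in \<open>simp add: plus_fun_def\<close>)
  show "r *\<^sub>R a * b = r *\<^sub>R (a * b)" by transfer (rule sf_mult_scl_left)
  show "a * r *\<^sub>R b = r *\<^sub>R (a * b)" by transfer (rule sf_mult_scl_right)
  have "sf_const 1 {} (\<lambda>i. 0) \<noteq> 0"
    by (simp add: sf_const_def)
  then show "(0 :: superfun) \<noteq> 1" by transfer metis
qed (transfer, simp add: fun_eq_iff scl_def algebra_simps)+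

end

text \<open>No domain is mentioned, because elements \<open>loc m V f\<close> vanish off
  \<open>V\<close> and outside the subsets of \<open>{..<m}\<close>; on them this is
  \<open>sf_parity m V\<close>. Zero has both parities.\<close>

definition homogeneous :: "nat \<Rightarrow> superfun \<Rightarrow> bool" where
  "homogeneous p F \<longleftrightarrow> (\<forall>I x. card I mod 2 \<noteq> p mod 2 \<longrightarrow> Rep_superfun F I x = 0)"

text \<open>Taking complements in \<open>K\<close> interchanges the factors. A term is nonzero only
  if \<open>I\<close> and \<open>K - I\<close> have the parities \<open>q\<close> and
  \<open>p\<close>, and then \<open>inversions_swap\<close> yields the sign.\<close>

lemma homogeneous_mult_commute:
  assumes "homogeneous p F" "homogeneous q G"
  shows "F * G = sg (p * q) *\<^sub>R (G * F)"
proof -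
  have "(Rep_superfun F \<star> Rep_superfun G) K x = sg (p * q) * (Rep_superfun G \<star> Rep_superfun F) K x"
    (is "?l = ?r") for K x
  proof (cases "finite K")
    case True
    have "?l = (\<Sum>I\<in>Pow K. sg (inversions (K - I) I) *
        Rep_superfun F (K - I) x * Rep_superfun G I x)"
      unfolding sf_mult_eq
      by (rule sum.reindex_bij_witness[where i = "\<lambda>I. K - I" and j = "\<lambda>I. K - I"])
         (auto simp: double_diff)
    also have "\<dots> = (\<Sum>I\<in>Pow K. sg (p * q) * (sg (inversions I (K - I)) *
        Rep_superfun G I x * Rep_superfun F (K - I) x))"
    proof (rule sum.cong[OF refl])
      fix I assume "I \<in> Pow K"
      then have fin: "finite I" "finite (K - I)"
        using True finite_subset by auto
      show "sg (inversions (K - I) I) * Rep_superfun F (K - I) x * Rep_superfun G I x =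
          sg (p * q) * (sg (inversions I (K - I)) * Rep_superfun G I x * Rep_superfun F (K - I) x)"
      proof (cases "card I mod 2 = q mod 2 \<and> card (K - I) mod 2 = p mod 2")
        case True
        then have "even (card I * card (K - I)) = even (p * q)"
          by (metis even_mult_iff even_iff_mod_2_eq_zero)
        then have "even (inversions (K - I) I) = even (p * q + inversions I (K - I))"
          by (metis inversions_swap[OF fin] Diff_disjoint even_add)
        then have "sg (inversions (K - I) I) = sg (p * q) * sg (inversions I (K - I))"
          by (simp add: minus_one_power_iff flip: power_add)
        then show ?thesis by simp
      next
        case False
        then have "Rep_superfun F (K - I) x = 0 \<or> Rep_superfun G I x = 0"
          using assms unfolding homogeneous_def by blast
        then show ?thesis by auto
      qed
    qed
    finally show ?thesis
      by (simp add: sf_mult_eq sum_distrib_left)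
  qed (simp add: sf_mult_infinite)
  then show ?thesis
    by transfer (simp add: fun_eq_iff scl_def)
qed

section \<open>Smooth functions on open subsets of coordinate space\<close>

lemma openin_Euclidean_spaceD:
  assumes "openin (Euclidean_space n) V"
  obtains U where "open U" "V = U \<inter> {x. \<forall>i\<ge>n. x i = 0}"
  using assms by (auto simp: Euclidean_space_def openin_subtopology euclidean_product_topology)

lemma openin_Euclidean_spaceI:
  "open U \<Longrightarrow> openin (Euclidean_space n) (U \<inter> {x. \<forall>i\<ge>n. x i = 0})"
  by (auto simp: Euclidean_space_def openin_subtopology euclidean_product_topology)

lemma openin_Euclidean_space_zero:
  "openin (Euclidean_space n) V \<Longrightarrow> x \<in> V \<Longrightarrow> n \<le> i \<Longrightarrow> x i = 0"
  by (auto elim!: openin_Euclidean_spaceD)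

lemma continuous_on_upd [continuous_intros]:
  fixes x :: "'b::topological_space \<Rightarrow> nat \<Rightarrow> real"
  assumes "continuous_on S x" "continuous_on S u"
  shows "continuous_on S (\<lambda>t. (x t)(i := u t))"
proof (rule continuous_on_coordinatewise_then_product)
  fix j show "continuous_on S (\<lambda>t. ((x t)(i := u t)) j)"
    using assms continuous_on_product_then_coordinatewise[OF assms(1), of j]
    by (cases "j = i") auto
qed

text \<open>Changing a coordinate below \<open>n\<close> leaves the vanishing ones alone, so a small
  change stays in \<open>V\<close> although \<open>V\<close> is open only in the subspace. This is
  why \<open>pderiv1\<close> at points of \<open>V\<close> sees only values on
  \<open>V\<close>.\<close>

lemma eventually_upd_mem:
  assumes V: "openin (Euclidean_space n) V" and "x \<in> V" "i < n"
  shows "\<forall>\<^sub>F t in nhds (x i). x(i := t) \<in> V"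
proof -
  obtain U where U: "open U" "V = U \<inter> {x. \<forall>i\<ge>n. x i = 0}"
    using V by (rule openin_Euclidean_spaceD)
  have "open ((\<lambda>t. x(i := t)) -` U)"
    by (intro open_vimage U continuous_intros)
  then have "\<forall>\<^sub>F t in nhds (x i). t \<in> (\<lambda>t. x(i := t)) -` U"
    using U assms by (intro eventually_nhds_in_open) auto
  then show ?thesis
    by eventually_elim (use U assms in auto)
qed

lemma pderiv1_cong:
  assumes "openin (Euclidean_space n) V" "x \<in> V" "i < n" "\<And>y. y \<in> V \<Longrightarrow> f y = g y"
  shows "pderiv1 i f x = pderiv1 i g x"
  unfolding pderiv1_def
  by (rule deriv_cong_ev[OF eventually_mono[OF eventually_upd_mem[OF assms(1-3)]]])
     (use assms in auto)

text \<open>Finite order permits induction with the function left arbitrary: the derivative of a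
  product or a composite is again built from functions of one order less, while the iterated
  derivatives along lists in \<open>C_infinity\<close> have no manageable closed form.\<close>

fun C_diff :: "nat \<Rightarrow> (nat \<Rightarrow> real) set \<Rightarrow> nat \<Rightarrow> ((nat \<Rightarrow> real) \<Rightarrow> real) \<Rightarrow> bool" where
  "C_diff n V 0 h \<longleftrightarrow> continuous_on V h"
| "C_diff n V (Suc k) h \<longleftrightarrow> continuous_on V h \<and> (\<forall>i<n. C_diff n V k (pderiv1 i h) \<and>
     (\<forall>x\<in>V. (\<lambda>t. h (x(i := t))) field_differentiable at (x i)))"

text \<open>\<open>foldr\<close> applies the last index of the list first, so a nonempty list is
  split at its end.\<close>

lemma C_infinity_unfold:
  "C_infinity n V h \<longleftrightarrow> continuous_on V h \<and> (\<forall>i<n. C_infinity n V (pderiv1 i h) \<and>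
     (\<forall>x\<in>V. (\<lambda>t. h (x(i := t))) field_differentiable at (x i)))" (is "?l \<longleftrightarrow> ?r")
proof
  assume l: ?l
  have "C_infinity n V (pderiv1 i h)" if "i < n" for i
    unfolding C_infinity_def
  proof (intro allI impI)
    fix js assume "set js \<subseteq> {..<n}"
    then show "continuous_on V (foldr pderiv1 js (pderiv1 i h)) \<and>
        (\<forall>k<n. \<forall>x\<in>V. (\<lambda>t. foldr pderiv1 js (pderiv1 i h) (x(k := t))) field_differentiable at (x k))"
      using l[unfolded C_infinity_def, rule_format, of "js @ [i]"] that by auto
  qed
  then show ?r
    using l[unfolded C_infinity_def, rule_format, of "[]"] by auto
next
  assume r: ?r
  show ?l
    unfolding C_infinity_def
  proof (intro allI impI)
    fix js assume js: "set js \<subseteq> {..<n}"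
    show "continuous_on V (foldr pderiv1 js h) \<and>
        (\<forall>k<n. \<forall>x\<in>V. (\<lambda>t. foldr pderiv1 js h (x(k := t))) field_differentiable at (x k))"
    proof (cases js rule: rev_cases)
      case Nil
      then show ?thesis using r by simp
    next
      case (snoc ks i)
      then have "C_infinity n V (pderiv1 i h)" "set ks \<subseteq> {..<n}"
        using r js by auto
      then show ?thesis
        using snoc unfolding C_infinity_def by auto
    qed
  qed
qed

lemma C_infinity_iff_C_diff: "C_infinity n V h \<longleftrightarrow> (\<forall>k. C_diff n V k h)"
proof
  assume "C_infinity n V h"
  moreover have "C_diff n V k h" if "C_infinity n V h" for k
    using that
  proof (induction k arbitrary: h)
    case 0
    then show ?case using C_infinity_unfold[of n V h] by simp
  next
    case (Suc k)
    then show ?case using C_infinity_unfold[of n V h] by simp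
  qed
  ultimately show "\<forall>k. C_diff n V k h" by blast
next
  assume h: "\<forall>k. C_diff n V k h"
  have "continuous_on V (foldr pderiv1 js h) \<and>
      (\<forall>k<n. \<forall>x\<in>V. (\<lambda>t. foldr pderiv1 js h (x(k := t))) field_differentiable at (x k))"
    if "set js \<subseteq> {..<n}" "\<forall>k. C_diff n V k h" for js
    using that
  proof (induction js arbitrary: h rule: rev_induct)
    case Nil
    from Nil(2)[rule_format, of 1] show ?case by (simp del: fun_upd_apply)
  next
    case (snoc i js)
    have "\<forall>k. C_diff n V k (pderiv1 i h)"
      using snoc.prems(1) snoc.prems(2)[rule_format, of "Suc k" for k] by auto
    then show ?case using snoc by auto
  qed
  then show "C_infinity n V h"
    using h by (simp add: C_infinity_def)
qed

lemma C_diff_imp_continuous_on: "C_diff n V k h \<Longrightarrow> continuous_on V h"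
  by (cases k) auto

lemma C_diff_SucD: "C_diff n V (Suc k) h \<Longrightarrow> C_diff n V k h"
  by (induction k arbitrary: h) auto

lemma C_diff_pderiv1:
  assumes "C_diff n V (Suc k) h" "x \<in> V" "i < n"
  shows "((\<lambda>t. h (x(i := t))) has_real_derivative pderiv1 i h x) (at (x i))"
  using assms by (simp add: pderiv1_def field_differentiable_derivI)

lemma pderiv1_eqI:
  "((\<lambda>t. h (x(i := t))) has_real_derivative D) (at (x i)) \<Longrightarrow> pderiv1 i h x = D"
  by (simp add: pderiv1_def DERIV_imp_deriv)

lemma C_diff_subset: "C_diff n V k h \<Longrightarrow> W \<subseteq> V \<Longrightarrow> C_diff n W k h"
  by (induction k arbitrary: h) (auto intro: continuous_on_subset)

lemma field_differentiable_upd_cong: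
  assumes "openin (Euclidean_space n) V" "x \<in> V" "i < n" "\<And>y. y \<in> V \<Longrightarrow> f y = g y"
    and "(\<lambda>t. f (x(i := t))) field_differentiable at (x i)"
  shows "(\<lambda>t. g (x(i := t))) field_differentiable at (x i)"
proof -
  obtain D where "((\<lambda>t. f (x(i := t))) has_real_derivative D) (at (x i))"
    using assms(5) by (auto simp: field_differentiable_def)
  moreover have "\<forall>\<^sub>F t in nhds (x i). f (x(i := t)) = g (x(i := t))"
    using eventually_upd_mem[OF assms(1-3)] by eventually_elim (use assms(4) in simp)
  ultimately have "((\<lambda>t. g (x(i := t))) has_real_derivative D) (at (x i))"
    using DERIV_cong_ev[of "x i" "x i" "\<lambda>t. f (x(i := t))" "\<lambda>t. g (x(i := t))" D D] by simp
  then show ?thesis by (auto simp: field_differentiable_def)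
qed

lemma C_diff_cong:
  assumes "openin (Euclidean_space n) V" "\<And>y. y \<in> V \<Longrightarrow> f y = g y" "C_diff n V k f"
  shows "C_diff n V k g"
  using assms(2,3)
proof (induction k arbitrary: f g)
  case 0
  then show ?case using continuous_on_cong[of V V f g] by simp
next
  case (Suc k)
  have "continuous_on V g"
    using Suc.prems continuous_on_cong[of V V f g] by simp
  moreover have "C_diff n V k (pderiv1 i g)" if "i < n" for i
    using Suc.IH[of "pderiv1 i f" "pderiv1 i g"] Suc.prems that pderiv1_cong[OF assms(1) _ that, of _ f g]
    by simp
  moreover have "(\<lambda>t. g (x(i := t))) field_differentiable at (x i)" if "i < n" "x \<in> V" for i x
    using field_differentiable_upd_cong[OF assms(1) that(2,1), of f g] Suc.prems that by simp
  ultimately show ?case by simp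
qed

text \<open>The derivative may be given by any expression \<open>D i\<close> that is correct on
  \<open>V\<close>. It need not be \<open>pderiv1 i h\<close> elsewhere, since \<open>V\<close> is
  open and \<open>C_diff\<close> depends only on values on \<open>V\<close>.\<close>

lemma C_diff_SucI:
  assumes V: "openin (Euclidean_space n) V" and "continuous_on V h"
    and "\<And>x i. x \<in> V \<Longrightarrow> i < n \<Longrightarrow> ((\<lambda>t. h (x(i := t))) has_real_derivative D i x) (at (x i))"
    and "\<And>i. i < n \<Longrightarrow> C_diff n V k (D i)"
  shows "C_diff n V (Suc k) h"
proof -
  have "C_diff n V k (pderiv1 i h)" if "i < n" for i
    by (rule C_diff_cong[OF V _ assms(4)[OF that]]) (metis pderiv1_eqI assms(3) that)
  then show ?thesis
    using assms(2,3) by (auto simp: field_differentiable_def)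
qed

lemma C_diff_const: "openin (Euclidean_space n) V \<Longrightarrow> C_diff n V k (\<lambda>x. c)"
proof (induction k arbitrary: c)
  case (Suc k)
  then show ?case by (intro C_diff_SucI[where D = "\<lambda>i x. 0"]) auto
qed simp

lemma C_diff_coord:
  assumes "openin (Euclidean_space n) V"
  shows "C_diff n V k (\<lambda>x. x i)"
proof -
  have c: "continuous_on V (\<lambda>x::nat \<Rightarrow> real. x i)"
    by (rule continuous_on_product_then_coordinatewise) (rule continuous_on_id)
  show ?thesis
  proof (cases k)
    case (Suc l)
    have "((\<lambda>t. (x(j := t)) i) has_real_derivative of_bool (i = j)) (at (x j))" for x :: "nat \<Rightarrow> real" and j
      by (cases "i = j") (auto intro!: derivative_eq_intros)
    then show ?thesis
      unfolding Suc using assms c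
      by (intro C_diff_SucI[where D = "\<lambda>j x. of_bool (i = j)"] C_diff_const) auto
  qed (use c in simp)
qed

lemma C_diff_add:
  assumes V: "openin (Euclidean_space n) V" and "C_diff n V k f" "C_diff n V k g"
  shows "C_diff n V k (\<lambda>x. f x + g x)"
  using assms(2,3)
proof (induction k arbitrary: f g)
  case (Suc k)
  show ?case
  proof (rule C_diff_SucI[OF V])
    show "((\<lambda>t. f (x(i := t)) + g (x(i := t))) has_real_derivative pderiv1 i f x + pderiv1 i g x) (at (x i))"
      if "x \<in> V" "i < n" for x i
      by (intro derivative_intros C_diff_pderiv1[OF Suc.prems(1) that] C_diff_pderiv1[OF Suc.prems(2) that])
  qed (use Suc in \<open>auto intro: continuous_intros\<close>)
qed (auto intro: continuous_intros)

lemma C_diff_mult: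
  assumes V: "openin (Euclidean_space n) V" and "C_diff n V k f" "C_diff n V k g"
  shows "C_diff n V k (\<lambda>x. f x * g x)"
  using assms(2,3)
proof (induction k arbitrary: f g)
  case (Suc k)
  show ?case
  proof (rule C_diff_SucI[OF V])
    show "((\<lambda>t. f (x(i := t)) * g (x(i := t))) has_real_derivative
        f x * pderiv1 i g x + pderiv1 i f x * g x) (at (x i))"
      if "x \<in> V" "i < n" for x i
      using DERIV_mult'[OF C_diff_pderiv1[OF Suc.prems(1) that] C_diff_pderiv1[OF Suc.prems(2) that]]
      by (simp only: fun_upd_triv)
    show "C_diff n V k (\<lambda>x. f x * pderiv1 i g x + pderiv1 i f x * g x)" if "i < n" for i
      using Suc.prems that C_diff_SucD[OF Suc.prems(1)] C_diff_SucD[OF Suc.prems(2)]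
      by (intro C_diff_add V Suc.IH) auto
  qed (use Suc.prems in \<open>auto intro: continuous_intros\<close>)
qed (auto intro: continuous_intros)

text \<open>\<open>W\<close> is open in the subspace containing \<open>V\<close>, so
  \<open>V\<close> and \<open>W\<close> have the same punctured neighbourhoods at
  \<open>x\<close>.\<close>

lemma continuous_on_local:
  fixes h :: "(nat \<Rightarrow> real) \<Rightarrow> real"
  assumes loc: "\<And>x. x \<in> V \<Longrightarrow> \<exists>W. openin (Euclidean_space n) W \<and> x \<in> W \<and> W \<subseteq> V \<and> continuous_on W h"
    and V: "V \<subseteq> {x. \<forall>i\<ge>n. x i = 0}"
  shows "continuous_on V h"
  unfolding continuous_on_eq_continuous_within
proof
  fix x assume "x \<in> V"
  from loc[OF this] obtain W
    where W: "openin (Euclidean_space n) W" "x \<in> W" "W \<subseteq> V" "continuous_on W h"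
    by auto
  obtain U where U: "open U" "W = U \<inter> {x. \<forall>i\<ge>n. x i = 0}"
    by (rule openin_Euclidean_spaceD[OF W(1)])
  have "at x within V = at x within W"
    by (rule at_within_nhd[of x U]) (use W U V in auto)
  then show "continuous (at x within V) h"
    using W(2,4) by (simp add: continuous_on_eq_continuous_within)
qed

lemma C_diff_local:
  assumes "\<And>x. x \<in> V \<Longrightarrow> \<exists>W. openin (Euclidean_space n) W \<and> x \<in> W \<and> W \<subseteq> V \<and> C_diff n W k h"
    and V: "V \<subseteq> {x. \<forall>i\<ge>n. x i = 0}"
  shows "C_diff n V k h"
  using assms(1)
proof (induction k arbitrary: h)
  case 0
  then show ?case using continuous_on_local[OF _ V] by simp
next
  case (Suc k)
  have "continuous_on V h"
    using Suc.prems C_diff_imp_continuous_on by (intro continuous_on_local[OF _ V]) meson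
  moreover have "C_diff n V k (pderiv1 i h)" if "i < n" for i
  proof (rule Suc.IH)
    fix x assume "x \<in> V"
    from Suc.prems[OF this] that
    show "\<exists>W. openin (Euclidean_space n) W \<and> x \<in> W \<and> W \<subseteq> V \<and> C_diff n W k (pderiv1 i h)"
      by auto
  qed
  moreover have "(\<lambda>t. h (x(i := t))) field_differentiable at (x i)" if "i < n" "x \<in> V" for i x
    using Suc.prems[OF that(2)] that(1) by auto
  ultimately show ?case by simp
qed

text \<open>By the mean value theorem, the second difference over a square of side \<open>h\<close>
  is \<open>h * h\<close> times \<open>F12\<close> at one interior point and \<open>h * h\<close>
  times \<open>F21\<close> at another. Continuity of both at the corner then forces equality
  there.\<close>

lemma mixed_derivatives_eq:
  fixes F F1 F2 F12 F21 :: "real \<Rightarrow> real \<Rightarrow> real"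
  assumes "0 < d"
    and F1: "\<And>s t. \<bar>s - a\<bar> < d \<Longrightarrow> \<bar>t - b\<bar> < d \<Longrightarrow> ((\<lambda>s. F s t) has_real_derivative F1 s t) (at s)"
    and F2: "\<And>s t. \<bar>s - a\<bar> < d \<Longrightarrow> \<bar>t - b\<bar> < d \<Longrightarrow> ((\<lambda>t. F s t) has_real_derivative F2 s t) (at t)"
    and F12: "\<And>s t. \<bar>s - a\<bar> < d \<Longrightarrow> \<bar>t - b\<bar> < d \<Longrightarrow> ((\<lambda>t. F1 s t) has_real_derivative F12 s t) (at t)"
    and F21: "\<And>s t. \<bar>s - a\<bar> < d \<Longrightarrow> \<bar>t - b\<bar> < d \<Longrightarrow> ((\<lambda>s. F2 s t) has_real_derivative F21 s t) (at s)"
    and c12: "\<And>e. 0 < e \<Longrightarrow> \<exists>r>0. \<forall>s t. \<bar>s - a\<bar> < r \<longrightarrow> \<bar>t - b\<bar> < r \<longrightarrow> \<bar>F12 s t - F12 a b\<bar> < e"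
    and c21: "\<And>e. 0 < e \<Longrightarrow> \<exists>r>0. \<forall>s t. \<bar>s - a\<bar> < r \<longrightarrow> \<bar>t - b\<bar> < r \<longrightarrow> \<bar>F21 s t - F21 a b\<bar> < e"
  shows "F12 a b = F21 a b"
proof (rule ccontr)
  assume ne: "F12 a b \<noteq> F21 a b"
  \<comment> \<open>Half the gap: numbers closer than \<open>e\<close> to \<open>F12 a b\<close> and
    to \<open>F21 a b\<close> cannot coincide.\<close>
  define e where "e = \<bar>F12 a b - F21 a b\<bar> / 2"
  have "0 < e" using ne by (simp add: e_def)
  from c12[OF this] c21[OF this] obtain r1 r2 where r: "0 < r1" "0 < r2"
    "\<And>s t. \<bar>s - a\<bar> < r1 \<Longrightarrow> \<bar>t - b\<bar> < r1 \<Longrightarrow> \<bar>F12 s t - F12 a b\<bar> < e"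
    "\<And>s t. \<bar>s - a\<bar> < r2 \<Longrightarrow> \<bar>t - b\<bar> < r2 \<Longrightarrow> \<bar>F21 s t - F21 a b\<bar> < e"
    by auto
  \<comment> \<open>Halving keeps the closed square of side \<open>h\<close> strictly inside all
    three neighbourhoods; the mean value theorem also uses its far edges.\<close>
  define h where "h = Min {d, r1, r2} / 2"
  have h: "0 < h" "h < d" "h < r1" "h < r2"
    using r(1,2) \<open>0 < d\<close> by (auto simp: h_def min_def)
  have "\<exists>s. a < s \<and> s < a + h \<and>
      (F (a + h) (b + h) - F (a + h) b) - (F a (b + h) - F a b) = (a + h - a) * (F1 s (b + h) - F1 s b)"
    by (rule MVT2) (use h in \<open>auto intro!: derivative_eq_intros F1\<close>)
  then obtain s where s: "a < s" "s < a + h"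
    "F (a + h) (b + h) - F (a + h) b - (F a (b + h) - F a b) = h * (F1 s (b + h) - F1 s b)"
    by auto
  have "\<exists>t. b < t \<and> t < b + h \<and> F1 s (b + h) - F1 s b = (b + h - b) * F12 s t"
    by (rule MVT2) (use h s in \<open>auto intro!: F12\<close>)
  then obtain t where t: "b < t" "t < b + h" "F1 s (b + h) - F1 s b = h * F12 s t"
    by auto
  have "\<exists>t. b < t \<and> t < b + h \<and>
      (F (a + h) (b + h) - F a (b + h)) - (F (a + h) b - F a b) = (b + h - b) * (F2 (a + h) t - F2 a t)"
    by (rule MVT2) (use h in \<open>auto intro!: derivative_eq_intros F2\<close>)
  then obtain t' where t': "b < t'" "t' < b + h"
    "F (a + h) (b + h) - F a (b + h) - (F (a + h) b - F a b) = h * (F2 (a + h) t' - F2 a t')"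
    by auto
  have "\<exists>s. a < s \<and> s < a + h \<and> F2 (a + h) t' - F2 a t' = (a + h - a) * F21 s t'"
    by (rule MVT2) (use h t' in \<open>auto intro!: F21\<close>)
  then obtain s' where s': "a < s'" "s' < a + h" "F2 (a + h) t' - F2 a t' = h * F21 s' t'"
    by auto
  have "h * (h * F12 s t) = h * (h * F21 s' t')"
    unfolding t(3)[symmetric] s'(3)[symmetric] s(3)[symmetric] t'(3)[symmetric] by simp
  then have "F12 s t = F21 s' t'" using h by simp
  moreover have "\<bar>F12 s t - F12 a b\<bar> < e" "\<bar>F21 s' t' - F21 a b\<bar> < e"
    using r(3)[of s t] r(4)[of s' t'] h s(1,2) t(1,2) s'(1,2) t'(1,2) by auto
  ultimately show False
    unfolding e_def by (smt (verit) field_sum_of_halves)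
qed

text \<open>Only the restriction of \<open>h\<close> to the coordinate plane through
  \<open>x\<close> in the directions \<open>i\<close> and \<open>j\<close> matters, which reduces
  the claim to two real variables.\<close>

lemma pderiv1_commute:
  assumes V: "openin (Euclidean_space n) V" and h: "C_diff n V 2 h" and "x \<in> V" "i < n" "j < n"
  shows "pderiv1 i (pderiv1 j h) x = pderiv1 j (pderiv1 i h) x"
proof (cases "i = j")
  case False
  define p where "p = (\<lambda>st::real \<times> real. x(i := fst st, j := snd st))"
  obtain U where U: "open U" "V = U \<inter> {x. \<forall>i\<ge>n. x i = 0}"
    using V by (rule openin_Euclidean_spaceD)
  have cp: "continuous_on UNIV p"
    unfolding p_def by (intro continuous_intros)
  have p0: "p (x i, x j) = x"
    by (auto simp: p_def)
  have "open (p -` U)"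
    using cp U by (simp add: open_vimage)
  moreover have "(x i, x j) \<in> p -` U"
    using U \<open>x \<in> V\<close> p0 by simp
  ultimately obtain d0 where d0: "0 < d0" "\<And>st. dist st (x i, x j) < d0 \<Longrightarrow> p st \<in> U"
    unfolding open_dist by (metis vimageE)
  have le: "dist (s, t) (x i, x j) \<le> \<bar>s - x i\<bar> + \<bar>t - x j\<bar>" for s t
    unfolding dist_prod_def dist_real_def using sqrt_sum_squares_le_sum_abs by simp
  \<comment> \<open>Distances in the plane are at most the sum of the two coordinate differences, so
    a square of half-width \<open>d0 / 2\<close> lies in the ball of radius
    \<open>d0\<close>.\<close>
  define d where "d = d0 / 2"
  have d: "0 < d" using d0 by (simp add: d_def)
  have pV: "p (s, t) \<in> V" if "\<bar>s - x i\<bar> < d" "\<bar>t - x j\<bar> < d" for s t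
    using d0(2)[of "(s, t)"] le[of s t] that U assms by (auto simp: p_def d_def)
  have h1: "C_diff n V (Suc 0) h" "C_diff n V (Suc 0) (pderiv1 i h)" "C_diff n V (Suc 0) (pderiv1 j h)"
    using h assms(4,5) C_diff_SucD[of n V 1 h] by (simp_all add: numeral_2_eq_2)
  have cont: "\<exists>r>0. \<forall>s t. \<bar>s - x i\<bar> < r \<longrightarrow> \<bar>t - x j\<bar> < r \<longrightarrow> \<bar>g (p (s, t)) - g (p (x i, x j))\<bar> < e"
    if g: "continuous_on V g" and "0 < e" for g :: "(nat \<Rightarrow> real) \<Rightarrow> real" and e
  proof -
    define B where "B = {st. \<bar>fst st - x i\<bar> < d \<and> \<bar>snd st - x j\<bar> < d}"
    have "open B"
      unfolding B_def by (intro open_Collect_conj open_Collect_less continuous_intros)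
    have "continuous_on B (\<lambda>st. g (p st))"
      by (rule continuous_on_compose2[OF g continuous_on_subset[OF cp]])
         (use pV in \<open>auto simp: B_def\<close>)
    then have "isCont (\<lambda>st. g (p st)) (x i, x j)"
      using \<open>open B\<close> d by (subst (asm) continuous_on_eq_continuous_at) (auto simp: B_def)
    then obtain r where r: "0 < r" "\<And>st. dist st (x i, x j) < r \<Longrightarrow> dist (g (p st)) (g (p (x i, x j))) < e"
      using \<open>0 < e\<close> unfolding continuous_at_eps_delta by metis
    show ?thesis
    proof (intro exI[of _ "r / 2"] conjI allI impI)
      fix s t assume "\<bar>s - x i\<bar> < r / 2" "\<bar>t - x j\<bar> < r / 2"
      then have "dist (s, t) (x i, x j) < r"
        using le[of s t] by linarith
      from r(2)[OF this] show "\<bar>g (p (s, t)) - g (p (x i, x j))\<bar> < e"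
        by (simp add: dist_real_def)
    qed (use r in simp)
  qed
  have "pderiv1 j (pderiv1 i h) (p (x i, x j)) = pderiv1 i (pderiv1 j h) (p (x i, x j))"
  proof (rule mixed_derivatives_eq[where F = "\<lambda>s t. h (p (s, t))" and d = d and a = "x i" and b = "x j"
        and ?F1.0 = "\<lambda>s t. pderiv1 i h (p (s, t))" and ?F2.0 = "\<lambda>s t. pderiv1 j h (p (s, t))"
        and ?F12.0 = "\<lambda>s t. pderiv1 j (pderiv1 i h) (p (s, t))"
        and ?F21.0 = "\<lambda>s t. pderiv1 i (pderiv1 j h) (p (s, t))"])
    have upd: "(p (s, t))(i := s') = p (s', t)" "(p (s, t))(j := t') = p (s, t')"
      "p (s, t) i = s" "p (s, t) j = t" for s t s' t'
      using False by (auto simp: p_def)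
    fix s t assume st: "\<bar>s - x i\<bar> < d" "\<bar>t - x j\<bar> < d"
    note * = C_diff_pderiv1[OF _ pV[OF st]]
    show "((\<lambda>s. h (p (s, t))) has_real_derivative pderiv1 i h (p (s, t))) (at s)"
      "((\<lambda>s. pderiv1 j h (p (s, t))) has_real_derivative pderiv1 i (pderiv1 j h) (p (s, t))) (at s)"
      using *[OF h1(1) \<open>i < n\<close>] *[OF h1(3) \<open>i < n\<close>] by (simp_all add: upd)
    show "((\<lambda>t. h (p (s, t))) has_real_derivative pderiv1 j h (p (s, t))) (at t)"
      "((\<lambda>t. pderiv1 i h (p (s, t))) has_real_derivative pderiv1 j (pderiv1 i h) (p (s, t))) (at t)"
      using *[OF h1(1) \<open>j < n\<close>] *[OF h1(2) \<open>j < n\<close>] by (simp_all add: upd)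
  qed (use d cont h1(2,3) assms in auto)
  then show ?thesis by (simp add: p0)
qed simp

section \<open>Superdomains as differential superalgebras\<close>

lemma C_infinity_mult:
  "openin (Euclidean_space n) V \<Longrightarrow> C_infinity n V f \<Longrightarrow> C_infinity n V g \<Longrightarrow> C_infinity n V (\<lambda>x. f x * g x)"
  and C_infinity_add:
  "openin (Euclidean_space n) V \<Longrightarrow> C_infinity n V f \<Longrightarrow> C_infinity n V g \<Longrightarrow> C_infinity n V (\<lambda>x. f x + g x)"
  and C_infinity_const: "openin (Euclidean_space n) V \<Longrightarrow> C_infinity n V (\<lambda>x. c)"
  and C_infinity_coord: "openin (Euclidean_space n) V \<Longrightarrow> C_infinity n V (\<lambda>x. x i)"
  by (auto simp: C_infinity_iff_C_diff C_diff_mult C_diff_add C_diff_const C_diff_coord)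

lemma C_infinity_cong:
  "openin (Euclidean_space n) V \<Longrightarrow> (\<And>y. y \<in> V \<Longrightarrow> f y = g y) \<Longrightarrow> C_infinity n V f \<Longrightarrow> C_infinity n V g"
  unfolding C_infinity_iff_C_diff using C_diff_cong by blast

lemma C_infinity_sum:
  assumes "openin (Euclidean_space n) V" "\<And>i. i \<in> I \<Longrightarrow> C_infinity n V (f i)"
  shows "C_infinity n V (\<lambda>x. \<Sum>i\<in>I. f i x)"
  using assms(2)
  by (induction I rule: infinite_finite_induct)
     (auto intro: C_infinity_add C_infinity_const assms(1))

lemma C_infinity_pderiv1: "C_infinity n V f \<Longrightarrow> i < n \<Longrightarrow> C_infinity n V (pderiv1 i f)"
  using C_infinity_unfold[of n V f] by simp

lemma C_infinity_has_derivative: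
  assumes "C_infinity n V h" "x \<in> V" "i < n"
  shows "((\<lambda>t. h (x(i := t))) has_real_derivative pderiv1 i h x) (at (x i))"
  using assms C_diff_pderiv1[of n V 0 h] by (simp only: C_infinity_iff_C_diff)

lemma sf_smooth_cong:
  "openin (Euclidean_space n) V \<Longrightarrow> sf_eq m V f g \<Longrightarrow> sf_smooth n m V f \<Longrightarrow> sf_smooth n m V g"
  unfolding sf_smooth_def sf_eq_def by (metis C_infinity_cong)

lemma sf_smooth_subset: "sf_smooth n m V f \<Longrightarrow> W \<subseteq> V \<Longrightarrow> sf_smooth n m W f"
  unfolding sf_smooth_def C_infinity_iff_C_diff using C_diff_subset by blast

lemma sf_smooth_add:
  "openin (Euclidean_space n) V \<Longrightarrow> sf_smooth n m V f \<Longrightarrow> sf_smooth n m V g \<Longrightarrow> sf_smooth n m V (f + g)"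
  using C_infinity_add by (simp add: sf_smooth_def plus_fun_def)

lemma sf_smooth_scl:
  "openin (Euclidean_space n) V \<Longrightarrow> sf_smooth n m V f \<Longrightarrow> sf_smooth n m V (scl c f)"
  by (auto simp: sf_smooth_def scl_def intro: C_infinity_mult C_infinity_const)

lemma sf_smooth_const: "openin (Euclidean_space n) V \<Longrightarrow> sf_smooth n m V (sf_const c)"
  by (auto simp: sf_smooth_def sf_const_def intro: C_infinity_const)

lemma sf_smooth_coord_fun: "openin (Euclidean_space n) V \<Longrightarrow> sf_smooth n m V (coord_fun i)"
proof (cases i)
  case (Inl k)
  assume "openin (Euclidean_space n) V"
  then have "C_infinity n V (\<lambda>x. if I = {} then x k else 0)" for I :: "nat set"
    by (cases "I = {}") (simp_all add: C_infinity_const C_infinity_coord)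
  then show ?thesis by (simp add: Inl sf_smooth_def)
qed (simp add: sf_smooth_def C_infinity_const)

lemma sf_smooth_mult:
  assumes "openin (Euclidean_space n) V" "sf_smooth n m V f" "sf_smooth n m V g"
  shows "sf_smooth n m V (f \<star> g)"
  unfolding sf_smooth_def
proof (intro allI impI)
  fix K assume K: "K \<subseteq> {..<m}"
  have eq: "(f \<star> g) K = (\<lambda>x. \<Sum>I\<in>Pow K. sg (inversions I (K - I)) * f I x * g (K - I) x)"
    by (simp add: fun_eq_iff sf_mult_eq)
  have "C_infinity n V (f I)" "C_infinity n V (g (K - I))" if "I \<in> Pow K" for I
    using that K assms unfolding sf_smooth_def by blast+
  then show "C_infinity n V ((f \<star> g) K)"
    unfolding eq by (intro C_infinity_sum C_infinity_mult C_infinity_const assms(1))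
qed

lemma sf_smooth_pd:
  assumes "openin (Euclidean_space n) V" "sf_smooth n m V f" "i \<in> coords n m"
  shows "sf_smooth n m V (pd i f)"
proof (cases i)
  case (Inl k)
  then show ?thesis
    using assms by (auto simp: sf_smooth_def coords_def intro: C_infinity_pderiv1)
next
  case (Inr k)
  have "C_infinity n V (pd (Inr k) f I)" if "I \<subseteq> {..<m}" for I
    using assms that Inr
    by (cases "k \<in> I") (auto simp: sf_smooth_def coords_def intro!: C_infinity_mult C_infinity_const)
  then show ?thesis
    unfolding Inr sf_smooth_def by blast
qed

text \<open>
  Restricting coefficients to \<open>V\<close> turns \<open>sf_eq m V\<close> into equality, while all superfunctions, on
  whatever superdomain, live in one and the same algebra.
\<close>

lift_definition loc :: "nat \<Rightarrow> (nat \<Rightarrow> real) set \<Rightarrow> sfun \<Rightarrow> superfun" is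
  "\<lambda>m V f I x. if I \<subseteq> {..<m} \<and> x \<in> V then f I x else 0"
  by (auto simp: fun_eq_iff dest: finite_subset[OF _ finite_lessThan])

lemma loc_eq_iff: "loc m V f = loc m V g \<longleftrightarrow> sf_eq m V f g"
  by transfer (auto simp: sf_eq_def fun_eq_iff)

lemma loc_zero [simp]: "loc m V 0 = 0"
  by transfer (auto simp: fun_eq_iff)

lemma loc_add: "loc m V (f + g) = loc m V f + loc m V g"
  by transfer (auto simp: fun_eq_iff)

lemma loc_diff: "loc m V (f - g) = loc m V f - loc m V g"
  by transfer (auto simp: fun_eq_iff)

lemma loc_scl: "loc m V (scl c f) = c *\<^sub>R loc m V f"
  by transfer (auto simp: fun_eq_iff scl_def)

lemma loc_sum: "loc m V (\<Sum>i\<in>I. f i) = (\<Sum>i\<in>I. loc m V (f i))"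
  by (induction I rule: infinite_finite_induct)
     (simp_all only: sum.insert sum.infinite sum.empty loc_add loc_zero not_False_eq_True if_False)

lemma loc_mult: "loc m V (f \<star> g) = loc m V f * loc m V g"
proof (transfer, intro ext)
  fix m V K x and f g :: sfun
  let ?r = "\<lambda>(f::sfun) I x. if I \<subseteq> {..<m} \<and> x \<in> V then f I x else 0"
  show "?r (f \<star> g) K x = (?r f \<star> ?r g) K x"
  proof (cases "K \<subseteq> {..<m} \<and> x \<in> V")
    case True
    then have "I \<subseteq> {..<m}" "K - I \<subseteq> {..<m}" if "I \<in> Pow K" for I
      using that by blast+
    then have "(f \<star> g) K x = (?r f \<star> ?r g) K x"
      unfolding sf_mult_eq using True by (intro sum.cong) auto
    then show ?thesis
      using True by simp
  next
    case False
    have "?r f I x * ?r g (K - I) x = 0" if "I \<subseteq> K" for I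
      using False that by auto
    then have "(?r f \<star> ?r g) K x = 0"
      unfolding sf_mult_eq by (intro sum.neutral ballI) (simp only: mult.assoc, auto)
    then show ?thesis by (simp only: if_not_P[OF False])
  qed
qed

lemma loc_Rep_loc [simp]: "loc m V (Rep_superfun (loc m V f)) = loc m V f"
  by transfer (auto simp: fun_eq_iff)

lemma homogeneous_loc_iff: "homogeneous p (loc m V f) \<longleftrightarrow> sf_parity m V p f"
  by (auto simp: homogeneous_def sf_parity_def loc.rep_eq)

text \<open>The outer \<open>loc\<close> discards what \<open>pd\<close> yields off
  \<open>V\<close>: the extension by zero need not be differentiable at the boundary.\<close>

definition dloc :: "nat \<Rightarrow> (nat \<Rightarrow> real) set \<Rightarrow> idx \<Rightarrow> superfun \<Rightarrow> superfun" where
  "dloc m V i F = loc m V (pd i (Rep_superfun F))"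

text \<open>Truncation does not disturb the derivative: for even \<open>i\<close> because
  \<open>V\<close> is open, for odd \<open>i\<close> because \<open>insert k I\<close> stays inside
  \<open>{..<m}\<close> when \<open>k < m\<close>.\<close>

lemma loc_pd:
  assumes "openin (Euclidean_space n) V" "i \<in> coords n m"
  shows "loc m V (pd i f) = dloc m V i (loc m V f)"
proof -
  have "sf_eq m V (pd i f) (pd i (Rep_superfun (loc m V f)))"
  proof (cases i)
    case (Inl k)
    then have "k < n" using assms(2) by (auto simp: coords_def)
    then show ?thesis
      unfolding Inl sf_eq_def
      by (auto simp: loc.rep_eq intro!: pderiv1_cong[OF assms(1)])
  next
    case (Inr k)
    then show ?thesis
      using assms(2) by (auto simp: sf_eq_def loc.rep_eq coords_def)
  qed
  then show ?thesis
    by (simp add: dloc_def loc_eq_iff)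
qed

section \<open>Leibniz rules for odd and even derivatives\<close>

definition smooth_algebra :: "nat \<Rightarrow> nat \<Rightarrow> (nat \<Rightarrow> real) set \<Rightarrow> superfun set" where
  "smooth_algebra n m V = loc m V ` {f. sf_smooth n m V f}"

lemma sum_Pow_insert:
  assumes "finite K" "j \<notin> K"
  shows "(\<Sum>I\<in>Pow (insert j K). h I) = (\<Sum>I\<in>Pow K. h I + h (insert j I) :: real)"
proof -
  have "inj_on (insert j) (Pow K)"
    using assms(2) by (fastforce simp: inj_on_def)
  moreover have "Pow K \<inter> insert j ` Pow K = {}"
    using assms(2) by auto
  ultimately show ?thesis
    using assms(1) by (simp add: Pow_insert sum.union_disjoint sum.reindex sum.distrib)
qed

lemma sg_cong: "even a = even b \<Longrightarrow> sg a = sg b"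
  by (simp add: minus_one_power_iff)

text \<open>The coefficients are compared one by one. Homogeneity of \<open>f\<close> enters through
  the sign that the derivative acquires when it passes \<open>f\<close>: only sets \<open>I\<close>
  with \<open>card I\<close> congruent to \<open>p\<close> contribute.\<close>

lemma pd_odd_mult:
  assumes "finite K" and hom: "\<And>I. card I mod 2 \<noteq> p mod 2 \<Longrightarrow> f I x = 0"
  shows "pd (Inr j) (f \<star> g) K x = (pd (Inr j) f \<star> g) K x + sg p * (f \<star> pd (Inr j) g) K x"
proof -
  have pd_in: "pd (Inr j) h I = (\<lambda>x. 0)" if "j \<in> I" for h I
    using that by auto
  have pd_notin: "pd (Inr j) h I = (\<lambda>x. sg (count_below j I) * h (insert j I) x)" if "j \<notin> I" for h I
    using that by (auto simp: count_below_def)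
  have signs: "inversions (insert j I) (K - I) = count_below j (K - I) + inversions I (K - I)"
    "inversions I (insert j (K - I)) + count_below j I = inversions I (K - I) + card I"
    "count_below j K = count_below j I + count_below j (K - I)"
    "card (insert j I) = Suc (card I)" "insert j K - I = insert j (K - I)"
    "insert j K - insert j I = K - I"
    if "I \<subseteq> K" "j \<notin> K" "finite K" for I K
  proof -
    have fin: "finite I" "finite (K - I)" and nin: "j \<notin> I"
      using that finite_subset by auto
    show "inversions (insert j I) (K - I) = count_below j (K - I) + inversions I (K - I)"
      using inversions_Un_left[of "{j}" I "K - I"] fin nin by (simp add: inversions_singleton_left)
    show "inversions I (insert j (K - I)) + count_below j I = inversions I (K - I) + card I"
      using inversions_Un_right[of "{j}" "K - I" I] inversions_singleton_right[of I j] fin nin that(2)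
      by simp
    show "count_below j K = count_below j I + count_below j (K - I)"
      using inversions_Un_right[of I "K - I" "{j}"] fin that(1)
      by (simp add: inversions_singleton_left Un_absorb1)
    show "card (insert j I) = Suc (card I)" using fin nin by simp
  qed (use that in auto)
  show ?thesis
  proof (cases "j \<in> K")
    case False
    let ?h = "\<lambda>I. sg (inversions I (insert j K - I)) * f I x * g (insert j K - I) x"
    \<comment> \<open>The subsets of \<open>insert j K\<close> are grouped by whether
      \<open>\<xi>_j\<close> comes from \<open>g\<close> or from \<open>f\<close>.\<close>
    have "pd (Inr j) (f \<star> g) K x = sg (count_below j K) * (\<Sum>I\<in>Pow K. ?h I + ?h (insert j I))"
      unfolding pd_notin[OF False] sf_mult_eq sum_Pow_insert[OF assms(1) False] ..
    also have "\<dots> = (\<Sum>I\<in>Pow K. sg (inversions I (K - I)) * pd (Inr j) f I x * g (K - I) x +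
        sg p * (sg (inversions I (K - I)) * f I x * pd (Inr j) g (K - I) x))"
      unfolding sum_distrib_left
    proof (rule sum.cong[OF refl])
      fix I assume "I \<in> Pow K"
      then have I: "I \<subseteq> K" "j \<notin> I" "j \<notin> K - I" using False by auto
      note s = signs[OF I(1) False assms(1)]
      have "sg (count_below j K + inversions (insert j I) (K - I)) = sg (inversions I (K - I) + count_below j I)"
        by (rule sg_cong) (auto simp: s(1,3))
      moreover have "sg (count_below j K + inversions I (insert j (K - I))) * f I x =
          sg (p + inversions I (K - I) + count_below j (K - I)) * f I x"
      proof (cases "f I x = 0")
        case False
        then have "even (card I) = even p" using hom by (metis even_iff_mod_2_eq_zero)
        moreover have "even (inversions I (insert j (K - I)) + count_below j I) = even (inversions I (K - I) + card I)"
          using s(2) by simp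
        ultimately have "sg (count_below j K + inversions I (insert j (K - I))) =
            sg (p + inversions I (K - I) + count_below j (K - I))"
          by (intro sg_cong) (auto simp: s(3))
        then show ?thesis by simp
      qed simp
      ultimately show "sg (count_below j K) * (?h I + ?h (insert j I)) =
          sg (inversions I (K - I)) * pd (Inr j) f I x * g (K - I) x +
          sg p * (sg (inversions I (K - I)) * f I x * pd (Inr j) g (K - I) x)"
        unfolding pd_notin[OF I(2)] pd_notin[OF I(3)] s(5,6) power_add
        by (simp add: algebra_simps) (auto simp: mult.assoc[symmetric])
    qed
    finally show ?thesis
      unfolding sf_mult_eq by (simp only: sum.distrib sum_distrib_left)
  next
    case True
    define L where "L = K - {j}"
    have L: "K = insert j L" "j \<notin> L" "finite L" using True assms(1) by (auto simp: L_def)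
    \<comment> \<open>Here the left side is 0. On the right both products pair
      \<open>f (insert j I)\<close> with \<open>g (insert j (L - I))\<close>, with opposite signs;
      this cancellation reflects \<open>\<xi>_j \<xi>_j = 0\<close>.\<close>
    have "(pd (Inr j) f \<star> g) K x + sg p * (f \<star> pd (Inr j) g) K x =
      (\<Sum>I\<in>Pow L. sg (inversions I (insert j (L - I))) * (sg (count_below j I) * f (insert j I) x) * g (insert j (L - I)) x +
         sg p * (sg (inversions (insert j I) (L - I)) * f (insert j I) x *
           (sg (count_below j (L - I)) * g (insert j (L - I)) x)))"
      unfolding sf_mult_eq L(1) sum_Pow_insert[OF L(3,2)] sum_distrib_left sum.distrib[symmetric]
    proof (rule sum.cong[OF refl], goal_cases)
      case (1 I)
      then have I: "I \<subseteq> L" "j \<notin> I" "j \<notin> L - I" using L(2) by auto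
      show ?case
        unfolding signs(5,6)[OF I(1) L(2,3)] pd_notin[OF I(2)] pd_notin[OF I(3)]
        by (simp add: pd_in del: pd.simps)
    qed
    also have "\<dots> = 0"
    proof (intro sum.neutral ballI)
      fix I assume "I \<in> Pow L"
      then have I: "I \<subseteq> L" by auto
      note s = signs[OF I L(2,3)]
      have "(sg (inversions I (insert j (L - I)) + count_below j I) +
          sg (p + inversions (insert j I) (L - I) + count_below j (L - I))) * f (insert j I) x = 0"
      proof (cases "f (insert j I) x = 0")
        case False
        then have "even (Suc (card I)) = even p" using hom s(4) by (metis even_iff_mod_2_eq_zero)
        then show ?thesis
          by (auto simp: s(1,2) minus_one_power_iff)
      qed simp
      moreover have "a * (b * f) * g + c * (d * f * (e * g)) = 0" if "(a * b + c * d * e) * f = 0"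
        for a b c d e f g :: real
        using that by algebra
      ultimately show "sg (inversions I (insert j (L - I))) * (sg (count_below j I) * f (insert j I) x) * g (insert j (L - I)) x +
         sg p * (sg (inversions (insert j I) (L - I)) * f (insert j I) x *
           (sg (count_below j (L - I)) * g (insert j (L - I)) x)) = 0"
        unfolding power_add by blast
    qed
    finally show ?thesis
      using True by (simp only: pd_in)
  qed
qed

lemma pd_even_mult:
  assumes "K \<subseteq> {..<m}" "x \<in> V" "i < n" "sf_smooth n m V f" "sf_smooth n m V g"
  shows "pd (Inl i) (f \<star> g) K x = (pd (Inl i) f \<star> g) K x + (f \<star> pd (Inl i) g) K x"
proof -
  have "((\<lambda>t. f I (x(i := t)) * g (K - I) (x(i := t))) has_real_derivative
      f I x * pderiv1 i (g (K - I)) x + pderiv1 i (f I) x * g (K - I) x) (at (x i))"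
    if "I \<in> Pow K" for I
  proof -
    have "C_infinity n V (f I)" "C_infinity n V (g (K - I))"
      using assms that unfolding sf_smooth_def by blast+
    from DERIV_mult'[OF this[THEN C_infinity_has_derivative, OF assms(2,3)]]
    show ?thesis
      by (simp only: fun_upd_triv)
  qed
  then have "((\<lambda>t. (f \<star> g) K (x(i := t))) has_real_derivative (\<Sum>I\<in>Pow K. sg (inversions I (K - I)) *
      (f I x * pderiv1 i (g (K - I)) x + pderiv1 i (f I) x * g (K - I) x))) (at (x i))"
    unfolding sf_mult_eq mult.assoc by (intro DERIV_sum DERIV_cmult) auto
  then have "pderiv1 i ((f \<star> g) K) x = (\<Sum>I\<in>Pow K. sg (inversions I (K - I)) *
      (f I x * pderiv1 i (g (K - I)) x + pderiv1 i (f I) x * g (K - I) x))"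
    by (rule pderiv1_eqI)
  then show ?thesis
    by (simp add: sf_mult_eq algebra_simps sum.distrib)
qed

text \<open>The Leibniz rule asks for a homogeneous first factor because its sign depends on that
  parity. The element \<open>u\<close> is the constant function one on the domain; after truncation
  it differs in general from the 1 of the ambient algebra, so it acts as a unit only on
  \<open>A\<close>.\<close>

locale super_diff_algebra =
  fixes C :: "idx set" and A :: "'a::real_algebra_1 set" and hom :: "nat \<Rightarrow> 'a \<Rightarrow> bool"
    and D :: "idx \<Rightarrow> 'a \<Rightarrow> 'a" and X :: "idx \<Rightarrow> 'a" and u :: 'a
  assumes finite_C [simp]: "finite C"
    and A_add [simp]: "a \<in> A \<Longrightarrow> b \<in> A \<Longrightarrow> a + b \<in> A"
    and A_scaleR [simp]: "a \<in> A \<Longrightarrow> r *\<^sub>R a \<in> A"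
    and A_mult [simp]: "a \<in> A \<Longrightarrow> b \<in> A \<Longrightarrow> a * b \<in> A"
    and A_D [simp]: "a \<in> A \<Longrightarrow> i \<in> C \<Longrightarrow> D i a \<in> A"
    and A_u [simp]: "u \<in> A"
    and A_X [simp]: "X i \<in> A"
    and hom_cong: "hom p a \<Longrightarrow> even p = even q \<Longrightarrow> hom q a"
    and hom_zero [simp]: "hom p 0"
    and hom_add: "hom p a \<Longrightarrow> hom p b \<Longrightarrow> hom p (a + b)"
    and hom_scaleR: "hom p a \<Longrightarrow> hom p (r *\<^sub>R a)"
    and hom_mult: "hom p a \<Longrightarrow> hom q b \<Longrightarrow> hom (p + q) (a * b)"
    and hom_D: "hom p a \<Longrightarrow> hom (p + par i) (D i a)"
    and hom_X: "hom (par i) (X i)"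
    and commute: "hom p a \<Longrightarrow> hom q b \<Longrightarrow> a * b = sg (p * q) *\<^sub>R (b * a)"
    and D_add: "i \<in> C \<Longrightarrow> a \<in> A \<Longrightarrow> b \<in> A \<Longrightarrow> D i (a + b) = D i a + D i b"
    and D_scaleR: "i \<in> C \<Longrightarrow> a \<in> A \<Longrightarrow> D i (r *\<^sub>R a) = r *\<^sub>R D i a"
    and D_mult: "i \<in> C \<Longrightarrow> a \<in> A \<Longrightarrow> b \<in> A \<Longrightarrow> hom p a \<Longrightarrow>
      D i (a * b) = D i a * b + sg (par i * p) *\<^sub>R (a * D i b)"
    and D_D: "i \<in> C \<Longrightarrow> j \<in> C \<Longrightarrow> a \<in> A \<Longrightarrow> D i (D j a) = sg (par i * par j) *\<^sub>R D j (D i a)"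
    and D_X: "i \<in> C \<Longrightarrow> j \<in> C \<Longrightarrow> D i (X j) = (if i = j then u else 0)"
    and u_mult [simp]: "a \<in> A \<Longrightarrow> u * a = a" "a \<in> A \<Longrightarrow> a * u = a"

section \<open>The differential superalgebra of a superdomain\<close>

lemma Rep_add: "Rep_superfun (F + G) I x = Rep_superfun F I x + Rep_superfun G I x"
  and Rep_scaleR: "Rep_superfun (c *\<^sub>R F) I x = c * Rep_superfun F I x"
  and Rep_mult: "Rep_superfun (F * G) = Rep_superfun F \<star> Rep_superfun G"
  and Rep_zero: "Rep_superfun 0 I x = 0"
  by (simp_all add: plus_superfun.rep_eq scaleR_superfun.rep_eq scl_def times_superfun.rep_eq zero_superfun.rep_eq)

lemma smooth_algebraE:
  assumes "F \<in> smooth_algebra n m V" "openin (Euclidean_space n) V"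
  obtains "F = loc m V (Rep_superfun F)" "sf_smooth n m V (Rep_superfun F)"
proof -
  obtain f where f: "F = loc m V f" "sf_smooth n m V f"
    using assms(1) by (auto simp: smooth_algebra_def)
  then have "F = loc m V (Rep_superfun F)" by simp
  moreover have "sf_eq m V f (Rep_superfun F)"
    using f(1) by (simp add: sf_eq_def loc.rep_eq)
  then have "sf_smooth n m V (Rep_superfun F)"
    using f(2) assms(2) sf_smooth_cong by blast
  ultimately show ?thesis by (rule that)
qed

lemma homogeneous_dloc:
  assumes "homogeneous p F"
  shows "homogeneous (p + par i) (dloc m V i F)"
  unfolding dloc_def homogeneous_loc_iff sf_parity_def
proof (intro allI impI ballI)
  fix I x assume I: "I \<subseteq> {..<m}" "card I mod 2 \<noteq> (p + par i) mod 2"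
  show "pd i (Rep_superfun F) I x = 0"
  proof (cases i)
    case (Inl k)
    then have "Rep_superfun F I = (\<lambda>x. 0)"
      using assms I by (auto simp: homogeneous_def)
    then show ?thesis by (simp add: Inl pderiv1_def)
  next
    case (Inr k)
    have "card (insert k I) mod 2 \<noteq> p mod 2" if "k \<notin> I"
      using that I finite_subset[OF I(1)] by (simp add: Inr) presburger
    then show ?thesis
      using assms by (auto simp: Inr homogeneous_def)
  qed
qed

lemma dloc_mult:
  assumes V: "openin (Euclidean_space n) V" and "i \<in> coords n m"
    and F: "F \<in> smooth_algebra n m V" and G: "G \<in> smooth_algebra n m V" and p: "homogeneous p F"
  shows "dloc m V i (F * G) = dloc m V i F * G + sg (par i * p) *\<^sub>R (F * dloc m V i G)"
proof -
  obtain f where f: "F = loc m V f" "sf_smooth n m V f" "f = Rep_superfun F"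
    using F V smooth_algebraE by metis
  obtain g where g: "G = loc m V g" "sf_smooth n m V g" "g = Rep_superfun G"
    using G V smooth_algebraE by metis
  have "sf_eq m V (pd i (f \<star> g)) (pd i f \<star> g + scl (sg (par i * p)) (f \<star> pd i g))"
    unfolding sf_eq_def
  proof (intro allI impI ballI)
    fix K x assume K: "K \<subseteq> {..<m}" "x \<in> V"
    show "pd i (f \<star> g) K x = (pd i f \<star> g + scl (sg (par i * p)) (f \<star> pd i g)) K x"
    proof (cases i)
      case (Inl k)
      then show ?thesis
        using pd_even_mult[OF K _ f(2) g(2), of k] assms(2)
        by (auto simp: scl_def coords_def simp del: pd.simps)
    next
      case (Inr k)
      then show ?thesis
        using pd_odd_mult[of K p f x k g] p finite_subset[OF K(1)]
        by (auto simp: scl_def homogeneous_def f(3) simp del: pd.simps)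
    qed
  qed
  then have "loc m V (pd i (f \<star> g)) = loc m V (pd i f \<star> g + scl (sg (par i * p)) (f \<star> pd i g))"
    by (simp add: loc_eq_iff)
  then show ?thesis
    by (simp only: loc_add loc_scl loc_mult loc_pd[OF V assms(2)] f(1)[symmetric] g(1)[symmetric])
qed

text \<open>An odd derivative only reindexes coefficients up to sign, so it commutes with even ones;
  even pairs are covered by \<open>pderiv1_commute\<close>. For two distinct odd indices exactly one
  order of differentiation crosses the other variable, whence the minus sign; for a repeated index
  or one already in \<open>I\<close> both sides vanish.\<close>

lemma sf_eq_pd_commute:
  assumes V: "openin (Euclidean_space n) V" and i: "i \<in> coords n m" and j: "j \<in> coords n m"
    and f: "sf_smooth n m V f"
  shows "sf_eq m V (pd i (pd j f)) (scl (sg (par i * par j)) (pd j (pd i f)))"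
proof -
  have mixed: "pderiv1 k (pd (Inr l) f I) x = pd (Inr l) (pd (Inl k) f) I x"
    if "k < n" "l < m" "I \<subseteq> {..<m}" "x \<in> V" for k l I x
  proof (cases "l \<in> I")
    case False
    have "C_infinity n V (f (insert l I))"
      using f that by (simp add: sf_smooth_def)
    then have "((\<lambda>t. sg (card {k \<in> I. k < l}) * f (insert l I) (x(k := t))) has_real_derivative
        sg (card {k \<in> I. k < l}) * pderiv1 k (f (insert l I)) x) (at (x k))"
      using that by (intro DERIV_cmult C_infinity_has_derivative)
    then show ?thesis
      using False by (simp add: pderiv1_eqI)
  qed (simp add: pderiv1_def)
  have odd: "pd (Inr k) (pd (Inr l) f) I x = - pd (Inr l) (pd (Inr k) f) I x"
    if "I \<subseteq> {..<m}" for k l I x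
  proof (cases "k = l \<or> k \<in> I \<or> l \<in> I")
    case False
    have "finite I" using that finite_subset by blast
    then have "count_below l (insert k I) = count_below l I + of_bool (k < l)"
      "count_below k (insert l I) = count_below k I + of_bool (l < k)"
      using False by (simp_all add: count_below_insert)
    moreover have "pd (Inr k) (pd (Inr l) f) I x =
        sg (count_below k I + count_below l (insert k I)) * f (insert l (insert k I)) x"
      "pd (Inr l) (pd (Inr k) f) I x =
        sg (count_below l I + count_below k (insert l I)) * f (insert l (insert k I)) x"
      using False by (simp_all add: count_below_def power_add insert_commute)
    ultimately show ?thesis
      using False by (cases "k < l") (simp_all add: minus_one_power_iff insert_commute del: pd.simps)
  qed auto
  show ?thesis
    unfolding sf_eq_def
  proof (intro allI impI ballI)
    fix I x assume I: "I \<subseteq> {..<m}" "x \<in> V"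
    show "pd i (pd j f) I x = scl (sg (par i * par j)) (pd j (pd i f)) I x"
    proof (cases i; cases j)
      fix k l assume "i = Inl k" "j = Inl l"
      moreover have "C_diff n V 2 (f I)"
        using f I by (simp add: sf_smooth_def C_infinity_iff_C_diff)
      ultimately show ?thesis
        using pderiv1_commute[OF V _ I(2)] i j by (auto simp: scl_def coords_def)
    next
      fix k l assume "i = Inl k" "j = Inr l"
      then show ?thesis
        using mixed[of k l I x] I i j by (auto simp: scl_def coords_def simp del: pd.simps(2))
    next
      fix k l assume "i = Inr k" "j = Inl l"
      then show ?thesis
        using mixed[of l k I x] I i j by (auto simp: scl_def coords_def simp del: pd.simps(2))
    next
      fix k l assume "i = Inr k" "j = Inr l"
      then show ?thesis
        using odd[OF I(1), of k l x] by (simp add: scl_def del: pd.simps)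
    qed
  qed
qed

lemma super_diff_algebra_smooth_algebra:
  assumes V: "openin (Euclidean_space n) V"
  shows "super_diff_algebra (coords n m) (smooth_algebra n m V) homogeneous (dloc m V)
    (\<lambda>i. loc m V (coord_fun i)) (loc m V (sf_const 1))"
proof
  show "finite (coords n m)" by (simp add: coords_def)
next
  fix a b :: superfun assume "a \<in> smooth_algebra n m V" "b \<in> smooth_algebra n m V"
  then obtain f g where fg: "a = loc m V f" "sf_smooth n m V f" "b = loc m V g" "sf_smooth n m V g"
    by (auto simp: smooth_algebra_def)
  show "a + b \<in> smooth_algebra n m V" "a * b \<in> smooth_algebra n m V"
    unfolding fg loc_add[symmetric] loc_mult[symmetric] smooth_algebra_def
    using sf_smooth_add[OF V fg(2,4)] sf_smooth_mult[OF V fg(2,4)] by blast+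
  show "dloc m V i (a + b) = dloc m V i a + dloc m V i b" if i: "i \<in> coords n m" for i
  proof -
    have "sf_eq m V (pd i (f + g)) (pd i f + pd i g)"
      unfolding sf_eq_def
    proof (intro allI impI ballI)
      fix I x assume I: "I \<subseteq> {..<m}" "x \<in> V"
      show "pd i (f + g) I x = (pd i f + pd i g) I x"
      proof (cases i)
        case (Inl k)
        have "C_infinity n V (f I)" "C_infinity n V (g I)" "k < n"
          using fg I Inl i by (auto simp: sf_smooth_def coords_def)
        then show ?thesis
          using DERIV_add[OF C_infinity_has_derivative[of n V "f I" x k] C_infinity_has_derivative[of n V "g I" x k]] I
          by (simp add: Inl plus_fun_def pderiv1_eqI)
      qed (auto simp: algebra_simps)
    qed
    then have "loc m V (pd i (f + g)) = loc m V (pd i f + pd i g)"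
      by (simp add: loc_eq_iff)
    then show ?thesis
      by (simp only: fg(1,3) loc_add loc_pd[OF V i])
  qed
next
  fix a :: superfun and r :: real assume "a \<in> smooth_algebra n m V"
  then obtain f where f: "a = loc m V f" "sf_smooth n m V f"
    by (auto simp: smooth_algebra_def)
  show "r *\<^sub>R a \<in> smooth_algebra n m V"
    unfolding f loc_scl[symmetric] smooth_algebra_def using sf_smooth_scl[OF V f(2)] by blast
  show "loc m V (sf_const 1) * a = a" "a * loc m V (sf_const 1) = a"
    unfolding f loc_mult[symmetric] loc_eq_iff sf_eq_def
    using sf_mult_one_left sf_mult_one_right finite_subset by (metis finite_lessThan)+
  show "dloc m V i (r *\<^sub>R a) = r *\<^sub>R dloc m V i a" if i: "i \<in> coords n m" for i
  proof -
    have "sf_eq m V (pd i (scl r f)) (scl r (pd i f))"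
      unfolding sf_eq_def
    proof (intro allI impI ballI)
      fix I x assume I: "I \<subseteq> {..<m}" "x \<in> V"
      show "pd i (scl r f) I x = scl r (pd i f) I x"
      proof (cases i)
        case (Inl k)
        have "C_infinity n V (f I)" "k < n"
          using f I Inl i by (auto simp: sf_smooth_def coords_def)
        then show ?thesis
          using DERIV_cmult[OF C_infinity_has_derivative[of n V "f I" x k], of r] I
          by (simp add: Inl scl_def pderiv1_eqI)
      qed (auto simp: scl_def)
    qed
    then have "loc m V (pd i (scl r f)) = loc m V (scl r (pd i f))"
      by (simp add: loc_eq_iff)
    then show ?thesis
      by (simp only: f(1) loc_scl loc_pd[OF V i])
  qed
  show "dloc m V i a \<in> smooth_algebra n m V" if i: "i \<in> coords n m" for i
    unfolding f loc_pd[OF V i, symmetric] smooth_algebra_def using sf_smooth_pd[OF V f(2) i] by blast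
  show "dloc m V i (dloc m V j a) = sg (par i * par j) *\<^sub>R dloc m V j (dloc m V i a)"
    if "i \<in> coords n m" "j \<in> coords n m" for i j
    using sf_eq_pd_commute[OF V that f(2)]
    unfolding loc_eq_iff[symmetric] loc_scl loc_pd[OF V that(1)] loc_pd[OF V that(2)] f(1) .
next
  show "loc m V (sf_const 1) \<in> smooth_algebra n m V" "loc m V (coord_fun i) \<in> smooth_algebra n m V" for i
    using sf_smooth_const[OF V] sf_smooth_coord_fun[OF V] by (auto simp: smooth_algebra_def)
  show "homogeneous (par i) (loc m V (coord_fun i))" for i
    unfolding homogeneous_loc_iff sf_parity_def by (cases i) auto
  show "dloc m V i (loc m V (coord_fun j)) = (if i = j then loc m V (sf_const 1) else 0)"
    if "i \<in> coords n m" "j \<in> coords n m" for i j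
  proof -
    have "sf_eq m V (pd i (coord_fun j)) (if i = j then sf_const 1 else 0)"
      unfolding sf_eq_def
    proof (intro allI impI ballI)
      fix I and x :: "nat \<Rightarrow> real"
      show "pd i (coord_fun j) I x = (if i = j then sf_const 1 else 0) I x"
        by (cases i; cases j) (auto simp: pderiv1_def sf_const_def)
    qed
    then have "loc m V (pd i (coord_fun j)) = loc m V (if i = j then sf_const 1 else 0)"
      by (simp add: loc_eq_iff)
    then show ?thesis
      by (simp add: loc_pd[OF V that(1)])
  qed
next
  fix a b :: superfun and p q :: nat and r :: real
  show "homogeneous p 0"
    by (simp add: homogeneous_def Rep_zero)
  assume a: "homogeneous p a"
  show "even p = even q \<Longrightarrow> homogeneous q a"
    using a by (metis homogeneous_def even_iff_mod_2_eq_zero not_mod_2_eq_0_eq_1)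
  show "homogeneous p b \<Longrightarrow> homogeneous p (a + b)" "homogeneous p (r *\<^sub>R a)"
    using a by (simp_all add: homogeneous_def Rep_add Rep_scaleR)
  show "homogeneous (p + par i) (dloc m V i a)" for i
    using a by (rule homogeneous_dloc)
  assume b: "homogeneous q b"
  show "a * b = sg (p * q) *\<^sub>R (b * a)"
    using a b by (rule homogeneous_mult_commute)
  show "homogeneous (p + q) (a * b)"
    unfolding homogeneous_def
  proof (intro allI impI)
    fix K :: "nat set" and x assume K: "card K mod 2 \<noteq> (p + q) mod 2"
    show "Rep_superfun (a * b) K x = 0"
    proof (cases "finite K")
      case True
      have "Rep_superfun a I x * Rep_superfun b (K - I) x = 0" if "I \<subseteq> K" for I
      proof -
        have "card K = card I + card (K - I)"
          using True that by (metis card_Diff_subset card_mono finite_subset le_add_diff_inverse)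
        then have "card I mod 2 \<noteq> p mod 2 \<or> card (K - I) mod 2 \<noteq> q mod 2"
          using K mod_add_cong[of "card I" 2 p "card (K - I)" q] by auto
        then show ?thesis using a b unfolding homogeneous_def by auto
      qed
      then show ?thesis
        unfolding Rep_mult sf_mult_eq mult.assoc by (intro sum.neutral) auto
    qed (simp add: Rep_mult sf_mult_infinite)
  qed
qed (fact dloc_mult[OF V])

section \<open>The square of an odd Laplacian\<close>

context super_diff_algebra
begin

lemma A_zero [simp]: "0 \<in> A"
  using A_scaleR[OF A_u, of 0] by simp

lemma A_sum [simp]: "(\<And>i. i \<in> I \<Longrightarrow> f i \<in> A) \<Longrightarrow> (\<Sum>i\<in>I. f i) \<in> A"
  by (induction I rule: infinite_finite_induct) auto

lemma hom_sum: "(\<And>i. i \<in> I \<Longrightarrow> hom p (f i)) \<Longrightarrow> hom p (\<Sum>i\<in>I. f i)"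
  by (induction I rule: infinite_finite_induct) (auto intro: hom_add)

lemma D_zero [simp]: "i \<in> C \<Longrightarrow> D i 0 = 0"
  using D_scaleR[of i 0 0] by simp

lemma D_sum: "i \<in> C \<Longrightarrow> (\<And>j. j \<in> I \<Longrightarrow> f j \<in> A) \<Longrightarrow> D i (\<Sum>j\<in>I. f j) = (\<Sum>j\<in>I. D i (f j))"
proof (induction I rule: infinite_finite_induct)
  case (insert x I)
  then have "f x \<in> A" "(\<Sum>j\<in>I. f j) \<in> A" by simp_all
  then show ?case using insert by (simp add: D_add)
qed auto

text \<open>A derivation kills the unit: \<open>u * u = u\<close> gives
  \<open>D i u = 2 D i u\<close>. That \<open>u\<close> is even follows from
  \<open>D i (X i) = u\<close>, where the parity of \<open>i\<close> enters twice.\<close>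

lemma D_u [simp]:
  assumes "i \<in> C"
  shows "D i u = 0"
proof -
  have "hom 0 u"
    using hom_D[OF hom_X, of i i] assms hom_cong by (fastforce simp: D_X)
  then have "D i (u * u) = D i u * u + sg (par i * 0) *\<^sub>R (u * D i u)"
    using assms by (intro D_mult) auto
  then show ?thesis
    using assms by simp
qed

lemma D3_swap:
  assumes "f \<in> A" "i \<in> C" "j \<in> C" "k \<in> C"
  shows "D k (D j (D i f)) = sg ((par j + par k) * par i) *\<^sub>R D i (D k (D j f))"
proof -
  have "D k (D j (D i f)) = D k (sg (par j * par i) *\<^sub>R D i (D j f))"
    using assms D_D[of j i f] by simp
  also have "\<dots> = sg (par j * par i) *\<^sub>R sg (par k * par i) *\<^sub>R D i (D k (D j f))"
    using assms D_D[of k i "D j f"] by (simp add: D_scaleR)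
  finally show ?thesis
    by (simp add: algebra_simps power_add)
qed

lemma D4_swap:
  assumes "f \<in> A" "i \<in> C" "j \<in> C" "k \<in> C" "l \<in> C"
  shows "D l (D k (D j (D i f))) = sg ((par k + par l) * (par i + par j)) *\<^sub>R D j (D i (D l (D k f)))"
proof -
  have "D l (D k (D j (D i f))) = sg ((par k + par l) * par j) *\<^sub>R D j (D l (D k (D i f)))"
    using assms by (intro D3_swap) auto
  also have "\<dots> = sg ((par k + par l) * par j) *\<^sub>R sg ((par k + par l) * par i) *\<^sub>R D j (D i (D l (D k f)))"
    using assms by (subst D3_swap[of f i k l]) (simp_all add: D_scaleR)
  finally show ?thesis
    by (simp add: algebra_simps power_add)
qed

end

text \<open>The sum equals its own negative, and division by 2 is possible. This is the mechanism
  that removes the fourth-order part of the squared Laplacian and its part quadratic in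
  \<open>T\<close> without derivatives.\<close>

lemma sum_antisym:
  fixes t :: "'i \<Rightarrow> 'i \<Rightarrow> 'a::real_vector"
  assumes "\<And>x y. x \<in> I \<Longrightarrow> y \<in> I \<Longrightarrow> t x y = - t y x"
  shows "(\<Sum>x\<in>I. \<Sum>y\<in>I. t x y) = 0"
proof -
  have "(\<Sum>x\<in>I. \<Sum>y\<in>I. t x y) = (\<Sum>x\<in>I. \<Sum>y\<in>I. - t y x)"
    using assms by (intro sum.cong refl) blast
  also have "\<dots> = - (\<Sum>x\<in>I. \<Sum>y\<in>I. t x y)"
    by (subst sum.swap) (simp add: sum_negf)
  finally have "2 *\<^sub>R (\<Sum>x\<in>I. \<Sum>y\<in>I. t x y) = 0"
    unfolding scaleR_2 by (metis add.right_inverse)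
  then show ?thesis by simp
qed

section \<open>Bracket and Jacobi identity of an odd symmetric tensor\<close>

locale odd_symmetric_tensor = super_diff_algebra C A hom D X u
  for C and A :: "'a::real_algebra_1 set" and hom D X u +
  fixes S :: "idx \<Rightarrow> idx \<Rightarrow> 'a"
  assumes S_A [simp]: "i \<in> C \<Longrightarrow> j \<in> C \<Longrightarrow> S i j \<in> A"
    and S_hom: "i \<in> C \<Longrightarrow> j \<in> C \<Longrightarrow> hom (par i + par j + 1) (S i j)"
    and S_sym: "i \<in> C \<Longrightarrow> j \<in> C \<Longrightarrow> S i j = sg (par i * par j) *\<^sub>R S j i"
begin

text \<open>The coordinate form of \<open>odd_bracket\<close> for a first argument of parity
  \<open>p\<close>. The 2 is that of \<open>((S, f), g)\<close>.\<close>

definition bracket :: "nat \<Rightarrow> 'a \<Rightarrow> 'a \<Rightarrow> 'a" where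
  "bracket p a b = (2 * sg p) *\<^sub>R (\<Sum>i\<in>C. \<Sum>j\<in>C. sg (par i * p) *\<^sub>R (S i j * D j a * D i b))"

text \<open>Up to the factor \<open>4 * sg (par a + par b)\<close>, the iterated bracket
  \<open>[x^a, [x^b, x^c]]\<close>.\<close>

definition jacobi_term :: "idx \<Rightarrow> idx \<Rightarrow> idx \<Rightarrow> 'a" where
  "jacobi_term a b c = (\<Sum>i\<in>C. S a i * D i (S b c))"

text \<open>The Jacobi identity of three coordinates, scaled so that contraction with third
  derivatives turns its three terms into equal sums.\<close>

definition jacobi :: bool where
  "jacobi \<longleftrightarrow> (\<forall>a\<in>C. \<forall>b\<in>C. \<forall>c\<in>C. sg (par a) *\<^sub>R jacobi_term a b c +
     sg (par c * (par a + par b + 1)) *\<^sub>R jacobi_term c a b +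
     sg (par a * par b + par b) *\<^sub>R jacobi_term b a c = 0)"

text \<open>\<open>D j (X a)\<close> selects \<open>j = a\<close>, and the sign
  \<open>sg (par i * par a)\<close> is just the one that turns \<open>S i a\<close> into
  \<open>S a i\<close>.\<close>

lemma bracket_X_left:
  assumes "a \<in> C" "f \<in> A"
  shows "bracket (par a) (X a) f = (2 * sg (par a)) *\<^sub>R (\<Sum>i\<in>C. S a i * D i f)"
proof -
  have "(\<Sum>j\<in>C. sg (par i * par a) *\<^sub>R (S i j * D j (X a) * D i f)) = S a i * D i f" if i: "i \<in> C" for i
  proof -
    have "(\<Sum>j\<in>C. sg (par i * par a) *\<^sub>R (S i j * D j (X a) * D i f)) =
        (\<Sum>j\<in>C. if j = a then sg (par i * par a) *\<^sub>R (S i j * D i f) else 0)"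
      using assms i by (intro sum.cong) (auto simp: D_X mult.assoc)
    also have "\<dots> = S a i * D i f"
      using assms i S_sym[of a i] by (simp add: mult.commute)
    finally show ?thesis .
  qed
  then show ?thesis
    unfolding bracket_def by simp
qed

lemma bracket_X_right:
  assumes "c \<in> C" "f \<in> A"
  shows "bracket p f (X c) = (2 * sg p * sg (par c * p)) *\<^sub>R (\<Sum>j\<in>C. S c j * D j f)"
proof -
  have "(\<Sum>i\<in>C. \<Sum>j\<in>C. sg (par i * p) *\<^sub>R (S i j * D j f * D i (X c))) =
      (\<Sum>j\<in>C. \<Sum>i\<in>C. if i = c then sg (par i * p) *\<^sub>R (S i j * D j f) else 0)"
    by (subst sum.swap) (use assms in \<open>auto intro!: sum.cong simp: D_X\<close>)
  also have "\<dots> = sg (par c * p) *\<^sub>R (\<Sum>j\<in>C. S c j * D j f)"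
    using assms by (simp add: scaleR_sum_right)
  finally show ?thesis
    by (simp add: bracket_def)
qed

lemma bracket_X_X:
  assumes "a \<in> C" "b \<in> C"
  shows "bracket (par a) (X a) (X b) = (2 * sg (par a)) *\<^sub>R S a b"
proof -
  have "(\<Sum>i\<in>C. S a i * D i (X b)) = (\<Sum>i\<in>C. if i = b then S a i else 0)"
    using assms by (intro sum.cong) (auto simp: D_X)
  then show ?thesis
    using assms by (simp add: bracket_X_left)
qed

text \<open>Brackets of two coordinates are multiples of \<open>S a b\<close>, so each of the three
  iterated brackets is a multiple of one \<open>jacobi_term\<close>; the rest is bookkeeping of
  signs.\<close>

lemma jacobiI:
  assumes "\<And>a b c. a \<in> C \<Longrightarrow> b \<in> C \<Longrightarrow> c \<in> C \<Longrightarrow>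
    bracket (par a) (X a) (bracket (par b) (X b) (X c)) =
    bracket (par a + par b + 1) (bracket (par a) (X a) (X b)) (X c) +
    sg ((par a + 1) * (par b + 1)) *\<^sub>R bracket (par b) (X b) (bracket (par a) (X a) (X c))"
  shows jacobi
  unfolding jacobi_def
proof (intro ballI)
  fix a b c assume abc: "a \<in> C" "b \<in> C" "c \<in> C"
  have left: "bracket (par a) (X a) (bracket (par b) (X b) (X c)) = (4 * sg (par a + par b)) *\<^sub>R jacobi_term a b c"
    if "a \<in> C" "b \<in> C" "c \<in> C" for a b c
    using that unfolding bracket_X_X[OF that(2,3)]
    by (simp add: bracket_X_left D_scaleR jacobi_term_def power_add scaleR_sum_right[symmetric])
  have "bracket (par a + par b + 1) (bracket (par a) (X a) (X b)) (X c) =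
      (4 * (sg (par a + par b + 1) * sg (par c * (par a + par b + 1)) * sg (par a))) *\<^sub>R jacobi_term c a b"
    using abc unfolding bracket_X_X[OF abc(1,2)]
    by (simp add: bracket_X_right D_scaleR jacobi_term_def scaleR_sum_right[symmetric])
  moreover have "sg (par a + par b + 1) * sg (par c * (par a + par b + 1)) * sg (par a) =
      sg (par b + 1 + par c * (par a + par b + 1))"
    unfolding power_add[symmetric] by (rule sg_cong) auto
  ultimately have "(4 * sg (par a + par b)) *\<^sub>R jacobi_term a b c =
      (4 * sg (par b + 1 + par c * (par a + par b + 1))) *\<^sub>R jacobi_term c a b +
      (sg ((par a + 1) * (par b + 1)) * (4 * sg (par b + par a))) *\<^sub>R jacobi_term b a c"
    using assms[OF abc] left[OF abc] left[OF abc(2,1,3)] by (simp only: scaleR_scaleR)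
  also have "sg ((par a + 1) * (par b + 1)) * (4 * sg (par b + par a)) =
      4 * sg ((par a + 1) * (par b + 1) + par a + par b)"
    by (simp add: power_add)
  finally have eq: "(4 * sg (par a + par b)) *\<^sub>R jacobi_term a b c =
      (4 * sg (par b + 1 + par c * (par a + par b + 1))) *\<^sub>R jacobi_term c a b +
      (4 * sg ((par a + 1) * (par b + 1) + par a + par b)) *\<^sub>R jacobi_term b a c" .
  \<comment> \<open>Multiplication by \<open>sg (par b) / 4\<close> removes the common factor 4 and
    leaves \<open>sg (par a)\<close> in front of the first term, the normalisation chosen in
    \<open>jacobi\<close>.\<close>
  have sg: "sg (par b) / 4 * (4 * sg (par a + par b)) = sg (par a)"
    "sg (par b) / 4 * (4 * sg (par b + 1 + par c * (par a + par b + 1))) = - sg (par c * (par a + par b + 1))"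
    "sg (par b) / 4 * (4 * sg ((par a + 1) * (par b + 1) + par a + par b)) = - sg (par a * par b + par b)"
    by (auto simp: minus_one_power_iff)
  have "sg (par a) *\<^sub>R jacobi_term a b c = - sg (par c * (par a + par b + 1)) *\<^sub>R jacobi_term c a b +
      - sg (par a * par b + par b) *\<^sub>R jacobi_term b a c"
    using arg_cong[OF eq, of "\<lambda>x. (sg (par b) / 4) *\<^sub>R x"]
    by (simp only: scaleR_add_right scaleR_scaleR sg)
  then show "sg (par a) *\<^sub>R jacobi_term a b c +
     sg (par c * (par a + par b + 1)) *\<^sub>R jacobi_term c a b +
     sg (par a * par b + par b) *\<^sub>R jacobi_term b a c = 0"
    by (simp only: scaleR_minus_left) simp
qed

text \<open>Contract the Jacobi identity with \<open>D c (D b (D a f))\<close>. Permuting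
  derivatives and renaming indices identifies each of the three resulting sums with
  \<open>?X\<close>, so \<open>3 ?X = 0\<close>.\<close>

lemma jacobi_third_order:
  assumes jacobi "f \<in> A"
  shows "(\<Sum>a\<in>C. \<Sum>b\<in>C. \<Sum>c\<in>C. sg (par a) *\<^sub>R (jacobi_term a b c * D c (D b (D a f)))) = 0"
    (is "?X = 0")
proof -
  let ?E = "\<lambda>a b c. D c (D b (D a f))"
  have "0 = (\<Sum>a\<in>C. \<Sum>b\<in>C. \<Sum>c\<in>C. (sg (par a) *\<^sub>R jacobi_term a b c +
     sg (par c * (par a + par b + 1)) *\<^sub>R jacobi_term c a b +
     sg (par a * par b + par b) *\<^sub>R jacobi_term b a c) * ?E a b c)"
    using assms(1) by (simp add: jacobi_def)
  also have "\<dots> = ?X + (\<Sum>a\<in>C. \<Sum>b\<in>C. \<Sum>c\<in>C. (sg (par c * (par a + par b + 1)) *\<^sub>R jacobi_term c a b) * ?E a b c) +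
     (\<Sum>a\<in>C. \<Sum>b\<in>C. \<Sum>c\<in>C. (sg (par a * par b + par b) *\<^sub>R jacobi_term b a c) * ?E a b c)"
    by (simp add: distrib_right sum.distrib)
  also have "(\<Sum>a\<in>C. \<Sum>b\<in>C. \<Sum>c\<in>C. (sg (par c * (par a + par b + 1)) *\<^sub>R jacobi_term c a b) * ?E a b c) =
      (\<Sum>a\<in>C. \<Sum>b\<in>C. \<Sum>c\<in>C. sg (par c) *\<^sub>R (jacobi_term c a b * ?E c a b))"
  proof (intro sum.cong refl)
    fix a b c assume abc: "a \<in> C" "b \<in> C" "c \<in> C"
    have "?E c a b = sg ((par a + par b) * par c) *\<^sub>R ?E a b c"
      using D3_swap[of f c a b] abc assms(2) by simp
    moreover have "sg (par c * (par a + par b + 1)) = sg (par c) * sg ((par a + par b) * par c)"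
      by (simp add: algebra_simps power_add)
    ultimately show "(sg (par c * (par a + par b + 1)) *\<^sub>R jacobi_term c a b) * ?E a b c =
        sg (par c) *\<^sub>R (jacobi_term c a b * ?E c a b)"
      by (simp only: scaleR_scaleR mult_scaleR_left mult_scaleR_right)
  qed
  also have "\<dots> = (\<Sum>a\<in>C. \<Sum>c\<in>C. \<Sum>b\<in>C. sg (par c) *\<^sub>R (jacobi_term c a b * ?E c a b))"
    by (intro sum.cong refl sum.swap)
  also have "\<dots> = ?X"
    by (rule sum.swap)
  also have "(\<Sum>a\<in>C. \<Sum>b\<in>C. \<Sum>c\<in>C. (sg (par a * par b + par b) *\<^sub>R jacobi_term b a c) * ?E a b c) =
      (\<Sum>a\<in>C. \<Sum>b\<in>C. \<Sum>c\<in>C. sg (par b) *\<^sub>R (jacobi_term b a c * ?E b a c))"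
  proof (intro sum.cong refl)
    fix a b c assume abc: "a \<in> C" "b \<in> C" "c \<in> C"
    have "?E b a c = sg (par a * par b) *\<^sub>R ?E a b c"
      using D_D[of a b f] abc assms(2) by (simp add: D_scaleR)
    then show "(sg (par a * par b + par b) *\<^sub>R jacobi_term b a c) * ?E a b c =
        sg (par b) *\<^sub>R (jacobi_term b a c * ?E b a c)"
      by (simp only: scaleR_scaleR mult_scaleR_left mult_scaleR_right power_add mult.commute)
  qed
  also have "\<dots> = ?X"
    by (rule sum.swap)
  finally have "0 = ?X + ?X + ?X" .
  also have "\<dots> = (1 + 1 + 1) *\<^sub>R ?X"
    by (simp only: scaleR_left_distrib scaleR_one)
  finally show ?thesis by simp
qed

end

section \<open>The Laplacian of an odd tensor and its square\<close>

locale odd_laplacian = odd_symmetric_tensor C A hom D X u S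
  for C and A :: "'a::real_algebra_1 set" and hom D X u S +
  fixes T :: "idx \<Rightarrow> 'a"
  assumes T_A [simp]: "i \<in> C \<Longrightarrow> T i \<in> A"
    and T_hom: "i \<in> C \<Longrightarrow> hom (par i + 1) (T i)"
begin

definition lap :: "'a \<Rightarrow> 'a" where
  "lap f = (\<Sum>i\<in>C. \<Sum>j\<in>C. S i j * D j (D i f)) + (\<Sum>i\<in>C. T i * D i f)"

lemma lap_add: "a \<in> A \<Longrightarrow> b \<in> A \<Longrightarrow> lap (a + b) = lap a + lap b"
  by (simp add: lap_def D_add distrib_left sum.distrib)

lemma lap_scaleR: "a \<in> A \<Longrightarrow> lap (r *\<^sub>R a) = r *\<^sub>R lap a"
  by (simp add: lap_def D_scaleR scaleR_add_right scaleR_sum_right)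

lemma lap_zero: "lap 0 = 0"
  by (simp add: lap_def)

lemma lap_sum: "(\<And>i. i \<in> I \<Longrightarrow> f i \<in> A) \<Longrightarrow> lap (\<Sum>i\<in>I. f i) = (\<Sum>i\<in>I. lap (f i))"
proof (induction I rule: infinite_finite_induct)
  case (insert x I)
  then have "f x \<in> A" "(\<Sum>j\<in>I. f j) \<in> A" by simp_all
  then show ?case using insert by (simp add: lap_add)
qed (auto simp: lap_zero)

lemma lap_A [simp]: "a \<in> A \<Longrightarrow> lap a \<in> A"
  by (simp add: lap_def)

text \<open>\<open>S\<close> and \<open>T\<close> are odd, so moving \<open>a\<close> to the left of
  them combines all Leibniz signs into \<open>sg p\<close>. The last term measures how far a
  second-order operator is from being a derivation.\<close>

lemma lap_mult:
  assumes "a \<in> A" "b \<in> A" "hom p a"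
  shows "lap (a * b) = lap a * b + sg p *\<^sub>R (a * lap b) +
    2 *\<^sub>R (\<Sum>i\<in>C. \<Sum>j\<in>C. sg (par i * p) *\<^sub>R (S i j * D j a * D i b))"
proof -
  let ?s = "\<lambda>i j. sg (par i * p) *\<^sub>R (S i j * D j a * D i b)"
  have first: "T i * D i (a * b) = T i * D i a * b + sg p *\<^sub>R (a * (T i * D i b))" if i: "i \<in> C" for i
  proof -
    have "T i * D i (a * b) = T i * D i a * b + sg (par i * p) *\<^sub>R (T i * a * D i b)"
      using assms i by (simp add: D_mult[OF _ assms] distrib_left mult.assoc)
    also have "T i * a = sg ((par i + 1) * p) *\<^sub>R (a * T i)"
      using commute[OF T_hom[OF i] assms(3)] .
    also have "sg (par i * p) *\<^sub>R (sg ((par i + 1) * p) *\<^sub>R (a * T i) * D i b) = sg p *\<^sub>R (a * (T i * D i b))"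
      by (simp add: mult.assoc power_add algebra_simps flip: power_mult_distrib)
    finally show ?thesis .
  qed
  have second: "S i j * D j (D i (a * b)) = S i j * D j (D i a) * b + sg p *\<^sub>R (a * (S i j * D j (D i b))) +
      (sg (par j * (p + par i)) *\<^sub>R (S i j * D i a * D j b) + ?s i j)" if i: "i \<in> C" and j: "j \<in> C" for i j
  proof -
    have "D i (a * b) = D i a * b + sg (par i * p) *\<^sub>R (a * D i b)"
      using D_mult[OF i assms] .
    then have "D j (D i (a * b)) = D j (D i a) * b + sg (par j * (p + par i)) *\<^sub>R (D i a * D j b) +
        sg (par i * p) *\<^sub>R (D j a * D i b + sg (par j * p) *\<^sub>R (a * D j (D i b)))"
      using assms i j D_mult[OF j _ _ hom_D[OF assms(3), of i], of b] D_mult[OF j _ _ assms(3), of "D i b"]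
      by (simp add: D_add D_scaleR)
    then have "S i j * D j (D i (a * b)) = S i j * D j (D i a) * b +
        sg (par j * (p + par i)) *\<^sub>R (S i j * D i a * D j b) + ?s i j +
        (sg (par i * p) * sg (par j * p)) *\<^sub>R (S i j * a * D j (D i b))"
      by (simp add: distrib_left scaleR_add_right mult.assoc)
    also have "S i j * a = sg ((par i + par j + 1) * p) *\<^sub>R (a * S i j)"
      using commute[OF S_hom[OF i j] assms(3)] .
    also have "(sg (par i * p) * sg (par j * p)) *\<^sub>R (sg ((par i + par j + 1) * p) *\<^sub>R (a * S i j) * D j (D i b)) =
        (sg (par i * p) * sg (par j * p) * sg ((par i + par j + 1) * p)) *\<^sub>R (a * (S i j * D j (D i b)))"
      by (simp add: mult.assoc)
    also have "sg (par i * p) * sg (par j * p) * sg ((par i + par j + 1) * p) = sg p"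
      unfolding power_add[symmetric] by (rule sg_cong) auto
    finally show ?thesis by (simp add: algebra_simps)
  qed
  \<comment> \<open>The two mixed terms, with the derivatives distributed either way over
    \<open>a\<close> and \<open>b\<close>, agree by the symmetry of \<open>S\<close>; this produces
    the factor 2.\<close>
  have "(\<Sum>i\<in>C. \<Sum>j\<in>C. sg (par j * (p + par i)) *\<^sub>R (S i j * D i a * D j b)) = (\<Sum>i\<in>C. \<Sum>j\<in>C. ?s i j)"
  proof (subst sum.swap, intro sum.cong refl)
    fix i j assume i: "i \<in> C" and j: "j \<in> C"
    have "S j i = sg (par j * par i) *\<^sub>R S i j" using S_sym[OF j i] .
    then show "sg (par i * (p + par j)) *\<^sub>R (S j i * D j a * D i b) = ?s i j"
      by (simp add: algebra_simps power_add)
  qed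
  moreover have "(\<Sum>i\<in>C. \<Sum>j\<in>C. S i j * D j (D i (a * b))) =
      (\<Sum>i\<in>C. \<Sum>j\<in>C. S i j * D j (D i a)) * b + sg p *\<^sub>R (a * (\<Sum>i\<in>C. \<Sum>j\<in>C. S i j * D j (D i b))) +
      ((\<Sum>i\<in>C. \<Sum>j\<in>C. sg (par j * (p + par i)) *\<^sub>R (S i j * D i a * D j b)) + (\<Sum>i\<in>C. \<Sum>j\<in>C. ?s i j))"
    by (simp add: second sum.distrib sum_distrib_left sum_distrib_right scaleR_sum_right)
  moreover have "(\<Sum>i\<in>C. T i * D i (a * b)) =
      (\<Sum>i\<in>C. T i * D i a) * b + sg p *\<^sub>R (a * (\<Sum>i\<in>C. T i * D i b))"
    by (simp add: first sum.distrib sum_distrib_left sum_distrib_right scaleR_sum_right)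
  ultimately show ?thesis
    unfolding lap_def by (simp add: algebra_simps scaleR_2)
qed

lemma lap_generates_bracket:
  assumes "a \<in> A" "b \<in> A" "hom p a"
  shows "bracket p a b = sg p *\<^sub>R (lap (a * b) - lap a * b - sg p *\<^sub>R (a * lap b))"
  by (simp add: lap_mult[OF assms] bracket_def)

text \<open>Exchanging \<open>(k, l)\<close> with \<open>(i, j)\<close> commutes the two
  coefficients and the two pairs of derivatives. The signs combine to a minus because both
  coefficients, taken with their derivatives, are odd.\<close>

lemma fourth_order_cancel:
  assumes "f \<in> A"
  shows "(\<Sum>k\<in>C. \<Sum>l\<in>C. \<Sum>i\<in>C. \<Sum>j\<in>C.
    sg (par k + par l + 1) *\<^sub>R (S k l * (S i j * D j (D i (D l (D k f)))))) = 0"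
proof -
  \<comment> \<open>Pairs serve as single indices, so that \<open>sum_antisym\<close>
    applies.\<close>
  define t where "t = (\<lambda>(k, l) (i, j). sg (par k + par l + 1) *\<^sub>R (S k l * (S i j * D j (D i (D l (D k f))))))"
  have "(\<Sum>x\<in>C\<times>C. \<Sum>y\<in>C\<times>C. t x y) = 0"
  proof (rule sum_antisym)
    fix x y assume "x \<in> C \<times> C" "y \<in> C \<times> C"
    then obtain i j k l where x: "x = (k, l)" and y: "y = (i, j)"
      and C: "i \<in> C" "j \<in> C" "k \<in> C" "l \<in> C" by auto
    have "t x y = sg (par k + par l + 1) *\<^sub>R (S k l * S i j * D j (D i (D l (D k f))))"
      by (simp add: t_def x y mult.assoc)
    also have "S k l * S i j = sg ((par k + par l + 1) * (par i + par j + 1)) *\<^sub>R (S i j * S k l)"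
      using commute[OF S_hom S_hom] C by blast
    also have "D j (D i (D l (D k f))) = sg ((par i + par j) * (par k + par l)) *\<^sub>R D l (D k (D j (D i f)))"
      using C assms by (rule_tac D4_swap)
    also have "sg (par k + par l + 1) *\<^sub>R (sg ((par k + par l + 1) * (par i + par j + 1)) *\<^sub>R (S i j * S k l) *
        sg ((par i + par j) * (par k + par l)) *\<^sub>R D l (D k (D j (D i f)))) =
        (sg (par k + par l + 1) * sg ((par k + par l + 1) * (par i + par j + 1)) *
          sg ((par i + par j) * (par k + par l))) *\<^sub>R (S i j * (S k l * D l (D k (D j (D i f)))))"
      by (simp add: mult.assoc)
    also have "sg (par k + par l + 1) * sg ((par k + par l + 1) * (par i + par j + 1)) *
          sg ((par i + par j) * (par k + par l)) = - sg (par i + par j + 1)"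
      by (auto simp: minus_one_power_iff)
    finally show "t x y = - t y x"
      by (simp add: t_def x y)
  qed
  also have "(\<Sum>x\<in>C\<times>C. \<Sum>y\<in>C\<times>C. t x y) = (\<Sum>k\<in>C. \<Sum>l\<in>C. \<Sum>i\<in>C. \<Sum>j\<in>C. t (k, l) (i, j))"
    by (simp only: sum.cartesian_product')
  finally show ?thesis
    by (simp only: t_def case_prod_conv)
qed

text \<open>The same exchange, now between a second-order and a first-order part: the summands are
  different in form and cancel termwise once the indices are renamed.\<close>

lemma third_order_cancel:
  assumes "f \<in> A"
  shows "(\<Sum>k\<in>C. \<Sum>l\<in>C. \<Sum>i\<in>C. sg (par k + par l + 1) *\<^sub>R (S k l * (T i * D i (D l (D k f))))) +
    (\<Sum>k\<in>C. \<Sum>i\<in>C. \<Sum>j\<in>C. sg (par k + 1) *\<^sub>R (T k * (S i j * D j (D i (D k f))))) = 0"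
proof -
  have "(\<Sum>k\<in>C. \<Sum>i\<in>C. \<Sum>j\<in>C. sg (par k + 1) *\<^sub>R (T k * (S i j * D j (D i (D k f))))) =
      (\<Sum>k\<in>C. \<Sum>i\<in>C. \<Sum>l\<in>C. sg (par i + 1) *\<^sub>R (T i * (S k l * D l (D k (D i f)))))"
    by (rule sum.swap)
  also have "\<dots> = (\<Sum>k\<in>C. \<Sum>l\<in>C. \<Sum>i\<in>C. sg (par i + 1) *\<^sub>R (T i * (S k l * D l (D k (D i f)))))"
    by (intro sum.cong refl sum.swap)
  also have "\<dots> = (\<Sum>k\<in>C. \<Sum>l\<in>C. \<Sum>i\<in>C. - (sg (par k + par l + 1) *\<^sub>R (S k l * (T i * D i (D l (D k f))))))"
  proof (intro sum.cong refl)
    fix k l i assume C: "k \<in> C" "l \<in> C" "i \<in> C"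
    have "T i * S k l = sg ((par i + 1) * (par k + par l + 1)) *\<^sub>R (S k l * T i)"
      using commute[OF T_hom S_hom] C by blast
    moreover have "D l (D k (D i f)) = sg ((par k + par l) * par i) *\<^sub>R D i (D l (D k f))"
      using C assms by (rule_tac D3_swap)
    ultimately have "sg (par i + 1) *\<^sub>R (T i * (S k l * D l (D k (D i f)))) =
       (sg (par i + 1) * sg ((par i + 1) * (par k + par l + 1)) * sg ((par k + par l) * par i)) *\<^sub>R
         (S k l * (T i * D i (D l (D k f))))"
      by (simp add: mult.assoc[symmetric] del: power_Suc)
    also have "sg (par i + 1) * sg ((par i + 1) * (par k + par l + 1)) * sg ((par k + par l) * par i) =
        - sg (par k + par l + 1)"
      by (auto simp: minus_one_power_iff)
    finally show "sg (par i + 1) *\<^sub>R (T i * (S k l * D l (D k (D i f)))) =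
        - (sg (par k + par l + 1) *\<^sub>R (S k l * (T i * D i (D l (D k f)))))"
      by simp
  qed
  finally show ?thesis
    by (simp add: sum_negf)
qed

lemma second_order_cancel:
  assumes "f \<in> A"
  shows "(\<Sum>k\<in>C. \<Sum>i\<in>C. sg (par k + 1) *\<^sub>R (T k * (T i * D i (D k f)))) = 0"
proof (rule sum_antisym)
  fix k i assume C: "k \<in> C" "i \<in> C"
  have "T k * T i = sg ((par k + 1) * (par i + 1)) *\<^sub>R (T i * T k)"
    using commute[OF T_hom T_hom] C by blast
  moreover have "D i (D k f) = sg (par i * par k) *\<^sub>R D k (D i f)"
    using C assms by (intro D_D) auto
  ultimately have "sg (par k + 1) *\<^sub>R (T k * (T i * D i (D k f))) =
      (sg (par k + 1) * sg ((par k + 1) * (par i + 1)) * sg (par i * par k)) *\<^sub>R (T i * (T k * D k (D i f)))"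
    by (simp add: mult.assoc[symmetric] del: power_Suc)
  also have "sg (par k + 1) * sg ((par k + 1) * (par i + 1)) * sg (par i * par k) = - sg (par i + 1)"
    by (auto simp: minus_one_power_iff)
  finally show "sg (par k + 1) *\<^sub>R (T k * (T i * D i (D k f))) = - (sg (par i + 1) *\<^sub>R (T i * (T k * D k (D i f))))"
    by simp
qed

text \<open>The coefficients of the second derivatives in the squared Laplacian, in symmetrised
  form. The cross term with derivatives of \<open>T\<close> arises with a factor 2; placing one copy
  in each index order gives coefficients with the symmetry needed to recover them from the
  operator.\<close>

definition second_symbol :: "idx \<Rightarrow> idx \<Rightarrow> 'a" where
  "second_symbol k l = lap (S k l) + (\<Sum>j\<in>C. sg (par k) *\<^sub>R (S k j * D j (T l))) +
     (\<Sum>j\<in>C. sg (par l * (par k + 1)) *\<^sub>R (S l j * D j (T k)))"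

text \<open>\<open>lap_mult\<close> is applied to each product \<open>S k l * D l (D k f)\<close>
  and \<open>T k * D k f\<close>. It separates derivatives of the coefficients, undifferentiated
  coefficients, and cross terms; these are handled in turn.\<close>

lemma lap_lap:
  assumes jac: jacobi and f: "f \<in> A"
  shows "lap (lap f) = (\<Sum>k\<in>C. \<Sum>l\<in>C. second_symbol k l * D l (D k f)) + (\<Sum>k\<in>C. lap (T k) * D k f)"
proof -
  let ?S = "\<lambda>k l. \<Sum>i\<in>C. \<Sum>j\<in>C. sg (par i * (par k + par l + 1)) *\<^sub>R (S i j * D j (S k l) * D i (D l (D k f)))"
  let ?T = "\<lambda>k. \<Sum>i\<in>C. \<Sum>j\<in>C. sg (par i * (par k + 1)) *\<^sub>R (S i j * D j (T k) * D i (D k f))"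
  let ?V = "\<lambda>i k. \<Sum>j\<in>C. S i j * D j (T k)"
  have "lap (lap f) = (\<Sum>k\<in>C. \<Sum>l\<in>C. lap (S k l * D l (D k f))) + (\<Sum>k\<in>C. lap (T k * D k f))"
    using f by (subst (2) lap_def) (simp add: lap_add lap_sum)
  also have "(\<Sum>k\<in>C. \<Sum>l\<in>C. lap (S k l * D l (D k f))) = (\<Sum>k\<in>C. \<Sum>l\<in>C. lap (S k l) * D l (D k f) +
      sg (par k + par l + 1) *\<^sub>R (S k l * lap (D l (D k f))) + 2 *\<^sub>R ?S k l)"
    using f by (intro sum.cong refl lap_mult S_hom) auto
  also have "(\<Sum>k\<in>C. lap (T k * D k f)) = (\<Sum>k\<in>C. lap (T k) * D k f +
      sg (par k + 1) *\<^sub>R (T k * lap (D k f)) + 2 *\<^sub>R ?T k)"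
    using f by (intro sum.cong refl lap_mult T_hom) auto
  finally have 1: "lap (lap f) = (\<Sum>k\<in>C. \<Sum>l\<in>C. lap (S k l) * D l (D k f)) + (\<Sum>k\<in>C. lap (T k) * D k f) +
     ((\<Sum>k\<in>C. \<Sum>l\<in>C. sg (par k + par l + 1) *\<^sub>R (S k l * lap (D l (D k f)))) +
      (\<Sum>k\<in>C. sg (par k + 1) *\<^sub>R (T k * lap (D k f)))) +
     2 *\<^sub>R (\<Sum>k\<in>C. \<Sum>l\<in>C. ?S k l) + 2 *\<^sub>R (\<Sum>k\<in>C. ?T k)"
    by (simp only: sum.distrib scaleR_sum_right[symmetric] ac_simps)
  \<comment> \<open>The undifferentiated coefficients leave exactly the three sums of the
    cancellation lemmas.\<close>
  have 2: "(\<Sum>k\<in>C. \<Sum>l\<in>C. sg (par k + par l + 1) *\<^sub>R (S k l * lap (D l (D k f)))) +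
      (\<Sum>k\<in>C. sg (par k + 1) *\<^sub>R (T k * lap (D k f))) = 0"
    using fourth_order_cancel[OF f] third_order_cancel[OF f] second_order_cancel[OF f]
    by (simp only: lap_def distrib_left scaleR_add_right sum.distrib sum_distrib_left scaleR_sum_right
        add_0_left add_0_right add.assoc)
  \<comment> \<open>The cross terms of \<open>S\<close> with its own first derivatives are
    contracted Jacobi terms, up to the order of the derivatives of \<open>f\<close>.\<close>
  have "(\<Sum>k\<in>C. \<Sum>l\<in>C. ?S k l) = (\<Sum>k\<in>C. \<Sum>l\<in>C. \<Sum>i\<in>C. sg (par i) *\<^sub>R (jacobi_term i k l * D l (D k (D i f))))"
  proof (intro sum.cong refl)
    fix k l i assume C: "k \<in> C" "l \<in> C" "i \<in> C"
    have "D l (D k (D i f)) = sg ((par k + par l) * par i) *\<^sub>R D i (D l (D k f))"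
      using C f by (rule_tac D3_swap)
    then have "sg (par i) *\<^sub>R (jacobi_term i k l * D l (D k (D i f))) =
        (sg (par i) * sg ((par k + par l) * par i)) *\<^sub>R (jacobi_term i k l * D i (D l (D k f)))"
      by simp
    also have "sg (par i) * sg ((par k + par l) * par i) = sg (par i * (par k + par l + 1))"
      by (simp add: algebra_simps power_add)
    finally show "(\<Sum>j\<in>C. sg (par i * (par k + par l + 1)) *\<^sub>R (S i j * D j (S k l) * D i (D l (D k f)))) =
        sg (par i) *\<^sub>R (jacobi_term i k l * D l (D k (D i f)))"
      by (simp add: jacobi_term_def sum_distrib_right scaleR_sum_right)
  qed
  also have "\<dots> = (\<Sum>k\<in>C. \<Sum>i\<in>C. \<Sum>l\<in>C. sg (par i) *\<^sub>R (jacobi_term i k l * D l (D k (D i f))))"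
    by (intro sum.cong refl sum.swap)
  also have "\<dots> = (\<Sum>i\<in>C. \<Sum>k\<in>C. \<Sum>l\<in>C. sg (par i) *\<^sub>R (jacobi_term i k l * D l (D k (D i f))))"
    by (rule sum.swap)
  also have "\<dots> = 0"
    by (rule jacobi_third_order[OF jac f])
  finally have 3: "(\<Sum>k\<in>C. \<Sum>l\<in>C. ?S k l) = 0" .
  have T: "(\<Sum>k\<in>C. ?T k) = (\<Sum>k\<in>C. \<Sum>i\<in>C. (sg (par i * (par k + 1)) *\<^sub>R ?V i k) * D i (D k f))"
    by (simp add: sum_distrib_right scaleR_sum_right)
  also have "\<dots> = (\<Sum>k\<in>C. \<Sum>i\<in>C. (sg (par i) *\<^sub>R ?V i k) * D k (D i f))"
  proof (intro sum.cong refl)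
    fix k i assume C: "k \<in> C" "i \<in> C"
    have "D k (D i f) = sg (par k * par i) *\<^sub>R D i (D k f)"
      using C f by (intro D_D) auto
    then have "(sg (par i) *\<^sub>R ?V i k) * D k (D i f) = (sg (par i) * sg (par k * par i)) *\<^sub>R (?V i k * D i (D k f))"
      by simp
    also have "sg (par i) * sg (par k * par i) = sg (par i * (par k + 1))"
      by (simp add: algebra_simps power_add)
    finally show "(sg (par i * (par k + 1)) *\<^sub>R ?V i k) * D i (D k f) = (sg (par i) *\<^sub>R ?V i k) * D k (D i f)"
      by simp
  qed
  also have "\<dots> = (\<Sum>k\<in>C. \<Sum>l\<in>C. (sg (par k) *\<^sub>R ?V k l) * D l (D k f))"
    by (rule sum.swap)
  \<comment> \<open>Of the two copies one is rewritten with the derivatives exchanged, the other is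
    kept: these are the two \<open>T\<close> terms of \<open>second_symbol\<close>.\<close>
  finally have 4: "2 *\<^sub>R (\<Sum>k\<in>C. ?T k) = (\<Sum>k\<in>C. \<Sum>l\<in>C. (sg (par k) *\<^sub>R ?V k l) * D l (D k f)) +
      (\<Sum>k\<in>C. \<Sum>l\<in>C. (sg (par l * (par k + 1)) *\<^sub>R ?V l k) * D l (D k f))"
    unfolding scaleR_2 using T by simp
  have "(\<Sum>k\<in>C. \<Sum>l\<in>C. second_symbol k l * D l (D k f)) = (\<Sum>k\<in>C. \<Sum>l\<in>C. lap (S k l) * D l (D k f)) +
     ((\<Sum>k\<in>C. \<Sum>l\<in>C. (sg (par k) *\<^sub>R ?V k l) * D l (D k f)) +
      (\<Sum>k\<in>C. \<Sum>l\<in>C. (sg (par l * (par k + 1)) *\<^sub>R ?V l k) * D l (D k f)))"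
    by (simp only: second_symbol_def distrib_right sum.distrib scaleR_sum_right add.assoc)
  then show ?thesis
    unfolding 1 2 3 4 by (simp add: algebra_simps)
qed

lemma second_symbol_sym:
  assumes C: "k \<in> C" "l \<in> C"
  shows "second_symbol l k = sg (par k * par l) *\<^sub>R second_symbol k l"
proof -
  have "lap (S l k) = sg (par k * par l) *\<^sub>R lap (S k l)"
    using S_sym[OF C(2,1)] lap_scaleR[OF S_A[OF C]] by (simp add: mult.commute)
  moreover have "sg (par k * par l) * sg (par k) = sg (par k * (par l + 1))"
    "sg (par k * par l) * sg (par l * (par k + 1)) = sg (par l)"
    unfolding power_add[symmetric] by (auto intro!: sg_cong)
  ultimately show ?thesis
    unfolding second_symbol_def scaleR_sum_right[symmetric] scaleR_add_right scaleR_scaleR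
    by (simp add: algebra_simps)
qed

lemma lap_X:
  assumes "a \<in> C"
  shows "lap (X a) = T a"
proof -
  have "(\<Sum>i\<in>C. T i * D i (X a)) = (\<Sum>i\<in>C. if i = a then T i else 0)"
    using assms by (intro sum.cong) (auto simp: D_X)
  moreover have "D j (D i (X a)) = 0" if "i \<in> C" "j \<in> C" for i j
    using that assms by (simp add: D_X)
  ultimately show ?thesis
    using assms by (simp add: lap_def)
qed

text \<open>
  A second-order operator without zeroth-order term is determined by its values on the
  coordinates and on their pairwise products.
\<close>

theorem lap_lap_eq_zero_iff:
  assumes jac: jacobi
    and test: "\<And>a. a \<in> C \<Longrightarrow> X a \<in> B" "\<And>a b. a \<in> C \<Longrightarrow> b \<in> C \<Longrightarrow> X a * X b \<in> B" and B: "B \<subseteq> A"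
  shows "(\<forall>f\<in>B. lap (lap f) = 0) \<longleftrightarrow>
    (\<forall>k\<in>C. lap (T k) = 0) \<and> (\<forall>k\<in>C. \<forall>l\<in>C. second_symbol k l = 0)"
proof
  assume *: "\<forall>f\<in>B. lap (lap f) = 0"
  have R: "lap (T k) = 0" if "k \<in> C" for k
    using * test(1) that lap_X by metis
  moreover have "second_symbol a b = 0" if C: "a \<in> C" "b \<in> C" for a b
  proof -
    have D: "D k (X a * X b) = (if k = a then X b else 0) + sg (par a * par b) *\<^sub>R (if k = b then X a else 0)"
      if "k \<in> C" for k
      using C that by (auto simp: D_mult[OF that _ _ hom_X] D_X mult.commute)
    have D2: "D l (D k (X a * X b)) = (if l = b then if k = a then u else 0 else 0) +
        (if l = a then if k = b then sg (par a * par b) *\<^sub>R u else 0 else 0)"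
      if "k \<in> C" "l \<in> C" for k l
      using C that by (auto simp: D D_add D_scaleR D_X)
    have "0 = lap (lap (X a * X b))"
      using * test(2)[OF C] by simp
    also have "\<dots> = (\<Sum>k\<in>C. \<Sum>l\<in>C. second_symbol k l * D l (D k (X a * X b)))"
      using lap_lap[OF jac, of "X a * X b"] R by simp
    also have "\<dots> = (\<Sum>k\<in>C. (\<Sum>l\<in>C. if l = b then if k = a then second_symbol k l else 0 else 0) +
        (\<Sum>l\<in>C. if l = a then if k = b then sg (par a * par b) *\<^sub>R second_symbol k l else 0 else 0))"
    proof (intro sum.cong refl)
      fix k assume k: "k \<in> C"
      have "second_symbol k l \<in> A" if "l \<in> C" for l
        using k that by (simp add: second_symbol_def)
      then have "second_symbol k l * D l (D k (X a * X b)) = (if l = b then if k = a then second_symbol k l else 0 else 0) +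
        (if l = a then if k = b then sg (par a * par b) *\<^sub>R second_symbol k l else 0 else 0)" if "l \<in> C" for l
        using that k by (auto simp: D2 distrib_left)
      then show "(\<Sum>l\<in>C. second_symbol k l * D l (D k (X a * X b))) =
         (\<Sum>l\<in>C. if l = b then if k = a then second_symbol k l else 0 else 0) +
         (\<Sum>l\<in>C. if l = a then if k = b then sg (par a * par b) *\<^sub>R second_symbol k l else 0 else 0)"
        by (simp add: sum.distrib)
    qed
    also have "\<dots> = (\<Sum>k\<in>C. (if k = a then second_symbol k b else 0) +
        (if k = b then sg (par a * par b) *\<^sub>R second_symbol k a else 0))"
      using C by (intro sum.cong refl) simp
    also have "\<dots> = second_symbol a b + sg (par a * par b) *\<^sub>R second_symbol b a"
      using C by (simp add: sum.distrib)
    \<comment> \<open>This also covers \<open>a = b\<close>. For odd \<open>a\<close> the square of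
      \<open>X a\<close> vanishes, and the symmetry itself says that
      \<open>second_symbol a a\<close> is its own negative.\<close>
    also have "\<dots> = 2 *\<^sub>R second_symbol a b"
      using second_symbol_sym[OF C] by (simp add: scaleR_2)
    finally show ?thesis by simp
  qed
  ultimately show "(\<forall>k\<in>C. lap (T k) = 0) \<and> (\<forall>k\<in>C. \<forall>l\<in>C. second_symbol k l = 0)"
    by blast
next
  assume "(\<forall>k\<in>C. lap (T k) = 0) \<and> (\<forall>k\<in>C. \<forall>l\<in>C. second_symbol k l = 0)"
  then show "\<forall>f\<in>B. lap (lap f) = 0"
    using lap_lap[OF jac] B by (auto simp: subset_iff)
qed

end

section \<open>The bracket in coordinates\<close>

lemma finite_coords [simp]: "finite (coords n m)"
  by (simp add: coords_def)

lemma par_mom [simp]: "par (mom n m i) = par i"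
  by (cases i) auto

lemma coords_double: "i \<in> coords n m \<Longrightarrow> i \<in> coords (2 * n) (2 * m)"
  by (auto simp: coords_def)

lemma mom_in_coords: "i \<in> coords n m \<Longrightarrow> mom n m i \<in> coords (2 * n) (2 * m)"
  by (cases i) (auto simp: coords_def)

lemma mom_eq_iff: "mom n m i = mom n m j \<longleftrightarrow> i = j"
  by (cases i; cases j) auto

section \<open>The cotangent superdomain\<close>

abbreviation base_point :: "nat \<Rightarrow> (nat \<Rightarrow> real) \<Rightarrow> nat \<Rightarrow> real" where
  "base_point n x \<equiv> (\<lambda>i. if i < n then x i else 0)"

text \<open>The underlying space of the cotangent superdomain: the even momenta, at positions
  \<open>n\<close> to \<open>2 * n - 1\<close>, are arbitrary, and the odd momenta add no
  points.\<close>

definition cotangent :: "nat \<Rightarrow> (nat \<Rightarrow> real) set \<Rightarrow> (nat \<Rightarrow> real) set" where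
  "cotangent n V = {x. (\<forall>i\<ge>2 * n. x i = 0) \<and> base_point n x \<in> V}"

lemma continuous_on_base_point: "continuous_on A (base_point n)"
proof (rule continuous_on_coordinatewise_then_product)
  fix i show "continuous_on A (\<lambda>x. base_point n x i)"
    by (cases "i < n") (auto intro: continuous_on_product_then_coordinatewise continuous_on_id)
qed

lemma openin_cotangent:
  assumes "openin (Euclidean_space n) V"
  shows "openin (Euclidean_space (2 * n)) (cotangent n V)"
proof -
  obtain U where U: "open U" "V = U \<inter> {x. \<forall>i\<ge>n. x i = 0}"
    by (rule openin_Euclidean_spaceD[OF assms])
  have "open (base_point n -` U)"
    using U(1) continuous_on_base_point by (rule open_vimage)
  then have "openin (Euclidean_space (2 * n)) ((base_point n -` U) \<inter> {x. \<forall>i\<ge>2 * n. x i = 0})"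
    by (rule openin_Euclidean_spaceI)
  also have "(base_point n -` U) \<inter> {x. \<forall>i\<ge>2 * n. x i = 0} = cotangent n V"
    by (auto simp: cotangent_def U(2))
  finally show ?thesis .
qed

lemma base_point_upd:
  "i < n \<Longrightarrow> base_point n (x(i := t)) = (base_point n x)(i := t)"
  "n \<le> i \<Longrightarrow> base_point n (x(i := t)) = base_point n x"
  by auto

lemma C_diff_base_point:
  assumes V: "openin (Euclidean_space n) V" and "C_diff n V k h"
  shows "C_diff (2 * n) (cotangent n V) k (\<lambda>x. h (base_point n x))"
  using assms(2)
proof (induction k arbitrary: h)
  have *: "continuous_on (cotangent n V) (\<lambda>x. h (base_point n x))" if "continuous_on V h"
    for h :: "(nat \<Rightarrow> real) \<Rightarrow> real"
    by (rule continuous_on_compose2[OF that continuous_on_base_point]) (auto simp: cotangent_def)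
  {
    case 0
    then show ?case using * by simp
  next
    case (Suc k)
    show ?case
    proof (rule C_diff_SucI[OF openin_cotangent[OF V]])
      show "continuous_on (cotangent n V) (\<lambda>x. h (base_point n x))"
        using * Suc.prems by simp
      show "((\<lambda>t. h (base_point n (x(i := t)))) has_real_derivative
          (if i < n then pderiv1 i h (base_point n x) else 0)) (at (x i))"
        if "x \<in> cotangent n V" for x i
      proof (cases "i < n")
        case True
        then show ?thesis
          using C_diff_pderiv1[OF Suc.prems, of "base_point n x" i] that
          by (simp add: base_point_upd(1) cotangent_def del: fun_upd_apply)
      next
        case False
        then show ?thesis
          by (simp add: base_point_upd(2) del: fun_upd_apply)
      qed
      show "C_diff (2 * n) (cotangent n V) k (\<lambda>x. if i < n then pderiv1 i h (base_point n x) else 0)" for i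
        using Suc.IH[of "pderiv1 i h"] Suc.prems C_diff_const[OF openin_cotangent[OF V], of k 0]
        by (cases "i < n") auto
    qed
  }
qed

lemma sf_smooth_horiz:
  assumes V: "openin (Euclidean_space n) V" and f: "sf_smooth n m V f"
  shows "sf_smooth (2 * n) (2 * m) (cotangent n V) (horiz n m f)"
  unfolding sf_smooth_def
proof (intro allI impI)
  fix I
  show "C_infinity (2 * n) (cotangent n V) (horiz n m f I)"
  proof (cases "I \<subseteq> {..<m}")
    case True
    then show ?thesis
      using f C_diff_base_point[OF V, of _ "f I"]
      by (simp add: horiz_def sf_smooth_def C_infinity_iff_C_diff)
  next
    case False
    then show ?thesis
      using C_infinity_const[OF openin_cotangent[OF V], of 0] by (simp add: horiz_def)
  qed
qed

lemma horiz_mult: "horiz n m (f \<star> g) = horiz n m f \<star> horiz n m g"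
proof (intro ext)
  fix K x
  show "horiz n m (f \<star> g) K x = (horiz n m f \<star> horiz n m g) K x"
  proof (cases "K \<subseteq> {..<m}")
    case True
    then have "I \<subseteq> {..<m}" "K - I \<subseteq> {..<m}" if "I \<in> Pow K" for I
      using that by blast+
    then have "(f \<star> g) K (base_point n x) = (horiz n m f \<star> horiz n m g) K x"
      unfolding sf_mult_eq by (intro sum.cong) (auto simp: horiz_def)
    then show ?thesis
      using True by (simp add: horiz_def)
  next
    case False
    have "horiz n m f I x * horiz n m g (K - I) x = 0" if "I \<subseteq> K" for I
      using False that by (auto simp: horiz_def)
    then have "(horiz n m f \<star> horiz n m g) K x = 0"
      unfolding sf_mult_eq by (intro sum.neutral ballI) (simp only: mult.assoc, auto)
    then show ?thesis using False by (simp add: horiz_def)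
  qed
qed

lemma horiz_scl: "horiz n m (scl c f) = scl c (horiz n m f)"
  by (auto simp: horiz_def scl_def fun_eq_iff)

lemma horiz_sum: "horiz n m (\<Sum>i\<in>I. f i) = (\<Sum>i\<in>I. horiz n m (f i))"
proof -
  have "horiz n m 0 = 0" "horiz n m (f + g) = horiz n m f + horiz n m g" for f g
    by (auto simp: horiz_def fun_eq_iff)
  then show ?thesis
    by (induction I rule: infinite_finite_induct)
       (simp_all only: sum.insert sum.infinite sum.empty not_False_eq_True if_False)
qed

lemma pd_horiz:
  assumes "i \<in> coords n m"
  shows "pd i (horiz n m f) = horiz n m (pd i f)"
proof (cases i)
  case (Inl k)
  then have "k < n" using assms by (auto simp: coords_def)
  then show ?thesis
    by (auto simp: Inl horiz_def fun_eq_iff pderiv1_def base_point_upd(1) simp del: fun_upd_apply)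
next
  case (Inr k)
  then show ?thesis
    using assms by (auto simp: horiz_def fun_eq_iff coords_def)
qed

lemma pd_mom_horiz: "pd (mom n m i) (horiz n m f) = 0"
proof (cases i)
  case (Inl k)
  have "base_point n (x(n + k := t)) = base_point n x" for x :: "nat \<Rightarrow> real" and t
    by (rule base_point_upd(2)) simp
  then have "pderiv1 (n + k) (horiz n m f I) x = 0" for I x
    unfolding horiz_def pderiv1_def by (cases "I \<subseteq> {..<m}") simp_all
  then show ?thesis
    by (simp add: Inl fun_eq_iff)
next
  case (Inr k)
  then show ?thesis
    by (auto simp: horiz_def fun_eq_iff)
qed

lemma sf_parity_horiz:
  "sf_parity m V p f \<Longrightarrow> sf_parity (2 * m) (cotangent n V) p (horiz n m f)"
  by (auto simp: sf_parity_def horiz_def cotangent_def)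

text \<open>A point of \<open>V\<close> has zeros from index \<open>n\<close> on, so it is itself a
  point of the zero section. This brings identities on the cotangent superdomain back to the
  base.\<close>

lemma loc_horiz_eqI:
  assumes V: "openin (Euclidean_space n) V"
    and eq: "loc (2 * m) (cotangent n V) F = loc (2 * m) (cotangent n V) (horiz n m g)"
  shows "loc m V (horiz n m F) = loc m V g"
  unfolding loc_eq_iff sf_eq_def
proof (intro allI impI ballI)
  fix I x assume I: "I \<subseteq> {..<m}" and x: "x \<in> V"
  have x0: "base_point n x = x"
    using openin_Euclidean_space_zero[OF V x] by (auto simp: fun_eq_iff)
  have "x i = 0" if "2 * n \<le> i" for i
    using openin_Euclidean_space_zero[OF V x] that by simp
  then have "x \<in> cotangent n V"
    using x by (simp add: cotangent_def x0)
  moreover have "I \<subseteq> {..<2 * m}" using I by auto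
  ultimately have "F I x = horiz n m g I x"
    using eq unfolding loc_eq_iff sf_eq_def by blast
  then show "horiz n m F I x = g I x"
    using I by (simp add: horiz_def x0)
qed

section \<open>Canonical and odd brackets in local coordinates\<close>

lemma loc_part:
  "sf_parity m V p f \<Longrightarrow> loc m V (part q f) = (if even p = even q then loc m V f else 0)"
  unfolding loc_zero[of m V, symmetric] if_distrib[of "loc m V", symmetric] loc_eq_iff
  by (auto simp: sf_eq_def sf_parity_def part_def even_iff_mod_2_eq_zero)

lemma sf_parity_part: "sf_parity m V q (part q f)"
  by (simp add: sf_parity_def part_def)

text \<open>For homogeneous \<open>F\<close> only one of the two parity components in
  \<open>canonical_bracket\<close> survives.\<close>

lemma loc_canonical_bracket:
  assumes W: "openin (Euclidean_space (2 * n)) W" and p: "sf_parity (2 * m) W p F"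
  defines "L \<equiv> loc (2 * m) W" and "D \<equiv> dloc (2 * m) W"
  shows "L (canonical_bracket n m F G) = (\<Sum>i\<in>coords n m.
    sg (par i * (p + 1)) *\<^sub>R (D (mom n m i) (L F) * D i (L G)) -
    sg (par i * p) *\<^sub>R (D i (L F) * D (mom n m i) (L G)))"
proof -
  have D0: "D i 0 = 0" if "i \<in> coords (2 * n) (2 * m)" for i
    unfolding D_def using super_diff_algebra.D_zero[OF super_diff_algebra_smooth_algebra[OF W] that] .
  have "L (\<Sum>i\<in>coords n m.
      scl (sg (par i * (q + 1))) (pd (mom n m i) (part q F) \<star> pd i G) -
      scl (sg (par i * q)) (pd i (part q F) \<star> pd (mom n m i) G)) =
    (if even p = even q then (\<Sum>i\<in>coords n m.
    sg (par i * (p + 1)) *\<^sub>R (D (mom n m i) (L F) * D i (L G)) -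
    sg (par i * p) *\<^sub>R (D i (L F) * D (mom n m i) (L G))) else 0)" for q
  proof -
    have "L (scl (sg (par i * (q + 1))) (pd (mom n m i) (part q F) \<star> pd i G) -
        scl (sg (par i * q)) (pd i (part q F) \<star> pd (mom n m i) G)) =
        sg (par i * (q + 1)) *\<^sub>R (D (mom n m i) (if even p = even q then L F else 0) * D i (L G)) -
        sg (par i * q) *\<^sub>R (D i (if even p = even q then L F else 0) * D (mom n m i) (L G))"
      if i: "i \<in> coords n m" for i
      unfolding L_def D_def loc_diff loc_scl loc_mult loc_pd[OF W coords_double[OF i]]
        loc_pd[OF W mom_in_coords[OF i]] loc_part[OF p] ..
    moreover have "sg (par i * (q + 1)) = sg (par i * (p + 1))" "sg (par i * q) = sg (par i * p)"
      if "even p = even q" for i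
      using that by (auto intro!: sg_cong)
    ultimately show ?thesis
      unfolding L_def loc_sum by (auto simp: D0 coords_double mom_in_coords)
  qed
  then show ?thesis
    unfolding canonical_bracket_def unfolding L_def loc_sum[of _ _ _ "{..<2}"]
    by (simp add: numeral_2_eq_2 lessThan_Suc)
qed

text \<open>The conditions of \<open>master_hamiltonian\<close> inside one chart, separated because
  they pass to open subsets.\<close>

definition local_hamiltonian :: "nat \<Rightarrow> nat \<Rightarrow> (nat \<Rightarrow> real) set \<Rightarrow> (idx \<Rightarrow> idx \<Rightarrow> sfun) \<Rightarrow> bool" where
  "local_hamiltonian n m V S \<longleftrightarrow> (\<forall>i\<in>coords n m. \<forall>j\<in>coords n m.
     sf_smooth n m V (S i j) \<and> sf_parity m V (par i + par j + 1) (S i j) \<and>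
     sf_eq m V (S i j) (scl (sg (par i * par j)) (S j i)))"

lemma odd_symmetric_tensor_loc:
  assumes V: "openin (Euclidean_space n) V" and S: "local_hamiltonian n m V S"
  shows "odd_symmetric_tensor (coords n m) (smooth_algebra n m V) homogeneous (dloc m V)
    (\<lambda>i. loc m V (coord_fun i)) (loc m V (sf_const 1)) (\<lambda>i j. loc m V (S i j))"
proof -
  interpret super_diff_algebra "coords n m" "smooth_algebra n m V" homogeneous "dloc m V"
    "\<lambda>i. loc m V (coord_fun i)" "loc m V (sf_const 1)"
    using V by (rule super_diff_algebra_smooth_algebra)
  show ?thesis
    by unfold_locales
       (use S in \<open>auto simp: local_hamiltonian_def smooth_algebra_def homogeneous_loc_iff
          loc_eq_iff simp flip: loc_scl\<close>)
qed

text \<open>Computed in the algebra with \<open>2n|2m\<close> coordinates. The Hamiltonian is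
  quadratic in the momenta, its bracket with \<open>a\<close> is linear in them, and the second
  bracket removes the last momentum; \<open>a\<close> and \<open>b\<close> are pulled back from the
  base and have no momentum derivatives.\<close>

lemma loc_iterated_bracket:
  assumes V: "openin (Euclidean_space n) V" and S: "local_hamiltonian n m V S"
    and a: "sf_smooth n m V a" "sf_parity m V p a" and b: "sf_smooth n m V b"
  shows "loc m V (horiz n m (canonical_bracket n m
      (canonical_bracket n m (hamiltonian n m S) (horiz n m a)) (horiz n m b))) =
    2 *\<^sub>R (\<Sum>i\<in>coords n m. \<Sum>j\<in>coords n m. sg (par i * p) *\<^sub>R
      (loc m V (S i j) * dloc m V j (loc m V a) * dloc m V i (loc m V b)))"
proof -
  let ?C = "coords n m"
  define W where "W = cotangent n V"
  define L where "L = loc (2 * m) W"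
  define D where "D = dloc (2 * m) W"
  define mo where "mo = mom n m"
  define P where "P = (\<lambda>i. L (coord_fun (mo i)))"
  define h where "h = (\<lambda>f. L (horiz n m f))"
  define u where "u = L (sf_const 1)"
  have W: "openin (Euclidean_space (2 * n)) W"
    unfolding W_def by (rule openin_cotangent[OF V])
  interpret super_diff_algebra "coords (2 * n) (2 * m)" "smooth_algebra (2 * n) (2 * m) W" homogeneous D
    "\<lambda>i. L (coord_fun i)" u
    unfolding L_def D_def u_def by (rule super_diff_algebra_smooth_algebra[OF W])
  have mo [simp]: "mo i \<in> coords (2 * n) (2 * m)" "i \<in> coords (2 * n) (2 * m)" if "i \<in> ?C" for i
    using that unfolding mo_def by (simp_all add: mom_in_coords coords_double)
  have par_mo [simp]: "par (mo i) = par i" for i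
    by (simp add: mo_def)
  have P_A [simp]: "P i \<in> smooth_algebra (2 * n) (2 * m) W" for i
    unfolding P_def by (rule A_X)
  have P_hom: "homogeneous (par i) (P i)" for i
    using hom_X[of "mo i"] by (simp add: P_def)
  have h_A [simp]: "h f \<in> smooth_algebra (2 * n) (2 * m) W" if "sf_smooth n m V f" for f
    using sf_smooth_horiz[OF V that] by (simp add: h_def L_def W_def smooth_algebra_def)
  have h_hom: "homogeneous q (h f)" if "sf_parity m V q f" for f q
    unfolding h_def L_def W_def homogeneous_loc_iff using that by (rule sf_parity_horiz)
  have D_h: "D i (h f) = h (pd i f)" "D (mo i) (h f) = 0" if "i \<in> ?C" for i f
    using loc_pd[OF W mo(2)[OF that], of "horiz n m f"] loc_pd[OF W mo(1)[OF that], of "horiz n m f"] that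
    by (simp_all add: D_def h_def L_def mo_def pd_horiz pd_mom_horiz)
  have D_P: "D (mo i) (P j) = (if i = j then u else 0)" if "i \<in> ?C" "j \<in> ?C" for i j
    using D_X[OF mo(1)[OF that(1)] mo(1)[OF that(2)]] by (simp add: P_def mo_def mom_eq_iff)
  have h_mult: "h (f \<star> g) = h f * h g" for f g
    by (simp add: h_def L_def horiz_mult loc_mult)
  have smooth_S [simp]: "sf_smooth n m V (S i j)"
    and hom_S: "homogeneous (par i + par j + 1) (h (S i j))"
    and sym_S: "h (S i j) = sg (par i * par j) *\<^sub>R h (S j i)"
    if "i \<in> ?C" "j \<in> ?C" for i j
  proof -
    show "sf_smooth n m V (S i j)" "homogeneous (par i + par j + 1) (h (S i j))"
      using S that by (auto simp: local_hamiltonian_def intro: h_hom)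
    have "sf_eq m V (S i j) (scl (sg (par i * par j)) (S j i))"
      using S that by (auto simp: local_hamiltonian_def)
    then have "sf_eq (2 * m) W (horiz n m (S i j)) (horiz n m (scl (sg (par i * par j)) (S j i)))"
      by (auto simp: sf_eq_def horiz_def W_def cotangent_def)
    then show "h (S i j) = sg (par i * par j) *\<^sub>R h (S j i)"
      by (simp add: h_def L_def horiz_scl loc_scl[symmetric] loc_eq_iff)
  qed
  have smooth_a [simp]: "sf_smooth n m V (pd i a)" "sf_smooth n m V (pd i b)" if "i \<in> ?C" for i
    using sf_smooth_pd[OF V a(1) that] sf_smooth_pd[OF V b that] .
  have hom_a: "homogeneous (p + par k) (h (pd k a))" if "k \<in> ?C" for k
    using hom_D[OF h_hom[OF a(2)], of k] by (simp add: D_h that)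

  let ?H = "hamiltonian n m S"
  have H: "L ?H = (\<Sum>i\<in>?C. \<Sum>j\<in>?C. h (S i j) * P j * P i)"
    by (simp add: hamiltonian_def L_def loc_sum loc_mult h_def P_def mo_def)
  \<comment> \<open>A momentum has the parity of its coordinate, so the index parities of
    \<open>S\<close> are compensated and only its oddness remains.\<close>
  have "homogeneous 1 (L ?H)"
    unfolding H
  proof (intro hom_sum)
    fix i j assume "i \<in> ?C" "j \<in> ?C"
    then have "homogeneous (par i + par j + 1 + par j + par i) (h (S i j) * P j * P i)"
      by (intro hom_mult hom_S P_hom)
    then show "homogeneous 1 (h (S i j) * P j * P i)"
      by (rule hom_cong) auto
  qed
  then have par_H: "sf_parity (2 * m) W 1 ?H"
    by (simp add: L_def homogeneous_loc_iff)
  have D_H: "D (mo k) (L ?H) = 2 *\<^sub>R (\<Sum>i\<in>?C. h (S k i) * P i)" if k: "k \<in> ?C" for k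
  proof -
    have "D (mo k) (h (S i j) * P j * P i) =
        (if j = k then h (S k i) * P i else 0) + (if i = k then h (S k j) * P j else 0)"
      if i: "i \<in> ?C" and j: "j \<in> ?C" for i j
    proof -
      have "D (mo k) (P j * P i) = (if k = j then P i else 0) + sg (par k * par j) *\<^sub>R (if k = i then P j else 0)"
        using D_mult[OF mo(1)[OF k] P_A P_A P_hom, of j i] k i j by (simp add: D_P)
      then have "D (mo k) (h (S i j) * (P j * P i)) = sg (par k * (par i + par j + 1)) *\<^sub>R
          (h (S i j) * ((if k = j then P i else 0) + sg (par k * par j) *\<^sub>R (if k = i then P j else 0)))"
        using D_mult[OF mo(1)[OF k] _ _ hom_S[OF i j], of "P j * P i"] k i j by (simp add: D_h)
      also have "\<dots> = (if j = k then sg (par j * (par i + par j + 1)) *\<^sub>R (h (S i j) * P i) else 0) +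
          (if i = k then sg (par i * (par i + par j + 1) + par i * par j) *\<^sub>R (h (S i j) * P j) else 0)"
        by (simp add: distrib_left scaleR_add_right power_add)
      \<comment> \<open>Since \<open>j (j + 1)\<close> is even, the sign from passing the derivative
        over \<open>S i j\<close> is exactly the sign of the symmetry of \<open>S\<close>.\<close>
      also have "sg (par j * (par i + par j + 1)) *\<^sub>R (h (S i j) * P i) = h (S j i) * P i"
      proof -
        have "sg (par j * (par i + par j + 1)) = sg (par j * par i)" by (rule sg_cong) auto
        then show ?thesis unfolding sym_S[OF j i] by (simp only: mult_scaleR_left)
      qed
      also have "sg (par i * (par i + par j + 1) + par i * par j) = 1"
        by (auto simp: minus_one_power_iff)
      finally show ?thesis
        by (auto simp: mult.assoc)
    qed
    then have "D (mo k) (L ?H) = (\<Sum>i\<in>?C. \<Sum>j\<in>?C.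
        (if j = k then h (S k i) * P i else 0) + (if i = k then h (S k j) * P j else 0))"
      unfolding H using k by (simp add: D_sum)
    also have "\<dots> = (\<Sum>i\<in>?C. h (S k i) * P i) + (\<Sum>j\<in>?C. \<Sum>i\<in>?C. if i = k then h (S k j) * P j else 0)"
      using k by (simp add: sum.distrib sum.swap[of _ ?C ?C])
    also have "\<dots> = 2 *\<^sub>R (\<Sum>i\<in>?C. h (S k i) * P i)"
      using k by (simp add: scaleR_2)
    finally show ?thesis .
  qed

  let ?F = "canonical_bracket n m ?H (horiz n m a)"
  \<comment> \<open>The half of the canonical bracket that differentiates \<open>a\<close> along the
    momenta drops out.\<close>
  have F: "L ?F = 2 *\<^sub>R (\<Sum>k\<in>?C. \<Sum>i\<in>?C. h (S k i) * P i * h (pd k a))"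
  proof -
    have "L ?F = (\<Sum>k\<in>?C. sg (par k * (1 + 1)) *\<^sub>R (D (mo k) (L ?H) * D k (h a)) -
        sg (par k * 1) *\<^sub>R (D k (L ?H) * D (mo k) (h a)))"
      using loc_canonical_bracket[OF W par_H, of "horiz n m a"] by (simp only: L_def D_def mo_def h_def)
    also have "\<dots> = (\<Sum>k\<in>?C. 2 *\<^sub>R (\<Sum>i\<in>?C. h (S k i) * P i * h (pd k a)))"
      by (intro sum.cong refl) (simp add: D_h D_H sum_distrib_right)
    finally show ?thesis by (simp add: scaleR_sum_right)
  qed
  have "homogeneous (p + 1) (L ?F)"
    unfolding F
  proof (intro hom_scaleR hom_sum)
    fix k i assume "k \<in> ?C" "i \<in> ?C"
    then have "homogeneous (par k + par i + 1 + par i + (p + par k)) (h (S k i) * P i * h (pd k a))"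
      by (intro hom_mult hom_S P_hom hom_a)
    then show "homogeneous (p + 1) (h (S k i) * P i * h (pd k a))"
      by (rule hom_cong) auto
  qed
  then have par_F: "sf_parity (2 * m) W (p + 1) ?F"
    by (simp add: L_def homogeneous_loc_iff)
  have D_F: "D (mo l) (L ?F) = 2 *\<^sub>R (\<Sum>k\<in>?C. h (S l k) * h (pd k a))" if l: "l \<in> ?C" for l
  proof -
    have "D (mo l) (h (S k i) * P i * h (pd k a)) = (if i = l then h (S l k) * h (pd k a) else 0)"
      if k: "k \<in> ?C" and i: "i \<in> ?C" for k i
    proof -
      have "D (mo l) (P i * h (pd k a)) = (if l = i then h (pd k a) else 0)"
        using D_mult[OF mo(1)[OF l] P_A _ P_hom, of "h (pd k a)" i] l k i by (simp add: D_P D_h)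
      then have "D (mo l) (h (S k i) * (P i * h (pd k a))) =
          (if i = l then sg (par i * (par k + par i + 1)) *\<^sub>R (h (S k i) * h (pd k a)) else 0)"
        using D_mult[OF mo(1)[OF l] _ _ hom_S[OF k i], of "P i * h (pd k a)"] l k i by (simp add: D_h)
      also have "sg (par i * (par k + par i + 1)) *\<^sub>R (h (S k i) * h (pd k a)) = h (S i k) * h (pd k a)"
      proof -
        have "sg (par i * (par k + par i + 1)) = sg (par i * par k)" by (rule sg_cong) auto
        then show ?thesis unfolding sym_S[OF i k] by (simp only: mult_scaleR_left)
      qed
      finally show ?thesis
        by (auto simp: mult.assoc)
    qed
    then show ?thesis
      unfolding F using l by (simp add: D_sum D_scaleR)
  qed

  have "L (canonical_bracket n m ?F (horiz n m b)) = (\<Sum>l\<in>?C.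
      sg (par l * (p + 1 + 1)) *\<^sub>R (D (mo l) (L ?F) * D l (h b)) -
      sg (par l * (p + 1)) *\<^sub>R (D l (L ?F) * D (mo l) (h b)))"
    using loc_canonical_bracket[OF W par_F, of "horiz n m b"] by (simp only: L_def D_def mo_def h_def)
  also have "\<dots> = (\<Sum>l\<in>?C. sg (par l * p) *\<^sub>R ((2 *\<^sub>R (\<Sum>k\<in>?C. h (S l k) * h (pd k a))) * h (pd l b)))"
  proof (intro sum.cong refl)
    fix l assume l: "l \<in> ?C"
    have "sg (par l * (p + 1 + 1)) = sg (par l * p)" by (rule sg_cong) auto
    then show "sg (par l * (p + 1 + 1)) *\<^sub>R (D (mo l) (L ?F) * D l (h b)) -
      sg (par l * (p + 1)) *\<^sub>R (D l (L ?F) * D (mo l) (h b)) =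
      sg (par l * p) *\<^sub>R ((2 *\<^sub>R (\<Sum>k\<in>?C. h (S l k) * h (pd k a))) * h (pd l b))"
      by (simp only: D_h[OF l] D_F[OF l]) simp
  qed
  also have "\<dots> = h (scl 2 (\<Sum>l\<in>?C. \<Sum>k\<in>?C. scl (sg (par l * p)) (S l k \<star> pd k a \<star> pd l b)))"
    by (simp add: h_def L_def horiz_scl horiz_sum horiz_mult loc_scl loc_sum loc_mult
        scaleR_sum_right sum_distrib_right mult.commute)
  finally have "loc m V (horiz n m (canonical_bracket n m ?F (horiz n m b))) =
      loc m V (scl 2 (\<Sum>l\<in>?C. \<Sum>k\<in>?C. scl (sg (par l * p)) (S l k \<star> pd k a \<star> pd l b)))"
    unfolding h_def L_def W_def by (rule loc_horiz_eqI[OF V])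
  then show ?thesis
    by (simp add: loc_scl loc_sum loc_mult loc_pd[OF V])
qed

text \<open>The sum over \<open>q < 2\<close> reduces to the one \<open>q\<close> congruent to
  \<open>p\<close>; the signs depend on \<open>p\<close> modulo 2 only.\<close>

theorem loc_odd_bracket:
  assumes V: "openin (Euclidean_space n) V" and S: "local_hamiltonian n m V (S \<alpha>)"
    and f: "sf_smooth n m V (f \<alpha>)" "sf_parity m V p (f \<alpha>)" and g: "sf_smooth n m V (g \<alpha>)"
  shows "loc m V (odd_bracket n m S f g \<alpha>) =
    odd_symmetric_tensor.bracket (coords n m) (dloc m V) (\<lambda>i j. loc m V (S \<alpha> i j)) p
      (loc m V (f \<alpha>)) (loc m V (g \<alpha>))"
proof -
  let ?C = "coords n m"
  let ?b = "\<lambda>q x. 2 *\<^sub>R (\<Sum>i\<in>?C. \<Sum>j\<in>?C. sg (par i * q) *\<^sub>R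
      (loc m V (S \<alpha> i j) * dloc m V j x * dloc m V i (loc m V (g \<alpha>))))"
  interpret odd_symmetric_tensor ?C "smooth_algebra n m V" homogeneous "dloc m V"
    "\<lambda>i. loc m V (coord_fun i)" "loc m V (sf_const 1)" "\<lambda>i j. loc m V (S \<alpha> i j)"
    using V S by (rule odd_symmetric_tensor_loc)
  have "sf_smooth n m V (part q (f \<alpha>))" for q
  proof -
    have "part q (f \<alpha>) I = (if card I mod 2 = q mod 2 then f \<alpha> I else (\<lambda>x. 0))" for I
      by (simp add: part_def)
    then show ?thesis
      using f(1) C_infinity_const[OF V] by (simp add: sf_smooth_def)
  qed
  from loc_iterated_bracket[OF V S this sf_parity_part g]
  have "loc m V (odd_bracket n m S f g \<alpha>) =
      (\<Sum>q<2. sg q *\<^sub>R ?b q (if even p = even q then loc m V (f \<alpha>) else 0))"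
    unfolding odd_bracket_def loc_sum loc_scl loc_part[OF f(2)] by simp
  also have "\<dots> = (\<Sum>q<(2::nat). if even p = even q then sg p *\<^sub>R ?b p (loc m V (f \<alpha>)) else 0)"
  proof (intro sum.cong refl)
    fix q
    have "sg q = sg p" "sg (par i * q) = sg (par i * p)" if "even p = even q" for i
      using that by (auto intro!: sg_cong)
    then show "sg q *\<^sub>R ?b q (if even p = even q then loc m V (f \<alpha>) else 0) =
        (if even p = even q then sg p *\<^sub>R ?b p (loc m V (f \<alpha>)) else 0)"
      by simp
  qed
  also have "\<dots> = bracket p (loc m V (f \<alpha>)) (loc m V (g \<alpha>))"
    by (simp add: numeral_2_eq_2 lessThan_Suc bracket_def mult.commute)
  finally show ?thesis .
qed

section \<open>Extension of local superfunctions\<close>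

text \<open>The functions \<open>p(1/t) exp(-1/t)\<close>, continued by 0. The polynomial parameter
  makes the family closed under differentiation, so smoothness follows by induction.\<close>

definition flat :: "real poly \<Rightarrow> real \<Rightarrow> real" where
  "flat p t = (if 0 < t then poly p (1 / t) * exp (- (1 / t)) else 0)"

lemma tendsto_poly_exp_0: "((\<lambda>y::real. poly p y * exp (- y)) \<longlongrightarrow> 0) at_top"
proof -
  have "((\<lambda>y. \<Sum>i\<le>degree p. coeff p i * (y ^ i / exp y)) \<longlongrightarrow> (\<Sum>i\<le>degree p. coeff p i * 0)) at_top"
    by (intro tendsto_intros tendsto_power_div_exp_0)
  moreover have "poly p y * exp (- y) = (\<Sum>i\<le>degree p. coeff p i * (y ^ i / exp y))" for y :: real
    by (simp add: poly_altdef exp_minus field_simps sum_distrib_left sum_divide_distrib)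
  ultimately show ?thesis by simp
qed

text \<open>For \<open>t > 0\<close> this is the product rule, with \<open>1/t^2\<close> written as
  \<open>monom 1 2\<close> evaluated at \<open>1/t\<close>. At 0 the difference quotient is again a
  polynomial in \<open>1/t\<close> times \<open>exp (- 1/t)\<close> and tends to 0.\<close>

lemma flat_has_derivative:
  "(flat p has_real_derivative flat (monom 1 2 * (p - pderiv p)) t) (at t)"
proof -
  consider "0 < t" | "t < 0" | "t = 0" by linarith
  then show ?thesis
  proof cases
    case 1
    have "((\<lambda>s. poly p (1 / s) * exp (- (1 / s))) has_real_derivative
        flat (monom 1 2 * (p - pderiv p)) t) (at t)"
      using 1 by (auto intro!: derivative_eq_intros simp: flat_def poly_monom field_simps power2_eq_square)
    moreover have "\<forall>\<^sub>F s in nhds t. flat p s = poly p (1 / s) * exp (- (1 / s))"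
      using eventually_nhds_in_open[of "{0<..}" t] 1 by (auto simp: flat_def elim: eventually_mono)
    ultimately show ?thesis
      by (subst DERIV_cong_ev[OF refl _ refl])
  next
    case 2
    have "\<forall>\<^sub>F s in nhds t. flat p s = 0"
      using eventually_nhds_in_open[of "{..<0}" t] 2 by (auto simp: flat_def elim: eventually_mono)
    then have "(flat p has_real_derivative 0) (at t)"
      by (subst DERIV_cong_ev[OF refl _ refl]) auto
    then show ?thesis using 2 by (simp add: flat_def)
  next
    case 3
    have "((\<lambda>h. flat p h / h) \<longlongrightarrow> 0) (at 0)"
    proof (rule filterlim_split_at)
      have "\<forall>\<^sub>F h in at_left (0::real). flat p h / h = 0"
        by (auto simp: flat_def eventually_at_left_field intro: exI[of _ "-1"])
      then show "((\<lambda>h. flat p h / h) \<longlongrightarrow> 0) (at_left 0)"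
        by (rule tendsto_eventually)
      have "((\<lambda>h. poly (monom 1 1 * p) (inverse h) * exp (- inverse h)) \<longlongrightarrow> 0) (at_right (0::real))"
        by (rule filterlim_compose[OF tendsto_poly_exp_0 filterlim_inverse_at_top_right])
      moreover have "\<forall>\<^sub>F h in at_right (0::real).
          poly (monom 1 1 * p) (inverse h) * exp (- inverse h) = flat p h / h"
        by (auto simp: flat_def eventually_at_right_field poly_monom field_simps intro!: exI[of _ 1])
      ultimately show "((\<lambda>h. flat p h / h) \<longlongrightarrow> 0) (at_right 0)"
        by (rule Lim_transform_eventually)
    qed
    then show ?thesis
      using 3 by (simp add: DERIV_def flat_def)
  qed
qed

lemma continuous_on_flat: "continuous_on A (flat p)"
  by (rule continuous_on_subset[of UNIV])
     (auto simp: continuous_on_eq_continuous_at intro: DERIV_isCont flat_has_derivative)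

lemma C_diff_flat:
  assumes V: "openin (Euclidean_space n) V" and "C_diff n V k h"
  shows "C_diff n V k (\<lambda>x. flat p (h x))"
  using assms(2)
proof (induction k arbitrary: p)
  case 0
  then show ?case
    by (auto intro: continuous_on_compose2[OF continuous_on_flat[of UNIV]])
next
  case (Suc k)
  let ?q = "monom 1 2 * (p - pderiv p)"
  show ?case
  proof (rule C_diff_SucI[OF V])
    show "continuous_on V (\<lambda>x. flat p (h x))"
      using C_diff_imp_continuous_on[OF Suc.prems]
      by (auto intro: continuous_on_compose2[OF continuous_on_flat[of UNIV]])
    show "((\<lambda>t. flat p (h (x(i := t)))) has_real_derivative flat ?q (h x) * pderiv1 i h x) (at (x i))"
      if "x \<in> V" "i < n" for x i
      using DERIV_chain2[OF flat_has_derivative C_diff_pderiv1[OF Suc.prems that]] by (simp only: fun_upd_triv)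
    show "C_diff n V k (\<lambda>x. flat ?q (h x) * pderiv1 i h x)" if "i < n" for i
      using Suc.IH[OF C_diff_SucD[OF Suc.prems], of ?q] Suc.prems that
      by (intro C_diff_mult V) auto
  qed
qed

lemma flat_one_mono: "s \<le> t \<Longrightarrow> flat 1 s \<le> flat 1 t"
  by (auto simp: flat_def frac_le)

text \<open>A basic open set of the product topology is a box. Its sides at indices from
  \<open>n\<close> on contain 0, the value of \<open>x\<close> there, so only finitely many sides
  restrict the radius.\<close>

lemma openin_Euclidean_space_contains_ball:
  assumes V: "openin (Euclidean_space n) V" and x: "x \<in> V"
  obtains e where "0 < e"
    "\<And>y. (\<And>i. n \<le> i \<Longrightarrow> y i = 0) \<Longrightarrow> (\<And>i. i < n \<Longrightarrow> \<bar>y i - x i\<bar> \<le> e) \<Longrightarrow> y \<in> V"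
proof -
  obtain U where U: "open U" "V = U \<inter> {x. \<forall>i\<ge>n. x i = 0}"
    by (rule openin_Euclidean_spaceD[OF V])
  have "openin (product_topology (\<lambda>i. euclideanreal) UNIV) U" "x \<in> U"
    using U x by (auto simp: euclidean_product_topology)
  from product_topology_open_contains_basis[OF this] obtain B
    where B: "x \<in> PiE UNIV B" "\<And>i. open (B i)" "PiE UNIV B \<subseteq> U"
    by auto
  have "\<exists>e>0. \<forall>t. \<bar>t - x i\<bar> < e \<longrightarrow> t \<in> B i" for i
    using B(1) B(2)[of i, unfolded open_dist] by (auto simp: PiE_def dist_real_def)
  then obtain d where d: "\<And>i. 0 < d i" "\<And>i t. \<bar>t - x i\<bar> < d i \<Longrightarrow> t \<in> B i"
    by metis
  \<comment> \<open>The inserted 1 makes the minimum meaningful for \<open>n = 0\<close>; halving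
    puts the closed cube inside the open box.\<close>
  define e where "e = Min (insert 1 (d ` {..<n})) / 2"
  have e: "0 < e" using d(1) by (auto simp: e_def)
  have ed: "e < d i" if "i < n" for i
  proof -
    have "2 * e \<le> d i" using that by (simp add: e_def)
    then show ?thesis using e by linarith
  qed
  show ?thesis
  proof (rule that[OF e])
    fix y :: "nat \<Rightarrow> real"
    assume y: "\<And>i. n \<le> i \<Longrightarrow> y i = 0" "\<And>i. i < n \<Longrightarrow> \<bar>y i - x i\<bar> \<le> e"
    have "y i \<in> B i" for i
    proof (cases "i < n")
      case True
      then show ?thesis using y(2) ed d(2) by (meson order.strict_trans1)
    next
      case False
      then show ?thesis
        using y(1)[of i] openin_Euclidean_space_zero[OF V x, of i] B(1) by (simp add: PiE_def Pi_iff) metis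
    qed
    then have "y \<in> U" using B(3) by (auto simp: PiE_def)
    then show "y \<in> V" using U(2) y(1) by auto
  qed
qed

text \<open>\<open>r\<close> is the squared distance from \<open>x\<close> in the first
  \<open>n\<close> coordinates, \<open>W\<close> and \<open>K\<close> are the balls of radius
  \<open>e / 2\<close> (open) and \<open>e\<close> (closed). \<open>K\<close> lies in the cube of
  half-side \<open>e\<close>, hence in \<open>V\<close>.\<close>

lemma bump_function:
  assumes V: "openin (Euclidean_space n) V" and x: "x \<in> V"
  obtains \<rho> K W where "\<And>V'. openin (Euclidean_space n) V' \<Longrightarrow> C_infinity n V' \<rho>"
    "compact K" "K \<subseteq> V" "openin (Euclidean_space n) W" "x \<in> W" "W \<subseteq> V"
    "\<And>y. y \<in> W \<Longrightarrow> \<rho> y = 1" "\<And>y. y \<in> V - K \<Longrightarrow> \<rho> y = 0"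
proof -
  let ?E = "{y::nat \<Rightarrow> real. \<forall>i\<ge>n. y i = 0}"
  obtain e where e: "0 < e"
    "\<And>y. (\<And>i. n \<le> i \<Longrightarrow> y i = 0) \<Longrightarrow> (\<And>i. i < n \<Longrightarrow> \<bar>y i - x i\<bar> \<le> e) \<Longrightarrow> y \<in> V"
    using openin_Euclidean_space_contains_ball[OF V x] by metis
  define r where "r = (\<lambda>y::nat \<Rightarrow> real. (\<Sum>i<n. (y i + - x i) * (y i + - x i)))"
  have r_ge: "(y i - x i)\<^sup>2 \<le> r y" if "i < n" for y i
    unfolding r_def power2_eq_square diff_conv_add_uminus
    by (rule member_le_sum) (use that in auto)
  have r_smooth: "C_diff n V' k r" if "openin (Euclidean_space n) V'" for V' k
  proof -
    have "C_infinity n V' r"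
      unfolding r_def
      by (intro C_infinity_sum C_infinity_mult C_infinity_add C_infinity_const C_infinity_coord that)
    then show ?thesis by (simp add: C_infinity_iff_C_diff)
  qed
  have r_cont: "continuous_on A r" for A
    unfolding r_def
    by (intro continuous_intros continuous_on_product_then_coordinatewise[OF continuous_on_id])
  define K where "K = {y \<in> ?E. r y \<le> e\<^sup>2}"
  define W where "W = {y \<in> ?E. r y < e\<^sup>2 / 4}"
  define c where "c = flat 1 (3 / 4)"
  have c: "0 < c" by (simp add: c_def flat_def)
  \<comment> \<open>The inner \<open>flat 1\<close> vanishes for \<open>r y \<le> e^2 / 4\<close>,
    where the quotient becomes 1, and is at least \<open>c = flat 1 (3 / 4)\<close> for
    \<open>r y \<ge> e^2\<close>, where the outer argument is nonpositive. Only a constant is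
    inverted, so composition, sums and products give smoothness.\<close>
  define \<rho> where "\<rho> = (\<lambda>y. inverse (flat 1 c) * flat 1 (c + (- 1) * flat 1 (inverse (e\<^sup>2) * r y + - (1 / 4))))"
  have bound: "\<bar>y i - x i\<bar> \<le> e" if "y \<in> K" "i < n" for y i
  proof -
    have "(y i - x i)\<^sup>2 \<le> e\<^sup>2"
      using r_ge[OF that(2), of y] that(1) by (simp add: K_def)
    then show ?thesis
      using abs_le_square_iff[of "y i - x i" e] e(1) by simp
  qed
  show ?thesis
  proof (rule that[of \<rho> K W])
    show "C_infinity n V' \<rho>" if "openin (Euclidean_space n) V'" for V'
      unfolding C_infinity_iff_C_diff \<rho>_def
      by (intro allI C_diff_mult C_diff_const C_diff_flat C_diff_add r_smooth that)
    show "K \<subseteq> V"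
      using e(2) bound by (auto simp: K_def)
    have "closed {y. r y \<le> e\<^sup>2}"
      using continuous_on_closed_Collect_le[OF r_cont continuous_on_const closed_UNIV] by simp
    moreover have "closed ?E"
      using closedin_Euclidean_imp_closed[OF closedin_topspace] by (simp add: topspace_Euclidean_space)
    ultimately have "closed K"
      unfolding K_def by (simp add: Collect_conj_eq closed_Int)
    \<comment> \<open>The ambient space is an infinite product, so compactness comes from
      Tychonoff's theorem for the intervals, of which \<open>K\<close> is a closed part.\<close>
    have "compactin (product_topology (\<lambda>i. euclideanreal) UNIV) (PiE UNIV (\<lambda>i. {x i - e..x i + e}))"
      by (simp add: compactin_PiE)
    then have "compact (PiE UNIV (\<lambda>i. {x i - e..x i + e}))"
      by (simp add: euclidean_product_topology)
    moreover have "y \<in> PiE UNIV (\<lambda>i. {x i - e..x i + e})" if "y \<in> K" for y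
    proof -
      have "y i \<in> {x i - e..x i + e}" for i
      proof (cases "i < n")
        case True
        then show ?thesis using bound[OF \<open>y \<in> K\<close>] by (auto simp: abs_le_iff algebra_simps)
      next
        case False
        then show ?thesis
          using \<open>y \<in> K\<close> e(1) openin_Euclidean_space_zero[OF V x, of i] by (simp add: K_def)
      qed
      then show ?thesis by (simp add: PiE_def)
    qed
    then have "PiE UNIV (\<lambda>i. {x i - e..x i + e}) \<inter> K = K" by auto
    ultimately show "compact K"
      using compact_Int_closed[OF _ \<open>closed K\<close>] by metis
    have "open {y. r y < e\<^sup>2 / 4}"
      by (intro open_Collect_less r_cont continuous_on_const)
    from openin_Euclidean_spaceI[OF this, of n] show "openin (Euclidean_space n) W"
      by (simp add: W_def Collect_conj_eq Int_commute)
    show "x \<in> W"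
      using openin_Euclidean_space_zero[OF V x] e(1) by (simp add: W_def r_def)
    have "r y \<le> e\<^sup>2" if "r y < e\<^sup>2 / 4" for y
      using that zero_le_power2[of e] by linarith
    then have "W \<subseteq> K" by (auto simp: W_def K_def)
    then show "W \<subseteq> V" using \<open>K \<subseteq> V\<close> by blast
    show "\<rho> y = 1" if "y \<in> W" for y
    proof -
      have "inverse (e\<^sup>2) * r y + - (1 / 4) \<le> 0"
        using that e(1) by (simp add: W_def field_simps)
      then show ?thesis
        using c by (simp add: \<rho>_def flat_def)
    qed
    show "\<rho> y = 0" if "y \<in> V - K" for y
    proof -
      have "e\<^sup>2 < r y"
        using that openin_Euclidean_space_zero[OF V, of y] by (auto simp: K_def not_le)
      then have "3 / 4 \<le> inverse (e\<^sup>2) * r y + - (1 / 4)"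
        using e(1) by (simp add: field_simps)
      then have "c \<le> flat 1 (inverse (e\<^sup>2) * r y + - (1 / 4))"
        unfolding c_def by (rule flat_one_mono)
      then show ?thesis
        by (simp add: \<rho>_def flat_def[of 1 "c - _"])
    qed
  qed
qed

lemma sf_smooth_local:
  assumes "\<And>x. x \<in> V \<Longrightarrow> \<exists>W. openin (Euclidean_space n) W \<and> x \<in> W \<and> W \<subseteq> V \<and> sf_smooth n m W f"
    and "V \<subseteq> {x. \<forall>i\<ge>n. x i = 0}"
  shows "sf_smooth n m V f"
  unfolding sf_smooth_def C_infinity_iff_C_diff
proof (intro allI impI)
  fix I k assume I: "I \<subseteq> {..<m}"
  show "C_diff n V k (f I)"
  proof (rule C_diff_local[OF _ assms(2)])
    fix x assume "x \<in> V"
    from assms(1)[OF this] I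
    show "\<exists>W. openin (Euclidean_space n) W \<and> x \<in> W \<and> W \<subseteq> V \<and> C_diff n W k (f I)"
      unfolding sf_smooth_def C_infinity_iff_C_diff by blast
  qed
qed

text \<open>On \<open>V\<close>, \<open>f\<close> agrees with \<open>0 f\<close>, so compatibility
  of \<open>\<psi>\<close> with equality and with scalars gives the claim.\<close>

lemma superalgebra_hom_zero:
  assumes hom: "superalgebra_hom n m V V' \<psi>" and V: "openin (Euclidean_space n) V"
    and f: "sf_smooth n m V f" "sf_eq m V f 0"
  shows "sf_eq m V' (\<psi> f) 0"
proof -
  have "sf_eq m V f (scl 0 f)"
    using f(2) by (simp add: sf_eq_def scl_def)
  then have "sf_eq m V' (\<psi> f) (\<psi> (scl 0 f))"
    using hom f(1) sf_smooth_scl[OF V f(1)] unfolding superalgebra_hom_def by blast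
  moreover have "sf_eq m V' (\<psi> (scl 0 f)) (scl 0 (\<psi> f))"
    using hom f(1) unfolding superalgebra_hom_def by blast
  ultimately show ?thesis
    by (simp add: sf_eq_def scl_def)
qed

section \<open>Charts, transition maps and global extension\<close>

lemma supermanifold_chart:
  assumes "supermanifold n m M" "\<alpha> \<in> charts M"
  shows "openin (body M) (cdom M \<alpha>)" "openin (Euclidean_space n) (cran M \<alpha>)"
    "homeomorphic_map (subtopology (body M) (cdom M \<alpha>))
       (subtopology (Euclidean_space n) (cran M \<alpha>)) (chart M \<alpha>)"
    "inj_on (chart M \<alpha>) (cdom M \<alpha>)"
    "\<And>W. openin (body M) W \<Longrightarrow> W \<subseteq> cdom M \<alpha> \<Longrightarrow> openin (Euclidean_space n) (chart M \<alpha> ` W)"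
proof -
  show *: "openin (body M) (cdom M \<alpha>)" "openin (Euclidean_space n) (cran M \<alpha>)"
    "homeomorphic_map (subtopology (body M) (cdom M \<alpha>))
       (subtopology (Euclidean_space n) (cran M \<alpha>)) (chart M \<alpha>)"
    using assms unfolding supermanifold_def by auto
  have top: "topspace (subtopology (body M) (cdom M \<alpha>)) = cdom M \<alpha>"
    using openin_subset[OF *(1)] by auto
  show "inj_on (chart M \<alpha>) (cdom M \<alpha>)"
    using homeomorphic_imp_injective_map[OF *(3)] by (simp only: top)
  fix W assume W: "openin (body M) W" "W \<subseteq> cdom M \<alpha>"
  have "openin (subtopology (body M) (cdom M \<alpha>)) W"
    using W *(1) by (simp add: openin_open_subtopology)
  then have "openin (subtopology (Euclidean_space n) (cran M \<alpha>)) (chart M \<alpha> ` W)"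
    using homeomorphic_map_openness[OF *(3), of W, unfolded top, OF W(2)] by simp
  then show "openin (Euclidean_space n) (chart M \<alpha> ` W)"
    using *(2) by (simp add: openin_open_subtopology)
qed

lemma supermanifold_trans:
  assumes "supermanifold n m M" "\<alpha> \<in> charts M" "\<beta> \<in> charts M" "openin (body M) W"
    "W \<subseteq> cdom M \<alpha> \<inter> cdom M \<beta>"
  shows "superalgebra_hom n m (chart M \<beta> ` W) (chart M \<alpha> ` W) (trans M \<alpha> \<beta>)"
proof -
  have "\<forall>\<alpha>\<in>charts M. \<forall>\<beta>\<in>charts M. \<forall>W. openin (body M) W \<and> W \<subseteq> cdom M \<alpha> \<inter> cdom M \<beta> \<longrightarrow>
      superalgebra_hom n m (chart M \<beta> ` W) (chart M \<alpha> ` W) (trans M \<alpha> \<beta>) \<and>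
      (\<forall>f. sf_smooth n m (chart M \<beta> ` W) f \<longrightarrow>
        (\<forall>w\<in>W. trans M \<alpha> \<beta> f {} (chart M \<alpha> w) = f {} (chart M \<beta> w)))"
    using assms(1) unfolding supermanifold_def by (elim conjE)
  from this[rule_format, OF assms(2,3) conjI, OF assms(4,5)] show ?thesis
    by (rule conjunct1)
qed

text \<open>
  The extension is \<open>\<rho> f\<close> for a bump function \<open>\<rho>\<close>, transported to the other charts and continued by
  zero. Since the manifold is Hausdorff, the compact support of \<open>\<rho>\<close> is closed, so that the result is smooth.
\<close>

lemma extend_superfunction:
  assumes M: "supermanifold n m M" and \<alpha>: "\<alpha> \<in> charts M" and x: "x \<in> cran M \<alpha>"
  obtains W where "openin (Euclidean_space n) W" "x \<in> W" "W \<subseteq> cran M \<alpha>"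
    "\<And>f. sf_smooth n m (cran M \<alpha>) f \<Longrightarrow> \<exists>g\<in>smooth_functions n m M. sf_eq m W (g \<alpha>) f \<and>
      (\<forall>p. sf_parity m (cran M \<alpha>) p f \<longrightarrow> gf_parity m M p g)"
proof -
  note chart = supermanifold_chart[OF M]
  obtain \<rho> K W where \<rho>: "\<And>V'. openin (Euclidean_space n) V' \<Longrightarrow> C_infinity n V' \<rho>"
    and K: "compact K" "K \<subseteq> cran M \<alpha>"
    and W: "openin (Euclidean_space n) W" "x \<in> W" "W \<subseteq> cran M \<alpha>" "\<And>y. y \<in> W \<Longrightarrow> \<rho> y = 1"
    and zero: "\<And>y. y \<in> cran M \<alpha> - K \<Longrightarrow> \<rho> y = 0"
    using bump_function[OF chart(2)[OF \<alpha>] x] by metis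
  define K' where "K' = {w \<in> cdom M \<alpha>. chart M \<alpha> w \<in> K}"
  have K': "chart M \<alpha> ` K' = K" "K' \<subseteq> cdom M \<alpha>"
    using K(2) by (auto simp: K'_def cran_def)
  have "closedin (body M) K'"
  proof -
    have top: "topspace (subtopology (body M) (cdom M \<alpha>)) = cdom M \<alpha>"
      using openin_subset[OF chart(1)[OF \<alpha>]] by auto
    have "Euclidean_space n = subtopology euclidean {y. \<forall>i\<ge>n. y i = 0}"
      by (simp add: Euclidean_space_def euclidean_product_topology)
    moreover have "K \<subseteq> {y. \<forall>i\<ge>n. y i = 0}"
      using K(2) openin_Euclidean_space_zero[OF chart(2)[OF \<alpha>]] by blast
    ultimately have "compactin (subtopology (Euclidean_space n) (cran M \<alpha>)) K"
      using K by (simp add: compactin_subtopology)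
    then have "compactin (subtopology (body M) (cdom M \<alpha>)) K'"
      using homeomorphic_map_compactness[OF chart(3)[OF \<alpha>], of K'] K' by (simp only: top)
    then have "compactin (body M) K'"
      by (simp add: compactin_subtopology)
    moreover have "Hausdorff_space (body M)"
      using M by (simp add: supermanifold_def)
    ultimately show ?thesis
      by (simp add: compactin_imp_closedin)
  qed
  \<comment> \<open>\<open>U\<close> and the domain of \<alpha> cover the manifold; that
    \<open>U\<close> is open is what the Hausdorff property is for.\<close>
  define U where "U = topspace (body M) - K'"
  have U: "openin (body M) U"
    using \<open>closedin (body M) K'\<close> by (simp add: U_def openin_diff)
  have cdom_U: "w \<in> U \<longleftrightarrow> w \<notin> K'" if "w \<in> cdom M \<beta>" "\<beta> \<in> charts M" for w \<beta>
    using openin_subset[OF chart(1)[OF that(2)]] that(1) by (auto simp: U_def)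
  show ?thesis
  proof (rule that[OF W(1-3)])
    fix f assume f: "sf_smooth n m (cran M \<alpha>) f"
    define h where "h = (\<lambda>I y. \<rho> y * f I y)"
    have h: "sf_smooth n m (cran M \<alpha>) h"
      using f \<rho>[OF chart(2)[OF \<alpha>]] unfolding sf_smooth_def h_def
      by (auto intro: C_infinity_mult chart(2)[OF \<alpha>])
    have h_sub: "sf_smooth n m (chart M \<alpha> ` O') h" if "O' \<subseteq> cdom M \<alpha>" for O'
      using sf_smooth_subset[OF h, of "chart M \<alpha> ` O'"] that by (auto simp: cran_def)
    \<comment> \<open>All coefficients of the transported function, not only its body, vanish off
      the support: transition maps act on every open subset of an overlap and preserve zero
      there.\<close>
    have h_zero: "sf_eq m (chart M \<beta> ` O') (trans M \<beta> \<alpha> h) 0"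
      if "\<beta> \<in> charts M" "openin (body M) O'" "O' \<subseteq> cdom M \<alpha> \<inter> cdom M \<beta>" "O' \<subseteq> U" for \<beta> O'
    proof (rule superalgebra_hom_zero[OF supermanifold_trans[OF M]])
      show "sf_eq m (chart M \<alpha> ` O') h 0"
        unfolding sf_eq_def
      proof (intro allI impI ballI)
        fix I y assume "y \<in> chart M \<alpha> ` O'"
        then obtain w where w: "w \<in> O'" "y = chart M \<alpha> w" by auto
        then have "w \<in> cdom M \<alpha>" "w \<notin> K'" using that by (auto simp: U_def)
        then have "y \<in> cran M \<alpha> - K" using w(2) by (auto simp: K'_def cran_def)
        then show "h I y = 0 I y" using zero by (simp add: h_def)
      qed
    qed (use that h_sub chart(5)[OF \<alpha>] \<alpha> in auto)
    \<comment> \<open>Continuation by zero outside the overlap with \<alpha>. It is consistent on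
      \<open>U\<close>, where the transported function vanishes as well.\<close>
    define g where "g = (\<lambda>\<beta> I y. if y \<in> chart M \<beta> ` (cdom M \<alpha> \<inter> cdom M \<beta>) then trans M \<beta> \<alpha> h I y else 0)"
    have g_overlap: "sf_eq m (chart M \<beta> ` O') (trans M \<beta> \<alpha> h) (g \<beta>)" if "O' \<subseteq> cdom M \<alpha> \<inter> cdom M \<beta>" for \<beta> O'
      using that by (auto simp: sf_eq_def g_def)
    have g_outside: "sf_eq m (chart M \<beta> ` O') (g \<beta>) 0"
      if "\<beta> \<in> charts M" "openin (body M) O'" "O' \<subseteq> cdom M \<beta>" "O' \<subseteq> U" for \<beta> O'
    proof -
      have "sf_eq m (chart M \<beta> ` (O' \<inter> cdom M \<alpha>)) (trans M \<beta> \<alpha> h) 0"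
        by (rule h_zero) (use that chart(1)[OF \<alpha>] in auto)
      moreover have "w \<in> O' \<inter> cdom M \<alpha>"
        if "w \<in> O'" "chart M \<beta> w \<in> chart M \<beta> ` (cdom M \<alpha> \<inter> cdom M \<beta>)" for w
        using that inj_onD[OF chart(4)[OF \<open>\<beta> \<in> charts M\<close>]] \<open>O' \<subseteq> cdom M \<beta>\<close> by blast
      ultimately show ?thesis
        by (auto simp: sf_eq_def g_def)
    qed
    have trans_smooth: "sf_smooth n m (chart M \<beta> ` O') (trans M \<beta> \<alpha> h)"
      if "\<beta> \<in> charts M" "openin (body M) O'" "O' \<subseteq> cdom M \<alpha> \<inter> cdom M \<beta>" for \<beta> O'
      using supermanifold_trans[OF M that(1) \<alpha> that(2)] that(3) h_sub[of O']
      unfolding superalgebra_hom_def by blast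
    have smooth_overlap: "sf_smooth n m (chart M \<beta> ` O') (g \<beta>)"
      if "\<beta> \<in> charts M" "openin (body M) O'" "O' \<subseteq> cdom M \<alpha> \<inter> cdom M \<beta>" for \<beta> O'
      using sf_smooth_cong[OF _ g_overlap trans_smooth] chart(5)[OF that(1,2)] that by blast
    have smooth_outside: "sf_smooth n m (chart M \<beta> ` O') (g \<beta>)"
      if "\<beta> \<in> charts M" "openin (body M) O'" "O' \<subseteq> cdom M \<beta>" "O' \<subseteq> U" for \<beta> O'
    proof (rule sf_smooth_cong[of n _ m 0])
      show "openin (Euclidean_space n) (chart M \<beta> ` O')"
        using chart(5) that by blast
      then show "sf_smooth n m (chart M \<beta> ` O') 0"
        using C_infinity_const[of n _ 0] by (simp add: sf_smooth_def zero_fun_def)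
      show "sf_eq m (chart M \<beta> ` O') 0 (g \<beta>)"
        using g_outside[OF that] by (simp add: sf_eq_def)
    qed
    have U_cdom: "openin (body M) (U \<inter> cdom M \<beta>)" if "\<beta> \<in> charts M" for \<beta>
      using U chart(1)[OF that] by blast
    have overlap: "openin (body M) (cdom M \<alpha> \<inter> cdom M \<beta>)" if "\<beta> \<in> charts M" for \<beta>
      using chart(1)[OF \<alpha>] chart(1)[OF that] by blast
    have "g \<in> smooth_functions n m M"
      unfolding smooth_functions_def
    proof (intro CollectI conjI ballI)
      fix \<beta> assume \<beta>: "\<beta> \<in> charts M"
      show "sf_smooth n m (cran M \<beta>) (g \<beta>)"
      proof (rule sf_smooth_local)
        fix y assume "y \<in> cran M \<beta>"
        then obtain w where w: "w \<in> cdom M \<beta>" "y = chart M \<beta> w" by (auto simp: cran_def)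
        show "\<exists>W. openin (Euclidean_space n) W \<and> y \<in> W \<and> W \<subseteq> cran M \<beta> \<and> sf_smooth n m W (g \<beta>)"
        \<comment> \<open>Near points of the domain of \<alpha> the extension is a transported
          smooth function; all other points lie in \<open>U\<close>, where it is zero.\<close>
        proof (cases "w \<in> cdom M \<alpha>")
          case True
          then show ?thesis
            using w chart(5)[OF \<beta> overlap[OF \<beta>]] smooth_overlap[OF \<beta> overlap[OF \<beta>]]
            by (intro exI[of _ "chart M \<beta> ` (cdom M \<alpha> \<inter> cdom M \<beta>)"]) (auto simp: cran_def)
        next
          case False
          then have "w \<in> U" using cdom_U[OF w(1) \<beta>] K'(2) by blast
          then show ?thesis
            using w chart(5)[OF \<beta> U_cdom[OF \<beta>]] smooth_outside[OF \<beta> U_cdom[OF \<beta>]]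
            by (intro exI[of _ "chart M \<beta> ` (U \<inter> cdom M \<beta>)"]) (auto simp: cran_def)
        qed
      qed (use openin_Euclidean_space_zero[OF chart(2)[OF \<beta>]] in auto)
      fix \<gamma> assume \<gamma>: "\<gamma> \<in> charts M"
      show "sf_eq m (chart M \<beta> ` (cdom M \<beta> \<inter> cdom M \<gamma>)) (trans M \<beta> \<gamma> (g \<gamma>)) (g \<beta>)"
        unfolding sf_eq_def
      proof (intro allI impI ballI)
        fix I y assume I: "I \<subseteq> {..<m}" and "y \<in> chart M \<beta> ` (cdom M \<beta> \<inter> cdom M \<gamma>)"
        then obtain w where w: "w \<in> cdom M \<beta>" "w \<in> cdom M \<gamma>" "y = chart M \<beta> w" by auto
        show "trans M \<beta> \<gamma> (g \<gamma>) I y = g \<beta> I y"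
        proof (cases "w \<in> cdom M \<alpha>")
          case True
          let ?O = "cdom M \<alpha> \<inter> cdom M \<beta> \<inter> cdom M \<gamma>"
          have O: "openin (body M) ?O"
            using overlap[OF \<beta>] chart(1)[OF \<gamma>] by blast
          have "superalgebra_hom n m (chart M \<gamma> ` ?O) (chart M \<beta> ` ?O) (trans M \<beta> \<gamma>)"
            by (rule supermanifold_trans[OF M \<beta> \<gamma> O]) auto
          moreover have "sf_eq m (chart M \<gamma> ` ?O) (trans M \<gamma> \<alpha> h) (g \<gamma>)"
            by (rule g_overlap) auto
          moreover have "sf_smooth n m (chart M \<gamma> ` ?O) (trans M \<gamma> \<alpha> h)" "sf_smooth n m (chart M \<gamma> ` ?O) (g \<gamma>)"
            by (rule trans_smooth[OF \<gamma> O] smooth_overlap[OF \<gamma> O]; auto)+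
          \<comment> \<open>Over the domain of \<alpha>, agreement of the local expressions is the
            cocycle condition applied to \<open>h\<close>.\<close>
          ultimately have 1: "sf_eq m (chart M \<beta> ` ?O) (trans M \<beta> \<gamma> (trans M \<gamma> \<alpha> h)) (trans M \<beta> \<gamma> (g \<gamma>))"
            unfolding superalgebra_hom_def by blast
          have "\<forall>\<alpha>\<in>charts M. \<forall>\<beta>\<in>charts M. \<forall>\<gamma>\<in>charts M. \<forall>W f.
              openin (body M) W \<and> W \<subseteq> cdom M \<alpha> \<inter> cdom M \<beta> \<inter> cdom M \<gamma> \<and> sf_smooth n m (chart M \<gamma> ` W) f \<longrightarrow>
              sf_eq m (chart M \<alpha> ` W) (trans M \<alpha> \<beta> (trans M \<beta> \<gamma> f)) (trans M \<alpha> \<gamma> f)"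
            using M unfolding supermanifold_def by (elim conjE)
          from this[rule_format, OF \<beta> \<gamma> \<alpha>, of ?O h]
          have 2: "sf_eq m (chart M \<beta> ` ?O) (trans M \<beta> \<gamma> (trans M \<gamma> \<alpha> h)) (trans M \<beta> \<alpha> h)"
            using O h_sub[of ?O] by auto
          have 3: "sf_eq m (chart M \<beta> ` ?O) (trans M \<beta> \<alpha> h) (g \<beta>)"
            by (rule g_overlap) auto
          have "y \<in> chart M \<beta> ` ?O" using w True by auto
          then show ?thesis
            using 1 2 3 I unfolding sf_eq_def by metis
        next
          case False
          let ?O = "U \<inter> cdom M \<beta> \<inter> cdom M \<gamma>"
          have O: "openin (body M) ?O"
            using U_cdom[OF \<beta>] chart(1)[OF \<gamma>] by blast
          have "sf_eq m (chart M \<beta> ` ?O) (trans M \<beta> \<gamma> (g \<gamma>)) 0"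
          proof (rule superalgebra_hom_zero[OF supermanifold_trans[OF M \<beta> \<gamma> O]])
            show "sf_smooth n m (chart M \<gamma> ` ?O) (g \<gamma>)"
              by (rule smooth_outside[OF \<gamma> O]) auto
            show "sf_eq m (chart M \<gamma> ` ?O) (g \<gamma>) 0"
              by (rule g_outside[OF \<gamma> O]) auto
          qed (use chart(5)[OF \<gamma> O] in auto)
          moreover have "sf_eq m (chart M \<beta> ` ?O) (g \<beta>) 0"
            by (rule g_outside[OF \<beta> O]) auto
          moreover have "y \<in> chart M \<beta> ` ?O"
            using w False cdom_U[OF w(1) \<beta>] K'(2) by auto
          ultimately show ?thesis
            using I unfolding sf_eq_def by metis
        qed
      qed
    qed
    moreover have "sf_eq m W (g \<alpha>) f"
    proof -
      have "\<forall>\<alpha>\<in>charts M. \<forall>W f. openin (body M) W \<and> W \<subseteq> cdom M \<alpha> \<and> sf_smooth n m (chart M \<alpha> ` W) f \<longrightarrow>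
          sf_eq m (chart M \<alpha> ` W) (trans M \<alpha> \<alpha> f) f"
        using M unfolding supermanifold_def by (elim conjE)
      from this[rule_format, OF \<alpha>, of "cdom M \<alpha>" h]
      have "sf_eq m (cran M \<alpha>) (trans M \<alpha> \<alpha> h) h"
        using chart(1)[OF \<alpha>] h_sub[of "cdom M \<alpha>"] by (simp add: cran_def)
      moreover have "sf_eq m (cran M \<alpha>) (trans M \<alpha> \<alpha> h) (g \<alpha>)"
        unfolding cran_def by (rule g_overlap) auto
      ultimately have "sf_eq m (cran M \<alpha>) (g \<alpha>) h"
        by (simp add: sf_eq_def)
      moreover have "sf_eq m W h f"
        using W(4) by (simp add: sf_eq_def h_def)
      ultimately show ?thesis
        using W(3) unfolding sf_eq_def by (metis subsetD)
    qed
    moreover have "gf_parity m M p g" if p: "sf_parity m (cran M \<alpha>) p f" for p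
      unfolding gf_parity_def
    proof
      fix \<beta> assume \<beta>: "\<beta> \<in> charts M"
      let ?O = "cdom M \<alpha> \<inter> cdom M \<beta>"
      have "superalgebra_hom n m (chart M \<alpha> ` ?O) (chart M \<beta> ` ?O) (trans M \<beta> \<alpha>)"
        by (rule supermanifold_trans[OF M \<beta> \<alpha> overlap[OF \<beta>]]) auto
      moreover have "sf_parity m (chart M \<alpha> ` ?O) p h"
        using p by (auto simp: sf_parity_def h_def cran_def)
      ultimately have "sf_parity m (chart M \<beta> ` ?O) p (trans M \<beta> \<alpha> h)"
        using h_sub[of ?O] unfolding superalgebra_hom_def by blast
      then show "sf_parity m (cran M \<beta>) p (g \<beta>)"
        by (auto simp: sf_parity_def g_def)
    qed
    ultimately show "\<exists>g\<in>smooth_functions n m M. sf_eq m W (g \<alpha>) f \<and>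
        (\<forall>p. sf_parity m (cran M \<alpha>) p f \<longrightarrow> gf_parity m M p g)"
      by blast
  qed
qed

section \<open>The projective Laplacian\<close>

context super_diff_algebra
begin

lemma A_diff [simp]: "a \<in> A \<Longrightarrow> b \<in> A \<Longrightarrow> a - b \<in> A"
  using A_add[of a "(- 1) *\<^sub>R b"] A_scaleR[of b "- 1"] by simp

lemma hom_diff: "hom p a \<Longrightarrow> hom p b \<Longrightarrow> hom p (a - b)"
  using hom_add[of p a "(- 1) *\<^sub>R b"] hom_scaleR[of p b "- 1"] by simp

end

lemma sf_eq_subset: "sf_eq m V f g \<Longrightarrow> W \<subseteq> V \<Longrightarrow> sf_eq m W f g"
  by (auto simp: sf_eq_def)

lemma sf_parity_subset: "sf_parity m V p f \<Longrightarrow> W \<subseteq> V \<Longrightarrow> sf_parity m W p f"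
  by (auto simp: sf_parity_def)

lemma local_hamiltonian_subset: "local_hamiltonian n m V S \<Longrightarrow> W \<subseteq> V \<Longrightarrow> local_hamiltonian n m W S"
  by (auto simp: local_hamiltonian_def intro: sf_smooth_subset sf_eq_subset sf_parity_subset)

lemma loc_in_smooth_algebra: "sf_smooth n m V f \<Longrightarrow> loc m V f \<in> smooth_algebra n m V"
  by (simp add: smooth_algebra_def)

text \<open>In a trace term the summed index counts twice, and the Kronecker delta equates
  \<open>k\<close> with one lower index; what remains is the parity of the other lower index, as for
  the connection coefficient itself.\<close>

lemma loc_proj_coeff:
  assumes V: "openin (Euclidean_space n) V"
    and G: "\<And>i j k. i \<in> coords n m \<Longrightarrow> j \<in> coords n m \<Longrightarrow> k \<in> coords n m \<Longrightarrow>
      sf_smooth n m V (G k i j) \<and> sf_parity m V (par i + par j + par k) (G k i j)"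
    and ijk: "i \<in> coords n m" "j \<in> coords n m" "k \<in> coords n m"
  shows "loc m V (proj_coeff n m G k j i) \<in> smooth_algebra n m V"
    and "homogeneous (par i + par j + par k) (loc m V (proj_coeff n m G k j i))"
proof -
  interpret super_diff_algebra "coords n m" "smooth_algebra n m V" homogeneous "dloc m V"
    "\<lambda>i. loc m V (coord_fun i)" "loc m V (sf_const 1)"
    by (rule super_diff_algebra_smooth_algebra[OF V])
  have G': "loc m V (G c a b) \<in> smooth_algebra n m V" "homogeneous (par a + par b + par c) (loc m V (G c a b))"
    if "a \<in> coords n m" "b \<in> coords n m" "c \<in> coords n m" for a b c
    using G[OF that] by (simp_all add: loc_in_smooth_algebra homogeneous_loc_iff)
  have eq: "loc m V (proj_coeff n m G k j i) = loc m V (G k j i) - (1 / (real n - real m + 1)) *\<^sub>R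
      ((\<Sum>s\<in>coords n m. (of_bool (k = i) * sg (par s)) *\<^sub>R loc m V (G s j s)) +
       (\<Sum>s\<in>coords n m. (of_bool (k = j) * sg (par i * par j + par s)) *\<^sub>R loc m V (G s i s)))"
    by (simp only: proj_coeff_def loc_diff loc_add loc_scl loc_sum)
  show "loc m V (proj_coeff n m G k j i) \<in> smooth_algebra n m V"
    unfolding eq using ijk by (intro A_diff A_scaleR A_add A_sum G'(1)) auto
  have trace: "homogeneous (par i + par j + par k) ((of_bool (k = a) * r) *\<^sub>R loc m V (G s b s))"
    if "s \<in> coords n m" "{a, b} = {i, j}" for a b s r
  proof (cases "k = a")
    case True
    have "homogeneous (par b + par s + par s) (loc m V (G s b s))"
      by (rule G'(2)) (use that ijk in \<open>auto simp: doubleton_eq_iff\<close>)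
    then have "homogeneous (par i + par j + par k) (loc m V (G s b s))"
      by (rule hom_cong) (use True that in \<open>auto simp: doubleton_eq_iff\<close>)
    then show ?thesis by (rule hom_scaleR)
  qed simp
  have "homogeneous (par i + par j + par k) (loc m V (G k j i))"
    using G'(2)[OF ijk(2,1,3)] by (simp add: add_ac)
  then show "homogeneous (par i + par j + par k) (loc m V (proj_coeff n m G k j i))"
    unfolding eq by (intro hom_diff hom_scaleR hom_add hom_sum trace) auto
qed

text \<open>Contracted indices contribute their parity twice, so only the parity of \<open>i\<close>
  and the oddness of \<open>S\<close> remain.\<close>

lemma loc_proj_T:
  assumes V: "openin (Euclidean_space n) V" and S: "local_hamiltonian n m V S"
    and P: "\<And>i j k. i \<in> coords n m \<Longrightarrow> j \<in> coords n m \<Longrightarrow> k \<in> coords n m \<Longrightarrow>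
      loc m V (P k j i) \<in> smooth_algebra n m V \<and> homogeneous (par i + par j + par k) (loc m V (P k j i))"
    and i: "i \<in> coords n m"
  shows "loc m V (proj_T n m S P i) \<in> smooth_algebra n m V"
    and "homogeneous (par i + 1) (loc m V (proj_T n m S P i))"
proof -
  interpret odd_symmetric_tensor "coords n m" "smooth_algebra n m V" homogeneous "dloc m V"
    "\<lambda>i. loc m V (coord_fun i)" "loc m V (sf_const 1)" "\<lambda>i j. loc m V (S i j)"
    by (rule odd_symmetric_tensor_loc[OF V S])
  have eq: "loc m V (proj_T n m S P i) = (2 / (real n - real m + 3)) *\<^sub>R
        (\<Sum>j\<in>coords n m. dloc m V j (loc m V (S j i))) -
      ((real n - real m + 1) / (real n - real m + 3)) *\<^sub>R
        (\<Sum>j\<in>coords n m. \<Sum>k\<in>coords n m. loc m V (S j k) * loc m V (P i k j))"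
    by (simp add: proj_T_def loc_diff loc_scl loc_sum loc_mult loc_pd[OF V])
  show "loc m V (proj_T n m S P i) \<in> smooth_algebra n m V"
    unfolding eq using i P by (intro A_diff A_scaleR A_sum A_D A_mult S_A) auto
  have "homogeneous (par i + 1) (dloc m V j (loc m V (S j i)))" if "j \<in> coords n m" for j
    using hom_D[OF S_hom[OF that i], of j] by (rule hom_cong) auto
  moreover have "homogeneous (par i + 1) (loc m V (S j k) * loc m V (P i k j))"
    if "j \<in> coords n m" "k \<in> coords n m" for j k
    by (rule hom_cong[OF hom_mult[OF S_hom[OF that] conjunct2[OF P[OF that i]]]]) auto
  ultimately show "homogeneous (par i + 1) (loc m V (proj_T n m S P i))"
    unfolding eq by (intro hom_diff hom_scaleR hom_sum) auto
qed

text \<open>Stated for open subsets of a chart range, because the squaring argument needs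
  neighbourhoods on which coordinates have global extensions.\<close>

lemma odd_laplacian_loc:
  assumes M: "supermanifold n m M" and P: "projective_class n m M P" and S: "master_hamiltonian n m M S"
    and \<alpha>: "\<alpha> \<in> charts M" and W: "openin (Euclidean_space n) W" "W \<subseteq> cran M \<alpha>"
  shows "local_hamiltonian n m W (S \<alpha>)"
    and "odd_laplacian (coords n m) (smooth_algebra n m W) homogeneous (dloc m W)
      (\<lambda>i. loc m W (coord_fun i)) (loc m W (sf_const 1)) (\<lambda>i j. loc m W (S \<alpha> i j))
      (\<lambda>i. loc m W (proj_T n m (S \<alpha>) (P \<alpha>) i))"
proof -
  have "local_hamiltonian n m (cran M \<alpha>) (S \<alpha>)"
    using S \<alpha> unfolding master_hamiltonian_def local_hamiltonian_def by auto
  then show ham: "local_hamiltonian n m W (S \<alpha>)"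
    using W(2) by (rule local_hamiltonian_subset)
  interpret odd_symmetric_tensor "coords n m" "smooth_algebra n m W" homogeneous "dloc m W"
    "\<lambda>i. loc m W (coord_fun i)" "loc m W (sf_const 1)" "\<lambda>i j. loc m W (S \<alpha> i j)"
    by (rule odd_symmetric_tensor_loc[OF W(1) ham])
  obtain \<Gamma> where \<Gamma>: "symmetric_connection n m M \<Gamma>" and
    eq: "\<forall>\<alpha>\<in>charts M. \<forall>k\<in>coords n m. \<forall>j\<in>coords n m. \<forall>i\<in>coords n m.
        sf_eq m (cran M \<alpha>) (P \<alpha> k j i) (proj_coeff n m (\<Gamma> \<alpha>) k j i)"
    using P unfolding projective_class_def by blast
  have G: "sf_smooth n m W (\<Gamma> \<alpha> k i j) \<and> sf_parity m W (par i + par j + par k) (\<Gamma> \<alpha> k i j)"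
    if "i \<in> coords n m" "j \<in> coords n m" "k \<in> coords n m" for i j k
    using \<Gamma>[unfolded symmetric_connection_def, THEN conjunct1, rule_format, OF \<alpha> that] W(2)
    by (auto intro: sf_smooth_subset sf_parity_subset)
  have "loc m W (P \<alpha> k j i) = loc m W (proj_coeff n m (\<Gamma> \<alpha>) k j i)"
    if "i \<in> coords n m" "j \<in> coords n m" "k \<in> coords n m" for i j k
    using sf_eq_subset[OF eq[rule_format, OF \<alpha> that(3,2,1)] W(2)] by (simp add: loc_eq_iff)
  then have "loc m W (P \<alpha> k j i) \<in> smooth_algebra n m W \<and>
      homogeneous (par i + par j + par k) (loc m W (P \<alpha> k j i))"
    if "i \<in> coords n m" "j \<in> coords n m" "k \<in> coords n m" for i j k
    using loc_proj_coeff[OF W(1) G that] that by simp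
  note T = loc_proj_T[OF W(1) ham this]
  show "odd_laplacian (coords n m) (smooth_algebra n m W) homogeneous (dloc m W)
      (\<lambda>i. loc m W (coord_fun i)) (loc m W (sf_const 1)) (\<lambda>i j. loc m W (S \<alpha> i j))
      (\<lambda>i. loc m W (proj_T n m (S \<alpha>) (P \<alpha>) i))"
    by unfold_locales (use T in auto)
qed

section \<open>From local coefficients to the manifold\<close>

lemma smooth_functionsD: "f \<in> smooth_functions n m M \<Longrightarrow> \<alpha> \<in> charts M \<Longrightarrow> sf_smooth n m (cran M \<alpha>) (f \<alpha>)"
  by (simp add: smooth_functions_def)

lemma projective_laplacian_generates_bracket:
  assumes M: "supermanifold n m M" and P: "projective_class n m M P" and S: "master_hamiltonian n m M S"
    and a: "a \<in> smooth_functions n m M" "gf_parity m M p a" and b: "b \<in> smooth_functions n m M"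
  defines "\<Delta> \<equiv> projective_laplacian n m S P"
  shows "gf_eq m M (odd_bracket n m S a b) (gscl (sg p) (\<Delta> (a \<bullet>\<^sub>s b) - \<Delta> a \<bullet>\<^sub>s b - gscl (sg p) (a \<bullet>\<^sub>s \<Delta> b)))"
  unfolding gf_eq_def
proof
  fix \<alpha> assume \<alpha>: "\<alpha> \<in> charts M"
  let ?V = "cran M \<alpha>"
  note V = supermanifold_chart(2)[OF M \<alpha>]
  interpret odd_laplacian "coords n m" "smooth_algebra n m ?V" homogeneous "dloc m ?V"
    "\<lambda>i. loc m ?V (coord_fun i)" "loc m ?V (sf_const 1)" "\<lambda>i j. loc m ?V (S \<alpha> i j)"
    "\<lambda>i. loc m ?V (proj_T n m (S \<alpha>) (P \<alpha>) i)"
    by (rule odd_laplacian_loc(2)[OF M P S \<alpha> V subset_refl])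
  have lap: "loc m ?V (\<Delta> f \<alpha>) = lap (loc m ?V (f \<alpha>))" for f
    by (simp add: \<Delta>_def projective_laplacian_def lap_def loc_add loc_sum loc_mult loc_pd[OF V])
  have ab: "sf_smooth n m ?V (a \<alpha>)" "sf_parity m ?V p (a \<alpha>)" "sf_smooth n m ?V (b \<alpha>)"
    using a b \<alpha> by (auto simp: smooth_functions_def gf_parity_def)
  have "loc m ?V (odd_bracket n m S a b \<alpha>) = bracket p (loc m ?V (a \<alpha>)) (loc m ?V (b \<alpha>))"
    by (rule loc_odd_bracket[where S = S and \<alpha> = \<alpha> and f = a and g = b, OF V odd_laplacian_loc(1)[OF M P S \<alpha> V subset_refl] ab])
  also have "\<dots> = sg p *\<^sub>R (lap (loc m ?V (a \<alpha>) * loc m ?V (b \<alpha>)) - lap (loc m ?V (a \<alpha>)) * loc m ?V (b \<alpha>) -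
      sg p *\<^sub>R (loc m ?V (a \<alpha>) * lap (loc m ?V (b \<alpha>))))"
    using ab by (intro lap_generates_bracket) (auto simp: loc_in_smooth_algebra homogeneous_loc_iff)
  also have "\<dots> = loc m ?V (gscl (sg p) (\<Delta> (a \<bullet>\<^sub>s b) - \<Delta> a \<bullet>\<^sub>s b - gscl (sg p) (a \<bullet>\<^sub>s \<Delta> b)) \<alpha>)"
    by (simp add: gscl_def gmult_def loc_scl loc_diff loc_mult lap)
  finally show "sf_eq m ?V (odd_bracket n m S a b \<alpha>)
      (gscl (sg p) (\<Delta> (a \<bullet>\<^sub>s b) - \<Delta> a \<bullet>\<^sub>s b - gscl (sg p) (a \<bullet>\<^sub>s \<Delta> b)) \<alpha>)"
    by (simp add: loc_eq_iff)
qed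

text \<open>The neighbourhood is independent of the functions to be extended. Hence one
  \<open>W\<close> serves both the Jacobi identity for the coordinates and the test functions for
  the square.\<close>

lemma square_zero_near:
  assumes M: "supermanifold n m M" and P: "projective_class n m M P" and S: "master_hamiltonian n m M S"
    and B: "odd_poisson_bracket n m M (odd_bracket n m S)" and \<alpha>: "\<alpha> \<in> charts M" and x: "x \<in> cran M \<alpha>"
  defines "\<Delta> \<equiv> projective_laplacian n m S P" and "T \<equiv> proj_T n m (S \<alpha>) (P \<alpha>)"
  shows "\<exists>W. x \<in> W \<and> W \<subseteq> cran M \<alpha> \<and>
    ((\<forall>f\<in>smooth_functions n m M. sf_eq m W (\<Delta> (\<Delta> f) \<alpha>) 0) \<longleftrightarrow>
      (\<forall>i\<in>coords n m. sf_eq m W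
          ((\<Sum>j\<in>coords n m. \<Sum>k\<in>coords n m. S \<alpha> j k \<star> pd k (pd j (T i))) +
           (\<Sum>j\<in>coords n m. T j \<star> pd j (T i))) 0) \<and>
      (\<forall>i\<in>coords n m. \<forall>j\<in>coords n m. sf_eq m W
          ((\<Sum>k\<in>coords n m. \<Sum>l\<in>coords n m. S \<alpha> k l \<star> pd l (pd k (S \<alpha> i j))) +
           (\<Sum>k\<in>coords n m. T k \<star> pd k (S \<alpha> i j)) +
           (\<Sum>k\<in>coords n m. scl (sg (par i)) (S \<alpha> i k \<star> pd k (T j))) +
           (\<Sum>k\<in>coords n m. scl (sg (par j * (par i + 1))) (S \<alpha> j k \<star> pd k (T i)))) 0))"
proof -
  obtain W where W: "openin (Euclidean_space n) W" "x \<in> W" "W \<subseteq> cran M \<alpha>" and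
    ext: "\<And>f. sf_smooth n m (cran M \<alpha>) f \<Longrightarrow> \<exists>g\<in>smooth_functions n m M. sf_eq m W (g \<alpha>) f \<and>
      (\<forall>p. sf_parity m (cran M \<alpha>) p f \<longrightarrow> gf_parity m M p g)"
    using extend_superfunction[OF M \<alpha> x] by metis
  note V = supermanifold_chart(2)[OF M \<alpha>]
  note ham = odd_laplacian_loc(1)[OF M P S \<alpha> W(1,3)]
  let ?L = "loc m W" and ?X = "\<lambda>i. loc m W (coord_fun i)" and ?B = "odd_bracket n m S"
  interpret odd_laplacian "coords n m" "smooth_algebra n m W" homogeneous "dloc m W" ?X "?L (sf_const 1)"
    "\<lambda>i j. ?L (S \<alpha> i j)" "\<lambda>i. ?L (proj_T n m (S \<alpha>) (P \<alpha>) i)"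
    by (rule odd_laplacian_loc(2)[OF M P S \<alpha> W(1,3)])
  have L: "?L (\<Delta> f \<alpha>) = lap (?L (f \<alpha>))" for f
    by (simp add: \<Delta>_def projective_laplacian_def lap_def loc_add loc_sum loc_mult loc_pd[OF W(1)])
  have smooth: "sf_smooth n m W (f \<alpha>)" if "f \<in> smooth_functions n m M" for f
    using sf_smooth_subset[OF smooth_functionsD[OF that \<alpha>] W(3)] .
  have LB: "?L (?B f g \<alpha>) = bracket p (?L (f \<alpha>)) (?L (g \<alpha>))"
    if "f \<in> smooth_functions n m M" "g \<in> smooth_functions n m M" "gf_parity m M p f" for f g p
    using that \<alpha> sf_parity_subset[OF _ W(3)]
    by (intro loc_odd_bracket[where S = S and \<alpha> = \<alpha>, OF W(1) ham]) (auto intro: smooth simp: gf_parity_def)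
  have B_smooth: "?B f g \<in> smooth_functions n m M"
    if "f \<in> smooth_functions n m M" "g \<in> smooth_functions n m M" for f g
    using B that unfolding odd_poisson_bracket_def by blast
  have "\<exists>g\<in>smooth_functions n m M. ?L (g \<alpha>) = ?X i \<and> gf_parity m M (par i) g" for i
  proof -
    have "sf_parity m (cran M \<alpha>) (par i) (coord_fun i)"
      by (cases i) (auto simp: sf_parity_def)
    then show ?thesis
      using ext[OF sf_smooth_coord_fun[OF V], of i] by (auto simp: loc_eq_iff)
  qed
  \<comment> \<open>From here on \<open>x\<close> denotes global functions that restrict to the
    coordinates on \<open>W\<close>, no longer the point. Their parities are needed for the Jacobi
    identity.\<close>
  then obtain x where x: "\<And>i. x i \<in> smooth_functions n m M" "\<And>i. ?L (x i \<alpha>) = ?X i"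
    "\<And>i. gf_parity m M (par i) (x i)"
    by metis
  have jacobi
  proof (rule jacobiI)
    fix a b c
    note jac = B[unfolded odd_poisson_bracket_def, THEN conjunct2, THEN conjunct2, rule_format,
        OF x(1)[of a] x(1)[of b] conjI, OF x(3) x(3)]
    have par_B: "gf_parity m M (par a + par b + 1) (?B (x a) (x b))"
      using jac by blast
    have "gf_eq m M (?B (x a) (?B (x b) (x c)))
        (?B (?B (x a) (x b)) (x c) + gscl (sg ((par a + 1) * (par b + 1))) (?B (x b) (?B (x a) (x c))))"
      using jac x(1)[of c] by blast
    then have "?L (?B (x a) (?B (x b) (x c)) \<alpha>) = ?L ((?B (?B (x a) (x b)) (x c) +
        gscl (sg ((par a + 1) * (par b + 1))) (?B (x b) (?B (x a) (x c)))) \<alpha>)"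
      unfolding loc_eq_iff gf_eq_def using \<alpha> sf_eq_subset[OF _ W(3)] by blast
    then show "bracket (par a) (?X a) (bracket (par b) (?X b) (?X c)) =
        bracket (par a + par b + 1) (bracket (par a) (?X a) (?X b)) (?X c) +
        sg ((par a + 1) * (par b + 1)) *\<^sub>R bracket (par b) (?X b) (bracket (par a) (?X a) (?X c))"
      by (simp only: plus_fun_apply gscl_def loc_add loc_scl LB[OF _ _ x(3)] LB[OF _ _ par_B] B_smooth x(1,2))
  qed
  \<comment> \<open>The restrictions of global functions form the test set. It need not be all of
    \<open>smooth_algebra n m W\<close>: containing the coordinates and their pairwise products is
    enough.\<close>
  let ?F = "(\<lambda>f. ?L (f \<alpha>)) ` smooth_functions n m M"
  have "(\<forall>F\<in>?F. lap (lap F) = 0) \<longleftrightarrow>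
      (\<forall>i\<in>coords n m. lap (?L (T i)) = 0) \<and> (\<forall>i\<in>coords n m. \<forall>j\<in>coords n m. second_symbol i j = 0)"
    unfolding T_def
  proof (rule lap_lap_eq_zero_iff[OF \<open>jacobi\<close>])
    show "?X a \<in> ?F" for a
      using x(1,2)[of a] by (metis image_eqI)
    show "?X a * ?X b \<in> ?F" for a b
    proof -
      have "sf_smooth n m (cran M \<alpha>) (coord_fun a \<star> coord_fun b)"
        by (intro sf_smooth_mult V sf_smooth_coord_fun)
      from ext[OF this] obtain g where "g \<in> smooth_functions n m M" "?L (g \<alpha>) = ?L (coord_fun a \<star> coord_fun b)"
        by (auto simp: loc_eq_iff)
      then show ?thesis
        by (metis image_eqI loc_mult)
    qed
    show "?F \<subseteq> smooth_algebra n m W"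
      using smooth by (auto simp: loc_in_smooth_algebra)
  qed
  moreover have "(\<forall>F\<in>?F. lap (lap F) = 0) \<longleftrightarrow> (\<forall>f\<in>smooth_functions n m M. sf_eq m W (\<Delta> (\<Delta> f) \<alpha>) 0)"
    by (simp only: loc_eq_iff[symmetric] L loc_zero ball_simps)
  moreover have "lap (?L (T i)) = ?L ((\<Sum>j\<in>coords n m. \<Sum>k\<in>coords n m. S \<alpha> j k \<star> pd k (pd j (T i))) +
           (\<Sum>j\<in>coords n m. T j \<star> pd j (T i)))" for i
    unfolding lap_def T_def by (simp add: loc_add loc_sum loc_mult loc_pd[OF W(1)])
  moreover have "second_symbol i j = ?L ((\<Sum>k\<in>coords n m. \<Sum>l\<in>coords n m. S \<alpha> k l \<star> pd l (pd k (S \<alpha> i j))) +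
           (\<Sum>k\<in>coords n m. T k \<star> pd k (S \<alpha> i j)) +
           (\<Sum>k\<in>coords n m. scl (sg (par i)) (S \<alpha> i k \<star> pd k (T j))) +
           (\<Sum>k\<in>coords n m. scl (sg (par j * (par i + 1))) (S \<alpha> j k \<star> pd k (T i))))" for i j
    unfolding second_symbol_def lap_def T_def
    by (simp add: loc_add loc_sum loc_mult loc_scl loc_pd[OF W(1)])
  ultimately show ?thesis
    using W(2,3) by (intro exI[of _ W] conjI) (simp_all only: loc_eq_iff[symmetric] loc_zero)
qed

text \<open>Vanishing on \<open>V\<close> is vanishing on each member of a cover, and both sides are
  built from such statements by universal quantifiers and conjunction, through which the quantifier
  over points passes.\<close>

lemma sf_eq_zero_local:
  assumes "\<And>x. x \<in> V \<Longrightarrow> \<exists>W. x \<in> W \<and> W \<subseteq> V \<and>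
    ((\<forall>f\<in>F. sf_eq m W (a f) 0) \<longleftrightarrow>
      (\<forall>i\<in>I. sf_eq m W (b i) 0) \<and> (\<forall>i\<in>I. \<forall>j\<in>I. sf_eq m W (c i j) 0))"
  shows "(\<forall>f\<in>F. sf_eq m V (a f) 0) \<longleftrightarrow>
      (\<forall>i\<in>I. sf_eq m V (b i) 0) \<and> (\<forall>i\<in>I. \<forall>j\<in>I. sf_eq m V (c i j) 0)"
proof -
  have "\<forall>x\<in>V. \<exists>W. x \<in> W \<and> W \<subseteq> V \<and> ((\<forall>f\<in>F. sf_eq m W (a f) 0) \<longleftrightarrow>
      (\<forall>i\<in>I. sf_eq m W (b i) 0) \<and> (\<forall>i\<in>I. \<forall>j\<in>I. sf_eq m W (c i j) 0))"
    using assms by (rule ballI)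
  \<comment> \<open>One neighbourhood is chosen per point, so that both sides of the equivalence are
    decomposed along the same cover.\<close>
  from bchoice[OF this] obtain W where W: "\<forall>x\<in>V. x \<in> W x \<and> W x \<subseteq> V \<and>
      ((\<forall>f\<in>F. sf_eq m (W x) (a f) 0) \<longleftrightarrow>
        (\<forall>i\<in>I. sf_eq m (W x) (b i) 0) \<and> (\<forall>i\<in>I. \<forall>j\<in>I. sf_eq m (W x) (c i j) 0))"
    by (rule exE)
  have nbhd: "x \<in> W x" "W x \<subseteq> V" if "x \<in> V" for x
    using W that by simp_all
  have eq: "sf_eq m V f 0 \<longleftrightarrow> (\<forall>x\<in>V. sf_eq m (W x) f 0)" for f
  proof
    assume "\<forall>x\<in>V. sf_eq m (W x) f 0"
    then show "sf_eq m V f 0"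
      using nbhd(1) by (simp add: sf_eq_def)
  qed (use nbhd(2) sf_eq_subset in blast)
  have "(\<forall>f\<in>F. sf_eq m V (a f) 0) \<longleftrightarrow> (\<forall>x\<in>V. \<forall>f\<in>F. sf_eq m (W x) (a f) 0)"
    unfolding eq by blast
  also have "\<dots> \<longleftrightarrow> (\<forall>x\<in>V. (\<forall>i\<in>I. sf_eq m (W x) (b i) 0) \<and> (\<forall>i\<in>I. \<forall>j\<in>I. sf_eq m (W x) (c i j) 0))"
    using W by (intro ball_cong refl) simp
  also have "\<dots> \<longleftrightarrow> (\<forall>i\<in>I. sf_eq m V (b i) 0) \<and> (\<forall>i\<in>I. \<forall>j\<in>I. sf_eq m V (c i j) 0)"
    unfolding eq by blast
  finally show ?thesis .
qed

theorem theorem4p2: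
  fixes n m :: nat
    and M :: "('a, 'c) atlas"
    and P :: "'c connection"
    and S :: "'c \<Rightarrow> idx \<Rightarrow> idx \<Rightarrow> sfun"
  assumes "supermanifold n m M"
    and "real n - real m + 1 \<noteq> 0"
    and "real n - real m + 3 \<noteq> 0"
    and "projective_class n m M P"
    and "master_hamiltonian n m M S"
    and "odd_poisson_bracket n m M (odd_bracket n m S)"
  shows "BV_operator n m M (odd_bracket n m S) (projective_laplacian n m S P) \<longleftrightarrow>
    (\<forall>\<alpha>\<in>charts M.
       let T = proj_T n m (S \<alpha>) (P \<alpha>) in
       (\<forall>i\<in>coords n m. sf_eq m (cran M \<alpha>)
          ((\<Sum>j\<in>coords n m. \<Sum>k\<in>coords n m. S \<alpha> j k \<star> pd k (pd j (T i))) +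
           (\<Sum>j\<in>coords n m. T j \<star> pd j (T i)))
          0) \<and>
       (\<forall>i\<in>coords n m. \<forall>j\<in>coords n m. sf_eq m (cran M \<alpha>)
          ((\<Sum>k\<in>coords n m. \<Sum>l\<in>coords n m. S \<alpha> k l \<star> pd l (pd k (S \<alpha> i j))) +
           (\<Sum>k\<in>coords n m. T k \<star> pd k (S \<alpha> i j)) +
           (\<Sum>k\<in>coords n m. scl (sg (par i)) (S \<alpha> i k \<star> pd k (T j))) +
           (\<Sum>k\<in>coords n m. scl (sg (par j * (par i + 1))) (S \<alpha> j k \<star> pd k (T i))))
          0))"
    (is "_ \<longleftrightarrow> (\<forall>\<alpha>\<in>charts M. let T = ?T \<alpha> in (\<forall>i\<in>?C. sf_eq m _ (?E1 \<alpha> T i) 0) \<and>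
      (\<forall>i\<in>?C. \<forall>j\<in>?C. sf_eq m _ (?E2 \<alpha> T i j) 0))")
proof -
  let ?D = "projective_laplacian n m S P"
  have BV: "BV_operator n m M (odd_bracket n m S) ?D \<longleftrightarrow>
      (\<forall>\<alpha>\<in>charts M. \<forall>f\<in>smooth_functions n m M. sf_eq m (cran M \<alpha>) (?D (?D f) \<alpha>) 0)"
    using projective_laplacian_generates_bracket[OF assms(1,4,5)]
    by (auto simp: BV_operator_def gf_eq_def)
  have "(\<forall>f\<in>smooth_functions n m M. sf_eq m (cran M \<alpha>) (?D (?D f) \<alpha>) 0) \<longleftrightarrow>
      (\<forall>i\<in>?C. sf_eq m (cran M \<alpha>) (?E1 \<alpha> (?T \<alpha>) i) 0) \<and>
      (\<forall>i\<in>?C. \<forall>j\<in>?C. sf_eq m (cran M \<alpha>) (?E2 \<alpha> (?T \<alpha>) i j) 0)" if \<alpha>: "\<alpha> \<in> charts M" for \<alpha>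
    by (intro sf_eq_zero_local square_zero_near[OF assms(1,4-6) \<alpha>])
  then show ?thesis
    unfolding BV Let_def by (intro ball_cong refl)
qed

end
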